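(* Let $n$ be a nonnegative integer and let $\vartheta$ be a nontrivial even probability measure on $\mathbb{R}/\mathbb{Z}$. Let $\varphi_{n+1}$ be the $(n+1)$-th orthonormal polynomial on the unit circle with respect to $\vartheta$, and let $K_n,A_{n+1},B_{n+1}$ be the associated kernel and companion polynomials (defined in the context). Let $\mathcal{A}_{n+1}=\{\xi\in\mathbb{R}/\mathbb{Z}:A_{n+1}(e^{2\pi i\xi})=0\}$ and $\mathcal{B}_{n+1}=\{\xi\in\mathbb{R}/\mathbb{Z}:B_{n+1}(e^{2\pi i\xi})=0\}$. For a nonnegative Borel measure $\varsigma$ on $(0,\infty)$ let $$h_\varsigma(x)=\int_0^\infty\Big\{\lambda^{-1/2}\theta_3(x,i\lambda^{-1})-\lambda^{-1/2}\theta_3(\tfrac12,i\lambda^{-1})\Big\}\,d\varsigma(\lambda).$$ (i) Suppose $\int_0^\infty\lambda^{-1/2}e^{-\pi\lambda^{-1}-a\lambda}\,d\varsigma(\lambda)<\infty$ for every $a>0$. If $\ell\in\Lambda_n$ satisfies $\ell(x)\le h_\varsigma(x)$ for all $x\in\mathbb{R}$, then $$\int_{\mathbb{R}/\mathbb{Z}}\ell(x)\,d\vartheta(x)\ \le\ \sum_{\xi\in\mathcal{A}_{n+1}}\frac{h_\varsigma(\xi)}{K_n(e^{2\pi i\xi},e^{2\pi i\xi})}.$$ Moreover, there exists a unique real trigonometric polynomial $z\mapsto\ell_\vartheta(n,\varsigma,z)\in\Lambda_n$ with $\ell_\vartheta(n,\varsigma,x)\le h_\varsigma(x)$ for all $x\in\mathbb{R}$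 for which equality holds. (ii) Suppose $\int_0^\infty(1+\lambda^{-1/2})e^{-\pi\lambda^{-1}}\,d\varsigma(\lambda)<\infty$. If $m\in\Lambda_n$ satisfies $m(x)\ge h_\varsigma(x)$ for all $x\in\mathbb{R}$, then $$\int_{\mathbb{R}/\mathbb{Z}}m(x)\,d\vartheta(x)\ \ge\ \sum_{\xi\in\mathcal{B}_{n+1}}\frac{h_\varsigma(\xi)}{K_n(e^{2\pi i\xi},e^{2\pi i\xi})}.$$ Moreover, there exists a unique real trigonometric polynomial $z\mapsto m_\vartheta(n,\varsigma,z)\in\Lambda_n$ with $m_\vartheta(n,\varsigma,x)\ge h_\varsigma(x)$ for all $x\in\mathbb{R}$ for which equality holds.
   Context: $\Lambda_n$ is the space of trigonometric polynomials $\sum_{k=-n}^n a_ke^{2\pi ikz}$, $a_k\in\mathbb{C}$; such a polynomial is real if it is real-valued for real $z$ (inequalities on $\mathbb{R}$ include real-valuedness). For $\operatorname{Im}\tau>0$, $\theta_3(z,\tau)=\sum_{k\in\mathbb{Z}}e^{\pi i\tau k^2+2\pi ikz}$; for $\lambda>0$, $\lambda^{-1/2}\theta_3(z,i\lambda^{-1})=\sum_{j\in\mathbb{Z}}e^{-\pi\lambda(j-z)^2}$. Measures on $\mathbb{R}/\mathbb{Z}$ are identified with measures on the unit circle $\partial\mathbb{D}$ via $x\mapsto e^{2\pi ix}$. A measure is nontrivial if it does not have finite support, and even if it is invariant under $x\mapsto-x$ (equivalently, under complex conjugation on $\partial\mathbb{D}$). $\{\varphi_n\}_{n\ge0}$ are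 the orthonormal polynomials ($\deg\varphi_n=n$, positive leading coefficient) for $\langle f,g\rangle=\int_{\partial\mathbb{D}}f\overline g\,d\vartheta$; since $\vartheta$ is even they have real coefficients. For a polynomial $P$ of degree $n$, $P^*(z)=z^n\overline{P(\overline z^{-1})}$. Define $$A_{n+1}=\tfrac12(\varphi_{n+1}^*+\varphi_{n+1}),\qquad B_{n+1}=\tfrac i2(\varphi_{n+1}^*-\varphi_{n+1}),$$ polynomials of degree $n+1$ whose zeros are simple and lie on the unit circle, and $$K_n(w,z)=\frac{\varphi_{n+1}^*(z)\overline{\varphi_{n+1}^*(w)}-\varphi_{n+1}(z)\overline{\varphi_{n+1}(w)}}{1-\overline wz}$$ (extended by continuity when $\overline wz=1$), which is the reproducing kernel of the space of algebraic polynomials of degree at most $n$ with the inner product $\langle f,g\rangle=\int_{\partial\mathbb{D}}f\overline g\,d\vartheta$. Under the condition in (i), $h_\varsigma(x)$ is finite for $x\notin\mathbb{Z}$ and possibly $h_\varsigma(0)=\infty$; under the condition in (ii), $h_\varsigma$ is finite everywhere. *)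

theory Defs
  imports "HOL-Probability.Probability" "HOL-Computational_Algebra.Polynomial"
begin

text \<open>
  The group \<open>\<real>/\<int>\<close> is represented by the fundamental domain \<open>[0,1)\<close>. Since
  \<open>x \<mapsto> e\<^sup>2\<^sup>\<pi>\<^sup>i\<^sup>x\<close> is a Borel isomorphism of \<open>[0,1)\<close> onto the unit circle, Borel measures
  on \<open>\<real>/\<int>\<close> are exactly the Borel measures on \<open>[0,1)\<close>.
\<close>

definition torus_borel :: "real measure" where
  "torus_borel = restrict_space borel {0..<1}"

definition circle_measure :: "real measure \<Rightarrow> complex measure" where
  "circle_measure \<theta> = distr \<theta> (restrict_space borel (sphere 0 1)) (\<lambda>x. cis (2 * pi * x))"

definition measure_support :: "'a::topological_space measure \<Rightarrow> 'a set" where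
  "measure_support M =
     {x \<in> space M. \<forall>U. open U \<longrightarrow> x \<in> U \<longrightarrow> emeasure M (U \<inter> space M) > 0}"

text \<open>
  The support is taken on the circle, because the topology of \<open>[0,1)\<close> is not that of
  \<open>\<real>/\<int>\<close>. In the next definition, \<open>frac (- x)\<close> is the representative of \<open>- x\<close> modulo 1.
\<close>

definition nontrivial_measure :: "real measure \<Rightarrow> bool" where
  "nontrivial_measure \<theta> \<longleftrightarrow> infinite (measure_support (circle_measure \<theta>))"

definition even_measure :: "real measure \<Rightarrow> bool" where
  "even_measure \<theta> \<longleftrightarrow> distr \<theta> \<theta> (\<lambda>x. frac (- x)) = \<theta>"

definition circle_inner :: "real measure \<Rightarrow> complex poly \<Rightarrow> complex poly \<Rightarrow> complex" where
  "circle_inner \<theta> p q = (\<integral>z. poly p z * cnj (poly q z) \<partial>circle_measure \<theta>)"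

definition orthonormal_polys :: "real measure \<Rightarrow> (nat \<Rightarrow> complex poly) \<Rightarrow> bool" where
  "orthonormal_polys \<theta> \<phi> \<longleftrightarrow>
     (\<forall>k. degree (\<phi> k) = k \<and> lead_coeff (\<phi> k) \<in> \<real> \<and> Re (lead_coeff (\<phi> k)) > 0) \<and>
     (\<forall>j k. circle_inner \<theta> (\<phi> j) (\<phi> k) = (if j = k then 1 else 0))"

definition star_poly :: "complex poly \<Rightarrow> complex poly" where
  "star_poly p = map_poly cnj (reflect_poly p)"

lemma poly_star_poly:
  assumes "z \<noteq> 0"
  shows "poly (star_poly p) z = z ^ degree p * cnj (poly p (inverse (cnj z)))"
proof -
  have cnj_map: "poly (map_poly cnj q) u = cnj (poly q (cnj u))" for q u
    by (induction q) (simp_all add: map_poly_pCons)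
  show ?thesis
    using assms by (simp add: star_poly_def cnj_map poly_reflect_poly_nz)
qed

definition companion_A :: "(nat \<Rightarrow> complex poly) \<Rightarrow> nat \<Rightarrow> complex poly" where
  "companion_A \<phi> k = smult (1 / 2) (star_poly (\<phi> k) + \<phi> k)"

definition companion_B :: "(nat \<Rightarrow> complex poly) \<Rightarrow> nat \<Rightarrow> complex poly" where
  "companion_B \<phi> k = smult (\<i> / 2) (star_poly (\<phi> k) - \<phi> k)"

definition kernel_quotient ::
    "(nat \<Rightarrow> complex poly) \<Rightarrow> nat \<Rightarrow> complex \<Rightarrow> complex \<Rightarrow> complex" where
  "kernel_quotient \<phi> n w z =
     (poly (star_poly (\<phi> (n + 1))) z * cnj (poly (star_poly (\<phi> (n + 1))) w)
        - poly (\<phi> (n + 1)) z * cnj (poly (\<phi> (n + 1)) w)) / (1 - cnj w * z)"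

text \<open>
  For fixed \<open>w \<noteq> 0\<close> the denominator vanishes only at \<open>z = 1 / cnj w\<close>, where the
  numerator vanishes as well; the value there is the limit in the second argument.
\<close>

definition repr_kernel ::
    "(nat \<Rightarrow> complex poly) \<Rightarrow> nat \<Rightarrow> complex \<Rightarrow> complex \<Rightarrow> complex" where
  "repr_kernel \<phi> n w z =
     (if cnj w * z = 1 then Lim (at z) (kernel_quotient \<phi> n w) else kernel_quotient \<phi> n w z)"

definition torus_zeros :: "complex poly \<Rightarrow> real set" where
  "torus_zeros p = {\<xi> \<in> {0..<1}. poly p (cis (2 * pi * \<xi>)) = 0}"

definition trig_polys :: "nat \<Rightarrow> (complex \<Rightarrow> complex) set" where
  "trig_polys n =
     {f. \<exists>a :: int \<Rightarrow> complex.
           f = (\<lambda>z. \<Sum>k = - int n..int n. a k * exp (2 * of_real pi * \<i> * of_int k * z))}"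

definition real_on_line :: "(complex \<Rightarrow> complex) \<Rightarrow> bool" where
  "real_on_line f \<longleftrightarrow> (\<forall>x::real. f (of_real x) \<in> \<real>)"

definition minorant :: "(complex \<Rightarrow> complex) \<Rightarrow> (real \<Rightarrow> ereal) \<Rightarrow> bool" where
  "minorant f h \<longleftrightarrow> real_on_line f \<and> (\<forall>x::real. ereal (Re (f (of_real x))) \<le> h x)"

definition majorant :: "(complex \<Rightarrow> complex) \<Rightarrow> (real \<Rightarrow> ereal) \<Rightarrow> bool" where
  "majorant f h \<longleftrightarrow> real_on_line f \<and> (\<forall>x::real. h x \<le> ereal (Re (f (of_real x))))"

definition theta3 :: "complex \<Rightarrow> complex \<Rightarrow> complex" where
  "theta3 z \<tau> =
     (\<Sum>\<^sub>\<infinity>k::int. exp (of_real pi * \<i> * \<tau> * of_int k ^ 2 + 2 * of_real pi * \<i> * of_int k * z))"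

text \<open>
  For real \<open>x\<close> and \<open>\<lambda> > 0\<close> the theta values below are real (pair \<open>k\<close> with \<open>- k\<close>),
  so taking real parts only changes the type.
\<close>

definition theta_diff :: "real \<Rightarrow> real \<Rightarrow> real" where
  "theta_diff l x =
     l powr (- 1 / 2) * Re (theta3 (of_real x) (\<i> * of_real (1 / l)))
     - l powr (- 1 / 2) * Re (theta3 (1 / 2) (\<i> * of_real (1 / l)))"

text \<open>
  The Lebesgue integral with values in the extended reals, as the integral of the positive part
  minus that of the negative part (\<open>ennreal\<close> truncates at 0). This keeps a possible value
  \<open>\<infinity>\<close> at integers, where the Bochner integral would return 0.
\<close>

definition gauss_h :: "real measure \<Rightarrow> real \<Rightarrow> ereal" where
  "gauss_h \<sigma> x =
     enn2ereal (\<integral>\<^sup>+l. ennreal (theta_diff l x) \<partial>\<sigma>)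
     - enn2ereal (\<integral>\<^sup>+l. ennreal (- theta_diff l x) \<partial>\<sigma>)"

definition torus_integral :: "real measure \<Rightarrow> (complex \<Rightarrow> complex) \<Rightarrow> real" where
  "torus_integral \<theta> f = (\<integral>x. Re (f (of_real x)) \<partial>\<theta>)"

text \<open>
  The kernel is real on the diagonal. The sum is taken in the extended reals since
  \<open>h\<close> is extended-valued.
\<close>

definition quadrature_sum ::
    "(nat \<Rightarrow> complex poly) \<Rightarrow> nat \<Rightarrow> real set \<Rightarrow> (real \<Rightarrow> ereal) \<Rightarrow> ereal" where
  "quadrature_sum \<phi> n S h =
     (\<Sum>\<xi>\<in>S. h \<xi> / ereal (Re (repr_kernel \<phi> n (cis (2 * pi * \<xi>)) (cis (2 * pi * \<xi>)))))"

end

theory Submission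
  imports Defs "HOL-Computational_Algebra.Fundamental_Theorem_Algebra"
begin

text \<open>
  Write \<open>s = 1 + cos 2\<pi>x\<close>, which runs through \<open>[0, 2]\<close>. The Jacobi triple product makes \<open>\<theta>\<^sub>3\<close> a
  positive multiple of a product of factors \<open>1 + c\<^sub>k s\<close> with \<open>c\<^sub>k > 0\<close>, so \<open>h\<^sub>\<sigma>\<close> is a power series in \<open>s\<close> with
  nonnegative coefficients and without constant term. Dividing such a series by \<open>s - r\<close> with
  \<open>0 \<le> r < 2\<close> leaves a constant and a series of the same kind. Dividing twice by
  \<open>s - s(\<xi>)\<close> for the nodes \<open>0 < \<xi> < 1/2\<close>, once by \<open>s\<close> if \<open>1/2\<close> is a node and once by \<open>s - 2\<close> if
  \<open>0\<close> is a node gives \<open>h\<^sub>\<sigma> = P(s) + \<omega>(s) g(s)\<close> with \<open>deg P \<le> n\<close>, \<open>g \<ge> 0\<close>, and \<open>\<omega>\<close> of constant sign,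
  nonnegative exactly when \<open>0\<close> is not a node. The zeros of \<open>A\<^sub>n\<^sub>+\<^sub>1\<close> and of \<open>B\<^sub>n\<^sub>+\<^sub>1\<close> are the nodes of
  quadrature rules that are exact on \<open>\<Lambda>\<^sub>n\<close> with the positive weights \<open>1/K\<^sub>n\<close>. They are symmetric
  because \<open>\<theta>\<close> is even; the point \<open>0\<close> is never a zero of \<open>A\<^sub>n\<^sub>+\<^sub>1\<close> and always one of \<open>B\<^sub>n\<^sub>+\<^sub>1\<close>. Uniqueness
  holds because two extremal polynomials agree to second order at every node other than \<open>0\<close>.
\<close>

section \<open>Orthogonal polynomials on the unit circle\<close>


text \<open>A factor in \<open>s\<close> counts differently in \<open>x\<close>: the nodes \<xi> and
  1 - \<xi> share one value of \<open>s\<close>, and \<open>s\<close> is critical at 1/2 and at 0,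
  so a simple factor there is already of second order in \<open>x\<close>. This is why n + 1 nodes
  take exactly n + 1 divisions and the interpolant has degree at most n in \<open>s\<close>. The
  delicate point is s = 2. In (i) the series may diverge there, so it is used only for s < 2, and
  the inequality at the integers is a limit. In (ii) the series converges at 2, but after division
  by s - 2 it need not, so at the node 0 uniqueness can use equality of values only. The count still
  suffices: 2n + 1 zeros are more than a nonzero element of \<open>trig_polys n\<close> can have in
  a period. Contact of second order is not derived from smoothness of h. The difference of two
  extremal polynomials is bounded below near a node by a multiple of a function that vanishes there
  to second order. Convergence for s < 2 needs exponential decay of the integrand as
  \<open>l\<close> grows. It comes from comparing the factors of the triple product at a given angle
  with those at angle 0.\<close>

locale circle_prob = prob_space \<theta> for \<theta> :: "real measure" +
  assumes sets_theta: "sets \<theta> = sets torus_borel"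
begin

lemma borel_measurable_theta:
  assumes "f \<in> borel_measurable borel"
  shows "f \<in> borel_measurable \<theta>"
proof -
  have "f \<in> borel_measurable torus_borel"
    unfolding torus_borel_def using assms by (rule measurable_restrict_space1)
  then show ?thesis
    using measurable_cong_sets[OF sets_theta refl] by blast
qed

lemma cis_measurable: "(\<lambda>x. cis (2 * pi * x)) \<in> \<theta> \<rightarrow>\<^sub>M restrict_space borel (sphere 0 1)"
proof (rule measurable_restrict_space2)
  have "continuous_on UNIV (\<lambda>x. cis (2 * pi * x))"
    by (intro continuous_intros)
  then have "(\<lambda>x. cis (2 * pi * x)) \<in> borel_measurable borel"
    by (rule borel_measurable_continuous_onI)
  then show "(\<lambda>x. cis (2 * pi * x)) \<in> borel_measurable \<theta>"
    by (rule borel_measurable_theta)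
qed (rule Pi_I, simp only: mem_sphere dist_0_norm norm_cis)

lemma integrable_circle:
  fixes g :: "complex \<Rightarrow> 'b::{banach, second_countable_topology}"
  assumes "continuous_on (sphere 0 1) g"
  shows "integrable \<theta> (\<lambda>x. g (cis (2 * pi * x)))"
proof -
  have "bounded (g ` sphere 0 1)"
    using assms compact_imp_bounded compact_continuous_image compact_sphere by blast
  then obtain B where B: "\<And>z. z \<in> sphere 0 1 \<Longrightarrow> norm (g z) \<le> B"
    unfolding bounded_iff by blast
  have "g \<in> borel_measurable (restrict_space borel (sphere 0 1))"
    using assms by (rule borel_measurable_continuous_on_restrict)
  from measurable_compose[OF cis_measurable this]
  have "(\<lambda>x. g (cis (2 * pi * x))) \<in> borel_measurable \<theta>" .
  moreover have "AE x in \<theta>. norm (g (cis (2 * pi * x))) \<le> B"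
    by (intro AE_I2 B) (simp only: mem_sphere dist_0_norm norm_cis)
  ultimately show ?thesis
    by (rule integrable_const_bound[rotated])
qed

lemma circle_inner_eq:
  "circle_inner \<theta> p q = (\<integral>x. poly p (cis (2 * pi * x)) * cnj (poly q (cis (2 * pi * x))) \<partial>\<theta>)"
  unfolding circle_inner_def circle_measure_def
  by (rule integral_distr[OF cis_measurable], (rule borel_measurable_continuous_on_restrict
     continuous_on_mult continuous_on_cnj continuous_on_poly continuous_on_id)+)

lemma integrable_inner:
  "integrable \<theta> (\<lambda>x. poly p (cis (2 * pi * x)) * cnj (poly q (cis (2 * pi * x))))"
  by (rule integrable_circle[where g = "\<lambda>z. poly p z * cnj (poly q z)"])
    (rule continuous_on_mult continuous_on_cnj continuous_on_poly continuous_on_id)+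

lemma inner_add_left: "circle_inner \<theta> (p + p') q = circle_inner \<theta> p q + circle_inner \<theta> p' q"
  by (simp add: circle_inner_eq ring_distribs integrable_inner)

lemma inner_smult_left: "circle_inner \<theta> (smult c p) q = c * circle_inner \<theta> p q"
  by (simp add: circle_inner_eq mult.assoc)

lemma inner_cnj: "cnj (circle_inner \<theta> p q) = circle_inner \<theta> q p"
  unfolding circle_inner_eq
  by (simp only: Bochner_Integration.integral_cnj [symmetric] complex_cnj_mult complex_cnj_cnj mult.commute)

lemma inner_cong:
  assumes "\<And>z. norm z = 1 \<Longrightarrow> poly p z * cnj (poly q z) = poly p' z * cnj (poly q' z)"
  shows "circle_inner \<theta> p q = circle_inner \<theta> p' q'"
  unfolding circle_inner_eq using assms by simp

lemma inner_add_right: "circle_inner \<theta> q (p + p') = circle_inner \<theta> q p + circle_inner \<theta> q p'"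
  by (metis inner_add_left inner_cnj complex_cnj_add)

lemma inner_smult_right: "circle_inner \<theta> q (smult c p) = cnj c * circle_inner \<theta> q p"
  by (metis inner_smult_left inner_cnj complex_cnj_mult)

lemma inner_zero [simp]: "circle_inner \<theta> 0 q = 0" "circle_inner \<theta> q 0 = 0"
  by (simp_all add: circle_inner_eq)

lemma inner_diff_left: "circle_inner \<theta> (p - p') q = circle_inner \<theta> p q - circle_inner \<theta> p' q"
  by (metis (no_types) inner_add_left add_diff_cancel_right' diff_add_cancel)

lemma inner_diff_right: "circle_inner \<theta> q (p - p') = circle_inner \<theta> q p - circle_inner \<theta> q p'"
  by (metis (no_types) inner_add_right add_diff_cancel_right' diff_add_cancel)

lemma inner_sum_left: "circle_inner \<theta> (\<Sum>i\<in>I. p i) q = (\<Sum>i\<in>I. circle_inner \<theta> (p i) q)"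
  by (induction I rule: infinite_finite_induct) (simp_all add: inner_add_left)

lemma inner_sum_right: "circle_inner \<theta> q (\<Sum>i\<in>I. p i) = (\<Sum>i\<in>I. circle_inner \<theta> q (p i))"
  by (induction I rule: infinite_finite_induct) (simp_all add: inner_add_right)

lemma inner_self_real: "circle_inner \<theta> p p = of_real (Re (circle_inner \<theta> p p))"
  using inner_cnj[of p p] by (simp add: complex_eq_iff)

lemma inner_self_nonneg: "Re (circle_inner \<theta> p p) \<ge> 0"
proof -
  have "Re (circle_inner \<theta> p p) = (\<integral>x. Re (poly p (cis (2 * pi * x)) * cnj (poly p (cis (2 * pi * x)))) \<partial>\<theta>)"
    unfolding circle_inner_eq by (simp only: integral_Re[OF integrable_inner])
  also have "\<dots> \<ge> 0"
    by (intro integral_nonneg_AE AE_I2) (simp add: complex_mult_cnj)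
  finally show ?thesis .
qed

end

locale opuc = circle_prob \<theta> for \<theta> +
  fixes \<phi> :: "nat \<Rightarrow> complex poly"
  assumes orthonormal: "orthonormal_polys \<theta> \<phi>"
begin

lemma degree_phi [simp]: "degree (\<phi> k) = k"
  using orthonormal by (auto simp: orthonormal_polys_def)

lemma lead_phi: "coeff (\<phi> k) k = of_real (Re (coeff (\<phi> k) k))" "Re (coeff (\<phi> k) k) > 0"
  using orthonormal degree_phi[of k]
  unfolding orthonormal_polys_def by (metis of_real_Re)+

lemma lead_phi_nonzero: "coeff (\<phi> k) k \<noteq> 0"
  using lead_phi(2)[of k] by auto

lemma inner_phi: "circle_inner \<theta> (\<phi> j) (\<phi> k) = (if j = k then 1 else 0)"
  using orthonormal by (auto simp: orthonormal_polys_def)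

lemma phi_expansion: "degree p < k \<Longrightarrow> \<exists>c. p = (\<Sum>j<k. smult (c j) (\<phi> j))"
proof (induction k arbitrary: p)
  case (Suc k)
  define a where "a = coeff p k / coeff (\<phi> k) k"
  define q where "q = p - smult a (\<phi> k)"
  have dq: "degree q \<le> k"
    unfolding q_def using Suc.prems by (intro degree_diff_le) auto
  have "coeff q k = 0"
    unfolding q_def a_def using lead_phi_nonzero[of k] by simp
  then have q: "q = 0 \<or> degree q < k"
    using dq by (metis leading_coeff_0_iff le_neq_implies_less)
  obtain c where "q = (\<Sum>j<k. smult (c j) (\<phi> j))"
  proof (cases "q = 0")
    case True
    then show ?thesis using that[of "\<lambda>_. 0"] by simp
  next
    case False
    then show ?thesis using Suc.IH q that by blast
  qed
  then have "p = (\<Sum>j<Suc k. smult ((c(k := a)) j) (\<phi> j))"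
    by (simp add: q_def algebra_simps)
  then show ?case by blast
qed simp

lemma inner_phi_lower:
  assumes "degree p < k"
  shows "circle_inner \<theta> p (\<phi> k) = 0"
proof -
  obtain c where "p = (\<Sum>j<k. smult (c j) (\<phi> j))"
    using phi_expansion[OF assms] by blast
  then show ?thesis
    by (auto simp: inner_sum_left inner_smult_left inner_phi intro!: sum.neutral)
qed

text \<open>Parseval: the family has one member in each degree and therefore spans, so the inner
  product of \<open>p\<close> with itself is the sum of the squared moduli of its coefficients in
  the family.\<close>

lemma inner_definite:
  assumes "circle_inner \<theta> p p = 0"
  shows "p = 0"
proof -
  obtain c where p: "p = (\<Sum>j<Suc (degree p). smult (c j) (\<phi> j))"
    using phi_expansion[of p "Suc (degree p)"] by blast
  have pj: "circle_inner \<theta> p (\<phi> j) = c j" if "j < Suc (degree p)" for j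
    using that by (subst p, unfold inner_sum_left inner_smult_left inner_phi)
      (simp add: if_distrib cong: if_cong del: sum.lessThan_Suc)
  have "circle_inner \<theta> p p = (\<Sum>j<Suc (degree p). c j * cnj (c j))"
    apply (subst (2) p)
    unfolding inner_sum_right inner_smult_right
    by (intro sum.cong refl) (simp add: pj mult.commute)
  also have "\<dots> = of_real (\<Sum>j<Suc (degree p). (norm (c j))\<^sup>2)"
    by (simp only: of_real_sum complex_norm_square)
  finally have "(\<Sum>j<Suc (degree p). (norm (c j))\<^sup>2) = 0"
    using assms by (metis of_real_eq_0_iff)
  then have "\<forall>j\<in>{..<Suc (degree p)}. (norm (c j))\<^sup>2 = 0"
    by (subst (asm) sum_nonneg_eq_0_iff) auto
  then show ?thesis
    by (subst p) (auto intro!: sum.neutral)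
qed

lemma inner_self_pos: "p \<noteq> 0 \<Longrightarrow> Re (circle_inner \<theta> p p) > 0"
  using inner_definite[of p] inner_self_real[of p] inner_self_nonneg[of p]
  by (metis less_eq_real_def of_real_0)

end

section \<open>Para-orthogonal polynomials and quadrature\<close>


lemma coeff_star_poly: "coeff (star_poly p) i = (if i \<le> degree p then cnj (coeff p (degree p - i)) else 0)"
  by (simp add: star_poly_def coeff_map_poly coeff_reflect_poly)

lemma degree_star_poly_le: "degree (star_poly p) \<le> degree p"
  by (intro degree_le) (simp add: coeff_star_poly)

lemma cnj_circle:
  assumes "norm z = 1"
  shows "cnj z = inverse z"
proof -
  have "z * cnj z = 1"
    by (subst complex_norm_square[symmetric]) (use assms in simp)
  then show ?thesis
    by (simp add: inverse_unique)
qed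

lemma cnj_diff_circle:
  assumes "norm z = 1" "norm w = 1"
  shows "cnj (z - w) * (z * w) = w - z"
  using assms by (auto simp: cnj_circle field_simps)

lemma poly_star_circle: "norm z = 1 \<Longrightarrow> poly (star_poly p) z = z ^ degree p * cnj (poly p z)"
  by (subst poly_star_poly) (auto simp: cnj_circle)

text \<open>\<open>star_poly\<close> reverses at the actual degree of \<open>p\<close>; the factor
  \<open>monom 1 (k - degree p)\<close> turns this into the reversal at a prescribed degree
  \<open>k\<close>.\<close>

lemma circle_reverse:
  assumes "degree p \<le> k"
  obtains q where "degree q \<le> k" "coeff q k = cnj (coeff p 0)"
    "\<And>z. norm z = 1 \<Longrightarrow> poly q z = z ^ k * cnj (poly p z)"
proof
  let ?q = "monom 1 (k - degree p) * star_poly p"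
  show "degree ?q \<le> k"
  proof -
    have "degree ?q \<le> degree (monom (1::complex) (k - degree p)) + degree (star_poly p)"
      by (rule degree_mult_le)
    also have "\<dots> \<le> (k - degree p) + degree p"
      by (intro add_mono degree_monom_le degree_star_poly_le)
    finally show ?thesis using assms by simp
  qed
  show "coeff ?q k = cnj (coeff p 0)"
    using assms by (simp add: coeff_monom_mult coeff_star_poly)
  show "poly ?q z = z ^ k * cnj (poly p z)" if "norm z = 1" for z
    using assms that by (simp add: poly_monom poly_star_circle flip: mult.assoc power_add)
qed

text \<open>The point \<open>w\<close> is exempted because in the application the vanishing is
  obtained after multiplication by \<open>z - w\<close>. The arc \<open>cis {0..1}\<close> already
  supplies infinitely many zeros, since \<open>cos\<close> is injective on an interval containing
  [0, 1].\<close>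

lemma poly_zero_on_circle:
  assumes "\<And>z. norm z = 1 \<Longrightarrow> z \<noteq> w \<Longrightarrow> poly p z = 0"
  shows "p = (0 :: complex poly)"
proof (rule ccontr)
  assume "p \<noteq> 0"
  then have "finite (insert w {z. poly p z = 0})"
    by (simp add: poly_roots_finite)
  then have "finite (cis ` {0..1})"
    by (rule finite_subset[rotated]) (use assms in auto)
  moreover have "inj_on cis {0..1}"
  proof (rule inj_onI)
    fix x y :: real
    assume xy: "x \<in> {0..1}" "y \<in> {0..1}" "cis x = cis y"
    then have "x \<le> pi" "y \<le> pi" "0 \<le> x" "0 \<le> y" "cos x = cos y"
      using pi_ge_two by (auto simp: complex_eq_iff)
    then show "x = y"
      using cos_inj_pi by blast
  qed
  ultimately have "finite {0..1::real}"
    using finite_imageD by blast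
  then show False
    by (simp add: infinite_Icc)
qed

section \<open>Zeros of the para-orthogonal polynomials\<close>

locale para_orthogonal = opuc +
  fixes n :: nat and \<epsilon> :: complex
  assumes eps: "\<epsilon> = 1 \<or> \<epsilon> = - 1"
begin

abbreviation \<Phi> :: "complex poly" where "\<Phi> \<equiv> \<phi> (Suc n)"

text \<open>
  This is \<open>2A\<^sub>n\<^sub>+\<^sub>1\<close> for \<open>\<epsilon> = 1\<close> and \<open>- 2\<i>B\<^sub>n\<^sub>+\<^sub>1\<close> for \<open>\<epsilon> = - 1\<close>.
\<close>

definition para :: "complex poly" where
  "para = star_poly \<Phi> + smult \<epsilon> \<Phi>"

lemma eps_simps [simp]: "\<epsilon> * \<epsilon> = 1" "cnj \<epsilon> = \<epsilon>" "\<epsilon> \<noteq> 0"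
  using eps by auto

lemma degree_para_le: "degree para \<le> Suc n"
  unfolding para_def using degree_star_poly_le[of \<Phi>] by (intro degree_add_le) auto

text \<open>On the circle, reversing both arguments at degree n + 1 swaps them in the inner product.
  The constant coefficient of \<open>p\<close> becomes the top coefficient of the reversed
  polynomial, so its vanishing lowers the degree and orthogonality of \<Phi> applies.\<close>

lemma inner_star_phi:
  assumes "coeff p 0 = 0" "degree p \<le> Suc n"
  shows "circle_inner \<theta> p (star_poly \<Phi>) = 0"
proof -
  obtain q where q: "degree q \<le> Suc n" "coeff q (Suc n) = cnj (coeff p 0)"
    "\<And>z. norm z = 1 \<Longrightarrow> poly q z = z ^ Suc n * cnj (poly p z)"
    using circle_reverse[OF assms(2)] by metis
  have "degree q < Suc n"
    using q(1,2) assms(1)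
    by (metis complex_cnj_zero degree_0 leading_coeff_0_iff le_neq_implies_less zero_less_Suc)
  then have "circle_inner \<theta> \<Phi> q = 0"
    using inner_phi_lower[of q "Suc n"] inner_cnj[of q \<Phi>] by simp
  moreover have "circle_inner \<theta> p (star_poly \<Phi>) = circle_inner \<theta> \<Phi> q"
    by (rule inner_cong) (simp add: q(3) poly_star_circle mult_ac del: power_Suc)
  ultimately show ?thesis by simp
qed

text \<open>The two summands of \<open>para\<close> are orthogonal to z, ..., z^(n+1) and to 1, ...,
  z^n respectively; the common range z, ..., z^n is what remains for the sum.\<close>

lemma inner_para:
  assumes "coeff p 0 = 0" "degree p \<le> n"
  shows "circle_inner \<theta> p para = 0"
  using assms inner_star_phi[of p] inner_phi_lower[of p "Suc n"]
  by (simp add: para_def inner_add_right inner_smult_right)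

lemma coeff_para_top: "coeff para (Suc n) = \<epsilon> * cnj (coeff para 0)"
  by (simp add: para_def coeff_star_poly ring_distribs flip: mult.assoc)

text \<open>If the sum vanished, \<open>star_poly \<Phi>\<close> would be a multiple of \<Phi>, so
  \<Phi> would be orthogonal to z^(n+1) as well as to all lower degrees, hence to itself.\<close>

lemma para_nonzero: "para \<noteq> 0"
proof
  assume "para = 0"
  then have st: "star_poly \<Phi> = smult (- \<epsilon>) \<Phi>"
    unfolding para_def by (metis eq_neg_iff_add_eq_0 smult_minus_left)
  let ?m = "monom 1 (Suc n) :: complex poly"
  define r where "r = \<Phi> - smult (coeff \<Phi> (Suc n)) ?m"
  have "degree r \<le> Suc n" "coeff r (Suc n) = 0"
    unfolding r_def by (auto intro!: degree_diff_le order_trans[OF degree_monom_le] order_trans[OF degree_smult_le])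
  then have "degree r < Suc n"
    by (metis degree_0 leading_coeff_0_iff le_neq_implies_less zero_less_Suc)
  then have "circle_inner \<theta> r \<Phi> = 0"
    by (rule inner_phi_lower)
  moreover have "circle_inner \<theta> ?m \<Phi> = 0"
  proof -
    have "circle_inner \<theta> ?m (star_poly \<Phi>) = 0"
      by (rule inner_star_phi) (simp_all add: degree_monom_eq)
    then show ?thesis
      by (simp add: st inner_smult_right del: smult_minus_left)
  qed
  ultimately have "circle_inner \<theta> \<Phi> \<Phi> = 0"
    by (simp add: r_def inner_diff_left inner_smult_left)
  then show False
    by (simp add: inner_phi)
qed

text \<open>With zero constant coefficient, self-reversal removes the top coefficient too. Then
  \<open>para\<close> lies in the span of z, ..., z^n, to which it is orthogonal.\<close>

lemma coeff_para_0: "coeff para 0 \<noteq> 0"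
proof
  assume 0: "coeff para 0 = 0"
  then have "coeff para (Suc n) = 0"
    by (simp add: coeff_para_top)
  then have "degree para \<le> n"
    using degree_para_le para_nonzero
    by (metis leading_coeff_0_iff le_SucE)
  then have "circle_inner \<theta> para para = 0"
    using 0 by (intro inner_para)
  then show False
    using inner_definite para_nonzero by blast
qed

lemma degree_para: "degree para = Suc n"
  using degree_para_le coeff_para_0 coeff_para_top
  by (metis complex_cnj_zero_iff eps_simps(3) le_antisym le_degree mult_eq_0_iff)

text \<open>
  If the product divides with cofactor \<open>q\<close>, then the inner product of \<open>z q\<close> with the
  polynomial, which vanishes by orthogonality, is a multiple of the norm of \<open>(z - \<alpha>) q\<close>. For
  \<open>\<bar>\<alpha>\<bar> = 1\<close> the two factors coincide, so this also excludes double zeros on the circle.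
\<close>

lemma para_no_reflected_pair:
  assumes "\<alpha> \<noteq> 0"
  shows "\<not> [:-\<alpha>, 1:] * [:- inverse (cnj \<alpha>), 1:] dvd para"
proof
  assume "[:-\<alpha>, 1:] * [:- inverse (cnj \<alpha>), 1:] dvd para"
  then obtain q where q: "para = [:-\<alpha>, 1:] * [:- inverse (cnj \<alpha>), 1:] * q"
    by (auto simp only: dvd_def)
  have q0: "q \<noteq> 0"
    using q para_nonzero by auto
  have "[:-\<alpha>, 1:] * [:- inverse (cnj \<alpha>), 1:] \<noteq> 0"
    by (simp only: mult_eq_0_iff) simp
  then have "degree para = degree ([:-\<alpha>, 1:] * [:- inverse (cnj \<alpha>), 1:]) + degree q"
    unfolding q using q0 by (rule degree_mult_eq)
  also have "degree ([:-\<alpha>, 1:] * [:- inverse (cnj \<alpha>), 1:]) = 2"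
    by (subst degree_mult_eq) auto
  finally have dq: "degree q + 2 = Suc n"
    by (simp add: degree_para)
  have "circle_inner \<theta> (pCons 0 q) para = 0"
    using dq q0 by (intro inner_para) auto
  moreover have "circle_inner \<theta> (pCons 0 q) para =
    circle_inner \<theta> (smult (- 1 / \<alpha>) ([:-\<alpha>, 1:] * q)) ([:-\<alpha>, 1:] * q)"
  proof (rule inner_cong)
    fix z :: complex assume z: "norm z = 1"
    have "z \<noteq> 0" using z by auto
    then have *: "z * cnj (z - inverse (cnj \<alpha>)) = (- 1 / \<alpha>) * (z - \<alpha>)"
      using assms cnj_circle[OF z] by (simp add: field_simps)
    have l: "poly [:- \<beta>, 1:] z = z - \<beta>" for \<beta>
      by simp
    have "poly (pCons 0 q) z * cnj (poly para z) =
      (z * cnj (z - inverse (cnj \<alpha>))) * (poly q z * cnj (poly ([:-\<alpha>, 1:] * q) z))"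
      unfolding q by (simp only: poly_mult poly_pCons[of 0] l complex_cnj_mult mult_ac add_0)
    also have "\<dots> = poly (smult (- 1 / \<alpha>) ([:-\<alpha>, 1:] * q)) z * cnj (poly ([:-\<alpha>, 1:] * q) z)"
      unfolding * by (simp only: poly_smult poly_mult l mult_ac)
    finally show "poly (pCons 0 q) z * cnj (poly para z) = \<dots>" .
  qed
  ultimately have "circle_inner \<theta> ([:-\<alpha>, 1:] * q) ([:-\<alpha>, 1:] * q) = 0"
    using assms unfolding inner_smult_left by (simp del: mult_pCons_left)
  then have "[:-\<alpha>, 1:] * q = 0"
    by (rule inner_definite)
  then show False using q0 by (simp only: mult_eq_0_iff) simp
qed

text \<open>Up to the sign \<epsilon> the polynomial equals its own reversal at degree n + 1, so its
  zeros are symmetric with respect to the circle.\<close>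

lemma para_reflect_root:
  assumes "poly para \<alpha> = 0" "\<alpha> \<noteq> 0"
  shows "poly para (inverse (cnj \<alpha>)) = 0"
proof -
  let ?b = "inverse (cnj \<alpha>)"
  have "cnj (poly para \<alpha>) = 0"
    using assms by simp
  then have "cnj \<alpha> ^ Suc n * poly \<Phi> ?b + \<epsilon> * cnj (poly \<Phi> \<alpha>) = 0"
    using assms(2) by (simp add: para_def poly_star_poly del: power_Suc)
  then have "\<epsilon> * ?b ^ Suc n * (cnj \<alpha> ^ Suc n * poly \<Phi> ?b + \<epsilon> * cnj (poly \<Phi> \<alpha>)) = 0"
    by simp
  moreover have "?b ^ Suc n * cnj \<alpha> ^ Suc n = 1"
    using assms(2) by (subst power_mult_distrib[symmetric]) simp
  ultimately have "\<epsilon> * poly \<Phi> ?b + ?b ^ Suc n * cnj (poly \<Phi> \<alpha>) = 0"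
    by (simp add: ring_distribs mult_ac del: power_Suc) (metis eps_simps(1) mult.assoc mult.commute mult.left_commute mult_1)
  then show ?thesis
    using assms(2) by (simp add: para_def poly_star_poly add.commute del: power_Suc)
qed

lemma para_root_circle:
  assumes "poly para \<alpha> = 0"
  shows "norm \<alpha> = 1"
proof -
  have a0: "\<alpha> \<noteq> 0"
    using assms coeff_para_0 by (auto simp: poly_0_coeff_0)
  have "inverse (cnj \<alpha>) = \<alpha>"
  proof (rule ccontr)
    assume ne: "inverse (cnj \<alpha>) \<noteq> \<alpha>"
    obtain q where q: "para = [:-\<alpha>, 1:] * q"
      using assms by (auto simp: poly_eq_0_iff_dvd dvd_def)
    have "poly para (inverse (cnj \<alpha>)) = 0"
      using assms a0 by (rule para_reflect_root)
    then have "poly q (inverse (cnj \<alpha>)) = 0"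
      using ne by (simp add: q)
    then obtain r where "q = [:- inverse (cnj \<alpha>), 1:] * r"
      by (auto simp: poly_eq_0_iff_dvd dvd_def)
    then have "[:-\<alpha>, 1:] * [:- inverse (cnj \<alpha>), 1:] dvd para"
      unfolding q by (metis dvd_triv_left mult.assoc)
    then show False using para_no_reflected_pair[OF a0] by blast
  qed
  then have "\<alpha> * cnj \<alpha> = 1"
    using a0 by (metis complex_cnj_zero_iff left_inverse)
  then have "(norm \<alpha>)\<^sup>2 = 1"
    by (metis complex_norm_square of_real_eq_1_iff)
  then show ?thesis by (simp add: power2_eq_1_iff) (metis abs_norm_cancel abs_minus_cancel abs_one)
qed

text \<open>All zeros lie on the circle, where a point is its own reflection; a double zero would
  thus be a reflected pair.\<close>

lemma rsquarefree_para: "rsquarefree para"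
  unfolding rsquarefree_def
proof (intro conjI allI para_nonzero)
  fix a
  show "order a para = 0 \<or> order a para = 1"
  proof (rule ccontr)
    assume *: "\<not> ?thesis"
    then have "[:-a, 1:] ^ 2 dvd para"
      by (subst order_divides) linarith
    moreover have "poly para a = 0"
      using * by (metis order_root)
    then have "norm a = 1" by (rule para_root_circle)
    then have "a \<noteq> 0" "inverse (cnj a) = a"
      by (auto simp: cnj_circle)
    ultimately show False
      using para_no_reflected_pair[of a] by (simp add: power2_eq_square)
  qed
qed

lemma card_para_roots: "card {z. poly para z = 0} = Suc n"
proof -
  let ?d = "smult (lead_coeff para) (\<Prod>z | poly para z = 0. [:-z, 1:])"
  have "degree ?d = card {z. poly para z = 0}"
    using para_nonzero by (simp add: degree_prod_eq_sum_degree)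
  moreover have "degree ?d = degree para"
    by (simp only: complex_poly_decompose_rsquarefree[OF rsquarefree_para])
  ultimately show ?thesis
    using degree_para by argo
qed

end

section \<open>The reproducing kernel at the zeros and the quadrature formula\<close>

lemma linear_division:
  fixes p :: "complex poly"
  obtains q where "p = [:poly p w:] + [:- w, 1:] * q" "degree p = Suc (degree q) \<or> q = 0"
proof -
  have "poly (p - [:poly p w:]) w = 0" by simp
  then obtain q where q: "p - [:poly p w:] = [:- w, 1:] * q"
    by (auto simp only: poly_eq_0_iff_dvd dvd_def)
  then have p: "p = [:poly p w:] + [:- w, 1:] * q"
    by (metis add.commute diff_add_cancel)
  moreover have "degree p = Suc (degree q)" if "q \<noteq> 0"
  proof -
    have d: "degree ([:- w, 1:] * q) = Suc (degree q)"
      using that by (subst degree_mult_eq) auto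
    then have "degree ([:poly p w:] + [:- w, 1:] * q) = degree ([:- w, 1:] * q)"
      by (intro degree_add_eq_right) simp
    then show ?thesis using p d by simp
  qed
  ultimately show ?thesis using that by blast
qed

context para_orthogonal
begin

definition cofactor :: "complex \<Rightarrow> complex poly" where
  "cofactor w = para div [:- w, 1:]"

text \<open>The kernel K(w, z) as a polynomial in z when \<open>w\<close> is a zero of
  \<open>para\<close>: there the numerator is \<open>cnj (poly (star_poly \<Phi>) w)\<close> times
  \<open>para\<close>, and 1 - cnj w z = - cnj w (z - w), with 1 / cnj w = w on the circle.\<close>

definition kernel_poly :: "complex \<Rightarrow> complex poly" where
  "kernel_poly w = smult (- w * cnj (poly (star_poly \<Phi>) w)) (cofactor w)"

lemma para_cofactor: "poly para w = 0 \<Longrightarrow> para = [:- w, 1:] * cofactor w"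
  unfolding cofactor_def poly_eq_0_iff_dvd by (simp only: dvd_mult_div_cancel)

lemma degree_cofactor:
  assumes "poly para w = 0"
  shows "degree (cofactor w) = n"
proof -
  have "degree ([:- w, 1:] * cofactor w) = Suc n"
    using para_cofactor[OF assms] degree_para by simp
  moreover have "cofactor w \<noteq> 0"
    using para_cofactor[OF assms] para_nonzero by auto
  ultimately show ?thesis
    by (subst (asm) degree_mult_eq) auto
qed

text \<open>Write p = p(w) + (z - w) r. On the circle the factor z - w is - w z times its conjugate;
  this completes the cofactor to \<open>para\<close>, which is orthogonal to z r. Pairing with the
  cofactor is therefore evaluation at \<open>w\<close> up to a constant.\<close>

lemma inner_cofactor:
  assumes w: "poly para w = 0" and p: "degree p \<le> n"
  shows "circle_inner \<theta> p (cofactor w) = poly p w * circle_inner \<theta> 1 (cofactor w)"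
proof -
  obtain r where r: "p = [:poly p w:] + [:- w, 1:] * r" "degree p = Suc (degree r) \<or> r = 0"
    using linear_division[where p = p and w = w] by metis
  have "circle_inner \<theta> ([:- w, 1:] * r) (cofactor w) = circle_inner \<theta> (smult (- w) (pCons 0 r)) para"
  proof (rule inner_cong)
    fix z :: complex assume z: "norm z = 1"
    have "z - w = - w * z * cnj (z - w)"
      using cnj_diff_circle[OF z para_root_circle[OF w]] by (simp add: algebra_simps)
    then have "(z - w) * (poly r z * cnj (poly (cofactor w) z)) =
        - w * z * cnj (z - w) * (poly r z * cnj (poly (cofactor w) z))"
      by (rule arg_cong[where f = "\<lambda>t. t * (poly r z * cnj (poly (cofactor w) z))"])
    moreover have "poly para z = (z - w) * poly (cofactor w) z"
      by (subst para_cofactor[OF w]) (simp add: algebra_simps)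
    moreover have "poly [:- w, 1:] z = z - w" by simp
    ultimately show "poly ([:- w, 1:] * r) z * cnj (poly (cofactor w) z) =
        poly (smult (- w) (pCons 0 r)) z * cnj (poly para z)"
      by (simp only: poly_mult poly_smult poly_pCons[of 0] add_0 complex_cnj_mult mult_ac)
  qed
  also have "\<dots> = 0"
    unfolding inner_smult_left using r(2) p by (subst inner_para) auto
  finally have "circle_inner \<theta> p (cofactor w) = circle_inner \<theta> (smult (poly p w) 1) (cofactor w)"
    by (subst r(1)) (simp add: inner_add_left del: mult_pCons_left)
  then show ?thesis by (simp only: inner_smult_left)
qed

lemma kernel_poly_times:
  assumes w: "poly para w = 0"
  shows "(1 - cnj w * z) * poly (kernel_poly w) z =
    poly (star_poly \<Phi>) z * cnj (poly (star_poly \<Phi>) w) - poly \<Phi> z * cnj (poly \<Phi> w)"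
proof -
  have nw: "w \<noteq> 0" "cnj w = inverse w"
    using para_root_circle[OF w] cnj_circle by auto
  have "(1 - cnj w * z) * poly (kernel_poly w) z = cnj (poly (star_poly \<Phi>) w) * ((z - w) * poly (cofactor w) z)"
    using nw by (simp add: kernel_poly_def field_simps)
  also have "(z - w) * poly (cofactor w) z = poly para z"
    by (subst para_cofactor[OF w]) (simp add: algebra_simps)
  also have "poly para z = poly (star_poly \<Phi>) z + \<epsilon> * poly \<Phi> z"
    by (simp add: para_def)
  finally have 1: "(1 - cnj w * z) * poly (kernel_poly w) z =
    poly (star_poly \<Phi>) z * cnj (poly (star_poly \<Phi>) w) + \<epsilon> * cnj (poly (star_poly \<Phi>) w) * poly \<Phi> z"
    by (simp add: algebra_simps)
  have "poly (star_poly \<Phi>) w = - \<epsilon> * poly \<Phi> w"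
    using w by (simp add: para_def eq_neg_iff_add_eq_0)
  then have 2: "\<epsilon> * cnj (poly (star_poly \<Phi>) w) = - cnj (poly \<Phi> w)"
    by (simp flip: mult.assoc)
  show ?thesis
    unfolding 1 2 by (simp add: algebra_simps)
qed

text \<open>
  On the circle \<open>1/(1 - w cnj z) = z/(z - w)\<close>. Adding
  \<open>z/(z - w) (\<bar>\<Phi>\<bar>\<^sup>2 - \<bar>\<Phi>\<^sup>*\<bar>\<^sup>2) = 0\<close> to the conjugate of the kernel replaces \<open>\<Phi>(w)\<close> and
  \<open>\<Phi>\<^sup>*(w)\<close> by difference quotients \<open>H\<close> and \<open>G\<close>; the term with \<open>G\<close> integrates to 0, and only the
  leading coefficient of \<open>H\<close> contributes.
\<close>

lemma inner_1_kernel_poly: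
  assumes w: "poly para w = 0"
  shows "circle_inner \<theta> 1 (kernel_poly w) = 1"
proof -
  let ?S = "star_poly \<Phi>"
  obtain G where G: "?S = [:poly ?S w:] + [:- w, 1:] * G" "degree ?S = Suc (degree G) \<or> G = 0"
    using linear_division[where p = ?S and w = w] by metis
  obtain H where H: "\<Phi> = [:poly \<Phi> w:] + [:- w, 1:] * H" "degree \<Phi> = Suc (degree H) \<or> H = 0"
    using linear_division[where p = \<Phi> and w = w] by metis
  have nw: "norm w = 1" by (rule para_root_circle[OF w])
  have dk: "degree (kernel_poly w) \<le> n"
    unfolding kernel_poly_def using degree_cofactor[OF w] degree_smult_le by metis
  obtain R where R: "\<And>z. norm z = 1 \<Longrightarrow> poly R z = z ^ n * cnj (poly (kernel_poly w) z)"
    using circle_reverse[OF dk] by metis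
  \<comment> \<open>This is the desired identity on the circle multiplied by z^(n+1), which turns
    the conjugated polynomials into polynomials and so allows the argument by counting
    zeros.\<close>
  define F where "F = pCons 0 R + pCons 0 G * \<Phi> - pCons 0 H * ?S"
  have key: "poly F z = z ^ Suc n * (cnj (poly (kernel_poly w) z) +
      poly (pCons 0 G) z * cnj (poly ?S z) - poly (pCons 0 H) z * cnj (poly \<Phi> z))" if z: "norm z = 1" for z
  proof -
    have "z * cnj z = 1" using z complex_norm_square[of z] by simp
    then have zz: "z ^ Suc n * cnj z ^ Suc n = 1"
      by (metis power_mult_distrib power_one)
    have "poly ?S z = z ^ Suc n * cnj (poly \<Phi> z)"
      using poly_star_circle[OF z, of \<Phi>] by simp
    moreover have "z ^ Suc n * cnj (poly ?S z) = poly \<Phi> z"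
    proof -
      have "z ^ Suc n * cnj (poly ?S z) = (z ^ Suc n * cnj z ^ Suc n) * poly \<Phi> z"
        unfolding \<open>poly ?S z = _\<close> by (simp del: power_Suc add: mult_ac)
      then show ?thesis unfolding zz by simp
    qed
    ultimately show ?thesis
      unfolding F_def by (simp add: R[OF z] algebra_simps)
  qed
  \<comment> \<open>After multiplication by \<open>z - w\<close> the bracket in \<open>key\<close>
    collapses, because \<open>star_poly \<Phi>\<close> and \<Phi> have equal modulus on the circle;
    this leaves out only the point \<open>w\<close>.\<close>
  have "F = 0"
  proof (rule poly_zero_on_circle)
    fix z :: complex assume z: "norm z = 1" "z \<noteq> w"
    have *: "(1 - w * cnj z) * cnj (poly (kernel_poly w) z) =
        cnj (poly ?S z) * poly ?S w - cnj (poly \<Phi> z) * poly \<Phi> w"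
      using kernel_poly_times[OF w, of z] by (metis complex_cnj_cnj complex_cnj_diff complex_cnj_mult complex_cnj_one)
    have zc: "z * cnj z = 1"
      using z(1) complex_norm_square[of z] by simp
    have SP: "cnj (poly ?S z) * poly ?S z = cnj (poly \<Phi> z) * poly \<Phi> z"
    proof -
      have "norm (poly ?S z) = norm (poly \<Phi> z)"
        using poly_star_circle[OF z(1), of \<Phi>] z(1) by (simp add: norm_mult norm_power)
      then show ?thesis
        by (metis complex_norm_square mult.commute)
    qed
    have g: "(z - w) * poly G z = poly ?S z - poly ?S w"
      using arg_cong[OF G(1), of "\<lambda>p. poly p z"] by (simp add: algebra_simps)
    have h: "(z - w) * poly H z = poly \<Phi> z - poly \<Phi> w"
      using arg_cong[OF H(1), of "\<lambda>p. poly p z"] by (simp add: algebra_simps)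
    have "(z - w) * cnj (poly (kernel_poly w) z) = z * ((1 - w * cnj z) * cnj (poly (kernel_poly w) z))"
      using zc by (simp add: algebra_simps)
    then have k: "(z - w) * cnj (poly (kernel_poly w) z) = z * (cnj (poly ?S z) * poly ?S w - cnj (poly \<Phi> z) * poly \<Phi> w)"
      unfolding * .
    have "(z - w) * (cnj (poly (kernel_poly w) z) +
      poly (pCons 0 G) z * cnj (poly ?S z) - poly (pCons 0 H) z * cnj (poly \<Phi> z)) =
      (z - w) * cnj (poly (kernel_poly w) z) + z * ((z - w) * poly G z) * cnj (poly ?S z)
        - z * ((z - w) * poly H z) * cnj (poly \<Phi> z)"
      by (simp add: algebra_simps)
    also have "\<dots> = z * (cnj (poly ?S z) * poly ?S z - cnj (poly \<Phi> z) * poly \<Phi> z)"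
      unfolding k g h by (simp add: algebra_simps)
    also have "\<dots> = 0" using SP by simp
    finally show "poly F z = 0"
      unfolding key[OF z(1)] using z(2) by simp
  qed
  have id: "cnj (poly (kernel_poly w) z) = poly (pCons 0 H) z * cnj (poly \<Phi> z) - poly (pCons 0 G) z * cnj (poly ?S z)"
    if z: "norm z = 1" for z
  proof -
    have "z \<noteq> 0" using z by auto
    then have "cnj (poly (kernel_poly w) z) + poly (pCons 0 G) z * cnj (poly ?S z)
        - poly (pCons 0 H) z * cnj (poly \<Phi> z) = 0"
      using key[OF z] unfolding \<open>F = 0\<close> by (metis mult_eq_0_iff poly_0 power_not_zero)
    then show ?thesis by algebra
  qed
  have "circle_inner \<theta> 1 (kernel_poly w) =
      (\<integral>x. poly (pCons 0 H) (cis (2 * pi * x)) * cnj (poly \<Phi> (cis (2 * pi * x))) -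
        poly (pCons 0 G) (cis (2 * pi * x)) * cnj (poly ?S (cis (2 * pi * x))) \<partial>\<theta>)"
    unfolding circle_inner_eq by (simp only: id[OF norm_cis] poly_1 mult_1_left)
  also have "\<dots> = circle_inner \<theta> (pCons 0 H) \<Phi> - circle_inner \<theta> (pCons 0 G) ?S"
    unfolding circle_inner_eq by (rule Bochner_Integration.integral_diff[OF integrable_inner integrable_inner])
  also have "circle_inner \<theta> (pCons 0 G) ?S = 0"
    using G(2) degree_star_poly_le[of \<Phi>] by (intro inner_star_phi) auto
  also have "circle_inner \<theta> (pCons 0 H) \<Phi> = 1"
  proof -
    have dH: "degree H = n"
    proof -
      have "H \<noteq> 0"
        using arg_cong[OF H(1), of degree] by auto
      then show ?thesis using H(2) by simp
    qed
    have "coeff \<Phi> (Suc n) = coeff ([:- w, 1:] * H) (Suc n)"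
      by (subst H(1)) simp
    then have cH: "coeff \<Phi> (Suc n) = coeff H n"
      using dH by (simp add: coeff_eq_0)
    define D where "D = pCons 0 H - \<Phi>"
    have "degree D \<le> Suc n" unfolding D_def using dH by (intro degree_diff_le) auto
    moreover have "coeff D (Suc n) = 0" unfolding D_def using cH by simp
    ultimately have "degree D < Suc n"
      by (metis degree_0 leading_coeff_0_iff le_neq_implies_less zero_less_Suc)
    then have "circle_inner \<theta> D \<Phi> = 0" by (rule inner_phi_lower)
    then show ?thesis
      by (simp add: D_def inner_diff_left inner_phi)
  qed
  finally show ?thesis by simp
qed

lemma degree_kernel_poly: "poly para w = 0 \<Longrightarrow> degree (kernel_poly w) \<le> n"
  unfolding kernel_poly_def using degree_cofactor degree_smult_le by metis

text \<open>The constant left open in \<open>inner_cofactor\<close> is fixed by testing with p =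
  1.\<close>

lemma inner_kernel_poly:
  assumes w: "poly para w = 0" and p: "degree p \<le> n"
  shows "circle_inner \<theta> p (kernel_poly w) = poly p w"
  using inner_1_kernel_poly[OF w] inner_cofactor[OF w p]
  unfolding kernel_poly_def inner_smult_right by (metis mult.left_commute mult_1_right)

lemma kernel_diag:
  assumes w: "poly para w = 0"
  shows "poly (kernel_poly w) w \<in> \<real>" "Re (poly (kernel_poly w) w) > 0"
proof -
  have *: "poly (kernel_poly w) w = circle_inner \<theta> (kernel_poly w) (kernel_poly w)"
    using inner_kernel_poly[OF w degree_kernel_poly[OF w]] by simp
  show "poly (kernel_poly w) w \<in> \<real>"
    unfolding * by (subst inner_self_real) simp
  have "kernel_poly w \<noteq> 0"
    using inner_1_kernel_poly[OF w] by auto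
  then show "Re (poly (kernel_poly w) w) > 0"
    unfolding * by (rule inner_self_pos)
qed

text \<open>Away from \<open>w\<close> the quotient coincides with a polynomial, so the limit that
  extends it to the diagonal is the value of that polynomial.\<close>

lemma repr_kernel_diag:
  assumes w: "poly para w = 0"
  shows "repr_kernel \<phi> n w w = poly (kernel_poly w) w"
proof -
  have nw: "norm w = 1" by (rule para_root_circle[OF w])
  have wc: "cnj w * w = 1"
    using nw complex_norm_square[of w] by (simp add: mult.commute)
  have quot: "kernel_quotient \<phi> n w z = poly (kernel_poly w) z" if "z \<noteq> w" for z
  proof -
    have "1 - cnj w * z \<noteq> 0"
      using that wc by (metis eq_iff_diff_eq_0 mult_left_cancel mult_zero_left zero_neq_one)
    then show ?thesis
      using kernel_poly_times[OF w, of z] by (simp add: kernel_quotient_def field_simps)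
  qed
  have "(poly (kernel_poly w) \<longlongrightarrow> poly (kernel_poly w) w) (at w)"
    using isCont_def poly_isCont by blast
  then have "(kernel_quotient \<phi> n w \<longlongrightarrow> poly (kernel_poly w) w) (at w)"
    by (rule Lim_transform_eventually) (auto simp: eventually_at_filter quot)
  then show ?thesis
    using wc by (simp add: repr_kernel_def tendsto_Lim)
qed

lemma kernel_poly_other_root:
  assumes "poly para w = 0" "poly para v = 0" "v \<noteq> w"
  shows "poly (kernel_poly w) v = 0"
proof -
  have "poly ([:- w, 1:] * cofactor w) v = 0"
    using para_cofactor[OF assms(1)] assms(2) by simp
  then show ?thesis
    using assms(3) by (simp add: kernel_poly_def)
qed

text \<open>The kernels at the n + 1 zeros vanish at each other's base points, so they form a
  Lagrange basis for degree at most n. Expanding \<open>p\<close> in this basis and applying the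
  reproducing property to \<open>q\<close> gives the rule.\<close>

lemma inner_quadrature:
  assumes p: "degree p \<le> n" and q: "degree q \<le> n"
  shows "circle_inner \<theta> p q =
    (\<Sum>w | poly para w = 0. poly p w * cnj (poly q w) / poly (kernel_poly w) w)"
proof -
  let ?Z = "{w. poly para w = 0}"
  have fin: "finite ?Z" using para_nonzero by (rule poly_roots_finite)
  have "p = (\<Sum>w\<in>?Z. smult (poly p w / poly (kernel_poly w) w) (kernel_poly w))" (is "_ = ?L")
  proof (rule poly_eqI_degree)
    fix v assume v: "v \<in> ?Z"
    have "poly ?L v = (\<Sum>w\<in>?Z. poly p w / poly (kernel_poly w) w * poly (kernel_poly w) v)"
      by (simp add: poly_sum)
    also have "\<dots> = (\<Sum>w\<in>?Z. if w = v then poly p v else 0)"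
    proof -
      have "poly (kernel_poly v) v \<noteq> 0"
        using kernel_diag(2)[of v] v by auto
      then show ?thesis
        using v by (intro sum.cong refl) (auto simp: kernel_poly_other_root)
    qed
    also have "\<dots> = poly p v" using v fin by simp
    finally show "poly p v = poly ?L v" by simp
  next
    show "degree p < card ?Z" using p card_para_roots by simp
    have "degree ?L \<le> n"
      by (intro degree_sum_le fin order_trans[OF degree_smult_le]) (simp add: degree_kernel_poly)
    then show "degree ?L < card ?Z" using card_para_roots by simp
  qed
  then have "circle_inner \<theta> p q = circle_inner \<theta> ?L q" by simp
  also have "\<dots> = (\<Sum>w\<in>?Z. poly p w / poly (kernel_poly w) w * circle_inner \<theta> (kernel_poly w) q)"
    by (simp add: inner_sum_left inner_smult_left)
  also have "\<dots> = (\<Sum>w\<in>?Z. poly p w * cnj (poly q w) / poly (kernel_poly w) w)"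
  proof (intro sum.cong refl)
    fix w assume "w \<in> ?Z"
    then have "circle_inner \<theta> (kernel_poly w) q = cnj (poly q w)"
      using inner_kernel_poly[OF _ q, of w] inner_cnj[of q "kernel_poly w"] by simp
    then show "poly p w / poly (kernel_poly w) w * circle_inner \<theta> (kernel_poly w) q =
        poly p w * cnj (poly q w) / poly (kernel_poly w) w"
      by simp
  qed
  finally show ?thesis .
qed

end

section \<open>Transfer from the circle to the fundamental domain [0, 1)\<close>

lemma trig_monomial_circle:
  "exp (2 * of_real pi * \<i> * of_int k * of_real x) =
    poly (monom 1 (nat k)) (cis (2 * pi * x)) * cnj (poly (monom 1 (nat (- k))) (cis (2 * pi * x)))"
proof -
  have *: "poly (monom 1 (nat j)) (cis (2 * pi * x)) = exp (2 * of_real pi * \<i> * of_int j * of_real x)"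
    if "j \<ge> 0" for j
  proof -
    have "poly (monom 1 (nat j)) (cis (2 * pi * x)) = cis (real (nat j) * (2 * pi * x))"
      by (simp only: poly_monom mult_1_left Complex.DeMoivre)
    also have "real (nat j) = of_int j" using that by simp
    finally show ?thesis by (simp add: cis_conv_exp mult_ac)
  qed
  show ?thesis
  proof (cases "k \<ge> 0")
    case True
    then show ?thesis by (simp add: *)
  next
    case False
    then have "poly (monom 1 (nat (- k))) (cis (2 * pi * x)) = exp (2 * of_real pi * \<i> * of_int (- k) * of_real x)"
      by (intro *) simp
    then have "cnj (poly (monom 1 (nat (- k))) (cis (2 * pi * x))) = exp (2 * of_real pi * \<i> * of_int k * of_real x)"
      by (simp add: exp_cnj)
    then show ?thesis using False by simp
  qed
qed

lemma cis_2pi_inj: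
  assumes "x \<in> {0..<1}" "y \<in> {0..<1}" "cis (2 * pi * x) = cis (2 * pi * y)"
  shows "x = y"
proof -
  have "cos (2 * pi * x) = cos (2 * pi * y) \<and> sin (2 * pi * x) = sin (2 * pi * y)"
    using assms(3) by (simp add: complex_eq_iff)
  then obtain k where "2 * pi * x = 2 * pi * y + 2 * pi * of_int k"
    using sin_cos_eq_iff by metis
  then have "2 * pi * x = 2 * pi * (y + of_int k)"
    by (simp add: algebra_simps)
  then have "x = y + of_int k"
    by simp
  then have "k = 0"
    using assms(1,2) by auto
  then show ?thesis using \<open>x = y + of_int k\<close> by simp
qed

lemma circle_point_torus:
  assumes "norm w = 1"
  obtains x where "x \<in> {0..<1}" "w = cis (2 * pi * x)"
proof
  let ?x = "frac (Arg w / (2 * pi))"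
  show "?x \<in> {0..<1}" by (simp add: frac_lt_1)
  have "2 * pi * ?x = Arg w - 2 * pi * of_int \<lfloor>Arg w / (2 * pi)\<rfloor>"
    by (simp add: frac_def algebra_simps)
  then have "cis (2 * pi * ?x) = cis (Arg w)"
    by (simp add: cis_divide[symmetric] cis_multiple_2pi)
  also have "\<dots> = w"
    using assms by (metis cis_Arg div_by_1 norm_zero of_real_1 sgn_div_norm scaleR_one inverse_1 zero_neq_one)
  finally show "w = cis (2 * pi * ?x)" by simp
qed

context para_orthogonal
begin

abbreviation nodes :: "real set" where "nodes \<equiv> torus_zeros para"

abbreviation kernel_value :: "real \<Rightarrow> real" where
  "kernel_value \<xi> \<equiv> Re (repr_kernel \<phi> n (cis (2 * pi * \<xi>)) (cis (2 * pi * \<xi>)))"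

lemma bij_betw_nodes: "bij_betw (\<lambda>\<xi>. cis (2 * pi * \<xi>)) nodes {w. poly para w = 0}"
  unfolding bij_betw_def
proof
  show "inj_on (\<lambda>\<xi>. cis (2 * pi * \<xi>)) nodes"
    by (rule inj_onI) (auto simp: torus_zeros_def intro: cis_2pi_inj)
  show "(\<lambda>\<xi>. cis (2 * pi * \<xi>)) ` nodes = {w. poly para w = 0}"
  proof (intro equalityI subsetI)
    fix w assume "w \<in> {w. poly para w = 0}"
    then have w: "poly para w = 0" by simp
    obtain x where "x \<in> {0..<1}" "w = cis (2 * pi * x)"
      using circle_point_torus[OF para_root_circle[OF w]] .
    then show "w \<in> (\<lambda>\<xi>. cis (2 * pi * \<xi>)) ` nodes"
      using w by (auto simp: torus_zeros_def)
  qed (auto simp: torus_zeros_def)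
qed

lemma card_nodes: "card nodes = Suc n"
  using bij_betw_same_card[OF bij_betw_nodes] card_para_roots by simp

lemma finite_nodes: "finite nodes"
  using card_nodes by (metis card.infinite nat.distinct(1))

lemma kernel_value_pos: "\<xi> \<in> nodes \<Longrightarrow> kernel_value \<xi> > 0"
  by (simp add: torus_zeros_def repr_kernel_diag kernel_diag)

text \<open>A frequency k with |k| at most n is z^k or the conjugate of z^(-k) on the circle. Thus
  it is an inner product integrand of two polynomials of degree at most n, and the rule for inner
  products covers every trigonometric polynomial of degree n.\<close>

lemma torus_quadrature:
  assumes "f \<in> trig_polys n"
  shows "torus_integral \<theta> f = (\<Sum>\<xi>\<in>nodes. Re (f (of_real \<xi>)) / kernel_value \<xi>)"
proof -
  obtain a :: "int \<Rightarrow> complex"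
    where f: "f = (\<lambda>z. \<Sum>k = - int n..int n. a k * exp (2 * of_real pi * \<i> * of_int k * z))"
    using assms by (auto simp: trig_polys_def)
  define p :: "int \<Rightarrow> complex poly" where "p k = monom 1 (nat k)" for k
  define q :: "int \<Rightarrow> complex poly" where "q k = monom 1 (nat (- k))" for k
  have fx: "f (of_real x) = (\<Sum>k = - int n..int n. a k * (poly (p k) (cis (2 * pi * x)) * cnj (poly (q k) (cis (2 * pi * x)))))" for x
    unfolding f p_def q_def by (simp only: trig_monomial_circle)
  have int: "integrable \<theta> (\<lambda>x. f (of_real x))"
    unfolding fx by (intro Bochner_Integration.integrable_sum integrable_mult_right integrable_inner)
  have "(\<integral>x. f (of_real x) \<partial>\<theta>) = (\<Sum>k = - int n..int n. a k * circle_inner \<theta> (p k) (q k))"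
    unfolding fx circle_inner_eq
    by (subst Bochner_Integration.integral_sum)
      (simp_all only: integrable_mult_right[OF integrable_inner] integral_mult_right_zero)
  also have "\<dots> = (\<Sum>k = - int n..int n. a k * (\<Sum>w | poly para w = 0. poly (p k) w * cnj (poly (q k) w) / poly (kernel_poly w) w))"
    by (intro sum.cong refl arg_cong2[where f = "(*)"] inner_quadrature)
      (auto simp: p_def q_def intro!: order_trans[OF degree_monom_le])
  also have "\<dots> = (\<Sum>w | poly para w = 0. (\<Sum>k = - int n..int n. a k * (poly (p k) w * cnj (poly (q k) w))) / poly (kernel_poly w) w)"
    unfolding sum_distrib_left sum_divide_distrib times_divide_eq_right by (rule sum.swap)
  also have "\<dots> = (\<Sum>\<xi>\<in>nodes. f (of_real \<xi>) / poly (kernel_poly (cis (2 * pi * \<xi>))) (cis (2 * pi * \<xi>)))"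
    unfolding fx by (rule sum.reindex_bij_betw[OF bij_betw_nodes, symmetric])
  also have "\<dots> = (\<Sum>\<xi>\<in>nodes. f (of_real \<xi>) / of_real (kernel_value \<xi>))"
    by (intro sum.cong refl) (auto simp: torus_zeros_def repr_kernel_diag kernel_diag of_real_Re)
  finally have "(\<integral>x. f (of_real x) \<partial>\<theta>) = (\<Sum>\<xi>\<in>nodes. f (of_real \<xi>) / of_real (kernel_value \<xi>))" .
  then have "Re (\<integral>x. f (of_real x) \<partial>\<theta>) = (\<Sum>\<xi>\<in>nodes. Re (f (of_real \<xi>)) / kernel_value \<xi>)"
    by simp
  then show ?thesis
    unfolding torus_integral_def using int by simp
qed

text \<open>A common zero of \<open>para\<close> and \<Phi> would also be a zero of
  \<open>star_poly \<Phi>\<close>, and the kernel at that point, which pairs to 1 with the constant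
  1, would vanish identically.\<close>

lemma para_root_phi_nonzero:
  assumes "poly para w = 0"
  shows "poly \<Phi> w \<noteq> 0"
proof
  assume "poly \<Phi> w = 0"
  then have "poly (star_poly \<Phi>) w = 0"
    using assms by (simp add: para_def)
  then have "kernel_poly w = 0"
    by (simp add: kernel_poly_def)
  then show False
    using inner_1_kernel_poly[OF assms] by simp
qed

end

section \<open>Even measures: real coefficients and symmetry of the nodes\<close>

lemma poly_map_cnj: "poly (map_poly cnj p) z = cnj (poly p (cnj z))"
  by (induction p) (simp_all add: map_poly_pCons)

locale even_opuc = opuc +
  assumes even: "even_measure \<theta>"
begin

lemma integral_reflect:
  fixes g :: "complex \<Rightarrow> complex"
  assumes "continuous_on (sphere 0 1) g"
  shows "(\<integral>x. g (cnj (cis (2 * pi * x))) \<partial>\<theta>) = (\<integral>x. g (cis (2 * pi * x)) \<partial>\<theta>)"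
proof -
  have meas: "(\<lambda>x. frac (- x)) \<in> \<theta> \<rightarrow>\<^sub>M \<theta>"
  proof -
    have "(\<lambda>x::real. frac (- x)) \<in> borel_measurable \<theta>"
      by (rule borel_measurable_theta) (simp add: frac_def)
    then have "(\<lambda>x. frac (- x)) \<in> \<theta> \<rightarrow>\<^sub>M restrict_space borel {0..<1}"
      by (intro measurable_restrict_space2) (auto simp: frac_lt_1)
    then show ?thesis
      using measurable_cong_sets[OF refl sets_theta, of \<theta>] by (simp add: torus_borel_def)
  qed
  have "(\<integral>x. g (cis (2 * pi * x)) \<partial>\<theta>) = (\<integral>x. g (cis (2 * pi * x)) \<partial>distr \<theta> \<theta> (\<lambda>x. frac (- x)))"
    using even by (simp add: even_measure_def)
  also have "\<dots> = (\<integral>x. g (cis (2 * pi * frac (- x))) \<partial>\<theta>)"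
    by (rule integral_distr[OF meas]) (rule borel_measurable_integrable[OF integrable_circle[OF assms]])
  also have "\<dots> = (\<integral>x. g (cnj (cis (2 * pi * x))) \<partial>\<theta>)"
  proof (rule Bochner_Integration.integral_cong[OF refl])
    fix x :: real
    have "2 * pi * frac (- x) = - (2 * pi * x) - 2 * pi * of_int \<lfloor>- x\<rfloor>"
      by (simp add: frac_def algebra_simps)
    then have "cis (2 * pi * frac (- x)) = cnj (cis (2 * pi * x))"
      by (simp add: cis_divide[symmetric] cis_multiple_2pi cis_cnj)
    then show "g (cis (2 * pi * frac (- x))) = g (cnj (cis (2 * pi * x)))" by simp
  qed
  finally show ?thesis by simp
qed

lemma inner_map_cnj:
  "circle_inner \<theta> (map_poly cnj p) (map_poly cnj q) = cnj (circle_inner \<theta> p q)"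
proof -
  have "circle_inner \<theta> (map_poly cnj p) (map_poly cnj q) =
      (\<integral>x. cnj (poly p (cnj (cis (2 * pi * x))) * cnj (poly q (cnj (cis (2 * pi * x))))) \<partial>\<theta>)"
    unfolding circle_inner_eq poly_map_cnj by (simp only: complex_cnj_mult)
  also have "\<dots> = cnj (\<integral>x. poly p (cnj (cis (2 * pi * x))) * cnj (poly q (cnj (cis (2 * pi * x)))) \<partial>\<theta>)"
    by (rule Bochner_Integration.integral_cnj)
  also have "(\<integral>x. poly p (cnj (cis (2 * pi * x))) * cnj (poly q (cnj (cis (2 * pi * x)))) \<partial>\<theta>) = circle_inner \<theta> p q"
    unfolding circle_inner_eq
    by (rule integral_reflect[where g = "\<lambda>z. poly p z * cnj (poly q z)"])
      (rule continuous_on_mult continuous_on_cnj continuous_on_poly continuous_on_id)+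
  finally show ?thesis .
qed

text \<open>Conjugating the coefficients gives another orthonormal polynomial with the same real
  leading coefficient. The difference \<open>D\<close> has lower degree, so it is orthogonal to both
  polynomials and hence to itself.\<close>

lemma phi_real: "map_poly cnj (\<phi> k) = \<phi> k"
proof -
  define D where "D = map_poly cnj (\<phi> k) - \<phi> k"
  have "degree D \<le> k"
    unfolding D_def by (intro degree_diff_le) (simp_all add: degree_map_poly)
  moreover have "coeff D k = 0"
    unfolding D_def using lead_phi(1)[of k]
    by (simp add: coeff_map_poly) (metis complex_cnj_complex_of_real)
  ultimately have "D = 0 \<or> degree D < k"
    by (metis leading_coeff_0_iff le_neq_implies_less)
  then have D: "circle_inner \<theta> D (\<phi> k) = 0" "circle_inner \<theta> (map_poly cnj D) (\<phi> k) = 0"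
    using inner_phi_lower[of D k] inner_phi_lower[of "map_poly cnj D" k] by (auto simp: degree_map_poly)
  have "map_poly cnj (map_poly cnj D) = D"
    by (rule poly_eqI) (simp add: coeff_map_poly)
  then have "circle_inner \<theta> D (map_poly cnj (\<phi> k)) = 0"
    using inner_map_cnj[of "map_poly cnj D" "\<phi> k"] D(2) by simp
  then have "circle_inner \<theta> D D = 0"
    by (subst (2) D_def) (simp add: inner_diff_right D(1))
  then have "D = 0" by (rule inner_definite)
  then show ?thesis by (simp add: D_def)
qed

end

locale even_para = even_opuc + para_orthogonal
begin

lemma poly_phi_cnj: "poly \<Phi> (cnj z) = cnj (poly \<Phi> z)"
  using poly_map_cnj[of \<Phi> "cnj z"] by (simp add: phi_real)

lemma nodes_reflect:
  assumes "\<xi> \<in> nodes" "\<xi> \<noteq> 0"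
  shows "1 - \<xi> \<in> nodes"
proof -
  let ?z = "cis (2 * pi * \<xi>)"
  have "cis (2 * pi * (1 - \<xi>)) = cnj ?z"
  proof -
    have "2 * pi * (1 - \<xi>) = 2 * pi * of_int 1 - 2 * pi * \<xi>" by (simp add: algebra_simps)
    then show ?thesis
      by (simp add: cis_divide[symmetric] cis_cnj inverse_eq_divide[symmetric])
  qed
  moreover have "poly para (cnj ?z) = cnj (poly para ?z)"
    by (simp add: para_def poly_star_circle poly_phi_cnj del: cis_cnj)
  ultimately show ?thesis
    using assms by (auto simp: torus_zeros_def)
qed

text \<open>\<Phi> is real at 1, so \<open>para\<close> takes the value (1 + \<epsilon>) \<Phi>(1)
  there; for \<epsilon> = 1 a zero would have to be a zero of \<Phi>, which is excluded.\<close>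

lemma zero_in_nodes: "0 \<in> nodes \<longleftrightarrow> \<epsilon> = - 1"
proof -
  have "poly (star_poly \<Phi>) 1 = poly \<Phi> 1"
    using poly_phi_cnj[of 1] by (simp add: poly_star_circle)
  then have p: "poly para 1 = (1 + \<epsilon>) * poly \<Phi> 1"
    by (simp add: para_def algebra_simps)
  have "poly para 1 = 0 \<longleftrightarrow> \<epsilon> = - 1"
    using para_root_phi_nonzero[of 1] p by (metis add.right_inverse add_eq_0_iff mult_eq_0_iff)
  then show ?thesis
    by (simp add: torus_zeros_def)
qed

end

section \<open>The Jacobi triple product\<close>


text \<open>The q-Pochhammer symbol (q^2; q^2)_m.\<close>

definition qpoch :: "real \<Rightarrow> nat \<Rightarrow> real" where
  "qpoch q m = (\<Prod>i<m. 1 - q ^ (2 * Suc i))"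

text \<open>
  The value 0 at negative arguments makes the recurrences below hold for all integers, without
  boundary cases.
\<close>

definition qpoch_inv :: "real \<Rightarrow> int \<Rightarrow> real" where
  "qpoch_inv q m = (if m < 0 then 0 else inverse (qpoch q (nat m)))"

text \<open>q^(j^2) times the Gaussian binomial coefficient "2N choose N + j" in base q^2: the
  coefficients of the finite form of the triple product.\<close>

definition jacobi_coeff :: "real \<Rightarrow> nat \<Rightarrow> int \<Rightarrow> real" where
  "jacobi_coeff q N j =
     q powi (j * j) * qpoch q (2 * N) * qpoch_inv q (int N + j) * qpoch_inv q (int N - j)"

lemma qpoch_pos:
  assumes "0 < q" "q < 1"
  shows "qpoch q m > 0"
  unfolding qpoch_def
proof (rule prod_pos)
  fix i
  have "q ^ (2 * Suc i) < 1"
    using assms by (intro power_Suc_less_one[of q "2 * i + 1", simplified] | simp)+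
  then show "0 < 1 - q ^ (2 * Suc i)" by simp
qed

lemma qpoch_Suc: "qpoch q (Suc m) = qpoch q m * (1 - q ^ (2 * Suc m))"
  by (simp add: qpoch_def)

lemma qpoch_inv_rec:
  assumes "0 < q" "q < 1"
  shows "qpoch_inv q (m - 1) = (1 - q powi (2 * m)) * qpoch_inv q m"
proof -
  consider "m < 0" | "m = 0" | "m > 0" by linarith
  then show ?thesis
  proof cases
    case 3
    then obtain k where m: "m = int (Suc k)"
      by (metis Suc_pred' zero_less_imp_eq_int)
    have "q powi (2 * m) = q ^ (2 * Suc k)"
      unfolding m by (metis of_nat_mult of_nat_numeral power_int_of_nat)
    moreover have "qpoch q (Suc k) \<noteq> 0" "qpoch q k \<noteq> 0"
      using qpoch_pos[OF assms] by (metis less_irrefl)+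
    moreover have "qpoch_inv q (m - 1) = inverse (qpoch q k)"
      by (simp add: qpoch_inv_def m)
    moreover have "qpoch_inv q m = inverse (qpoch q (Suc k))"
      unfolding qpoch_inv_def m by (simp del: of_nat_Suc)
    ultimately show ?thesis
      by (simp only: qpoch_Suc) (simp add: field_simps del: power_Suc mult_Suc_right)
  qed (auto simp: qpoch_inv_def)
qed

text \<open>This is multiplication by the next factor (1 + c e^(iu)) (1 + c e^(-iu)) = 1 + c^2 + c
  (e^(iu) + e^(-iu)). With x = q^(2(N+j)) and y = q^(2(N-j)) all coefficients become polynomial
  multiples of the common term P A B, and the claim reduces to a polynomial identity.\<close>

lemma jacobi_coeff_Suc:
  assumes q: "0 < q" "q < 1"
  defines "c \<equiv> \<lambda>N. q ^ (2 * N + 1)"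
  shows "jacobi_coeff q (Suc N) j =
    (1 + (c N)\<^sup>2) * jacobi_coeff q N j + c N * (jacobi_coeff q N (j - 1) + jacobi_coeff q N (j + 1))"
proof -
  define x y where "x = q powi (2 * (int N + j))" and "y = q powi (2 * (int N - j))"
  define A B where "A = qpoch_inv q (int N + 1 + j)" and "B = qpoch_inv q (int N + 1 - j)"
  define P where "P = q powi (j * j)"
  have q0: "q \<noteq> 0" using q by simp
  have powi: "q powi a * q powi b = q powi (a + b)" for a b
    using q0 by (simp add: power_int_add)
  have n2: "q\<^sup>2 = q powi 2" by simp
  have x2: "q powi (2 * (int N + 1 + j)) = q\<^sup>2 * x" and y2: "q powi (2 * (int N + 1 - j)) = q\<^sup>2 * y"
    unfolding x_def y_def n2 powi by (simp_all add: algebra_simps)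
  have r1: "qpoch_inv q (int N + j) = (1 - q\<^sup>2 * x) * A"
    using qpoch_inv_rec[OF q, of "int N + 1 + j"] unfolding x2 A_def by (simp add: algebra_simps)
  have r2: "qpoch_inv q (int N - j) = (1 - q\<^sup>2 * y) * B"
    using qpoch_inv_rec[OF q, of "int N + 1 - j"] unfolding y2 B_def by (simp add: algebra_simps)
  have r3: "qpoch_inv q (int N + (j - 1)) = (1 - x) * (1 - q\<^sup>2 * x) * A"
    using qpoch_inv_rec[OF q, of "int N + j"] unfolding x_def[symmetric] r1 by (simp add: algebra_simps)
  have r4: "qpoch_inv q (int N - (j + 1)) = (1 - y) * (1 - q\<^sup>2 * y) * B"
    using qpoch_inv_rec[OF q, of "int N - j"] unfolding y_def[symmetric] r2 by (simp add: algebra_simps)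
  have cN: "c N = q powi (2 * int N + 1)"
  proof -
    have "2 * int N + 1 = int (2 * N + 1)" by simp
    then show ?thesis unfolding c_def by (simp only: power_int_of_nat)
  qed
  have "(c N)\<^sup>2 = c N * c N"
    by (rule power2_eq_square)
  also have "\<dots> = q\<^sup>2 * x * y"
    unfolding cN x_def y_def n2 powi by (rule arg_cong[where f = "\<lambda>i. q powi i"]) simp
  finally have c2: "(c N)\<^sup>2 = q\<^sup>2 * x * y" .
  have cm: "c N * q powi ((j - 1) * (j - 1)) = P * q\<^sup>2 * y"
    unfolding cN P_def y_def n2 powi
    by (rule arg_cong[where f = "\<lambda>i. q powi i"]) (simp add: algebra_simps)
  have cp: "c N * q powi ((j + 1) * (j + 1)) = P * q\<^sup>2 * x"
    unfolding cN P_def x_def n2 powi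
    by (rule arg_cong[where f = "\<lambda>i. q powi i"]) (simp add: algebra_simps)
  have Q1: "q ^ (2 * Suc (2 * N)) = (c N)\<^sup>2"
    unfolding c_def power_mult[symmetric]
    by (rule arg_cong[where f = "\<lambda>i. q ^ i"]) simp
  have Q2: "q ^ (2 * Suc (Suc (2 * N))) = q\<^sup>2 * (c N)\<^sup>2"
    unfolding c_def power_mult[symmetric] power_add[symmetric]
    by (rule arg_cong[where f = "\<lambda>i. q ^ i"]) simp
  have "2 * Suc N = Suc (Suc (2 * N))" by simp
  then have Q: "qpoch q (2 * Suc N) = qpoch q (2 * N) * (1 - q\<^sup>2 * x * y) * (1 - q\<^sup>2 * (q\<^sup>2 * x * y))"
    by (simp only: qpoch_Suc Q1 Q2 c2 mult.assoc)
  have e: "int (Suc N) + j = int N + 1 + j" "int (Suc N) - j = int N + 1 - j"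
    "int N - (j - 1) = int N + 1 - j" "int N + (j + 1) = int N + 1 + j" by simp_all
  have "c N * jacobi_coeff q N (j - 1) = P * q\<^sup>2 * y * qpoch q (2 * N) * ((1 - x) * (1 - q\<^sup>2 * x) * A) * B"
    unfolding jacobi_coeff_def r3 e B_def[symmetric] cm[symmetric] by simp
  moreover have "c N * jacobi_coeff q N (j + 1) = P * q\<^sup>2 * x * qpoch q (2 * N) * A * ((1 - y) * (1 - q\<^sup>2 * y) * B)"
    unfolding jacobi_coeff_def r4 e A_def[symmetric] cp[symmetric] by simp
  moreover have "jacobi_coeff q N j = P * qpoch q (2 * N) * ((1 - q\<^sup>2 * x) * A) * ((1 - q\<^sup>2 * y) * B)"
    unfolding jacobi_coeff_def r1 r2 P_def by simp
  moreover have "jacobi_coeff q (Suc N) j =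
      P * (qpoch q (2 * N) * (1 - q\<^sup>2 * x * y) * (1 - q\<^sup>2 * (q\<^sup>2 * x * y))) * A * B"
    unfolding jacobi_coeff_def e A_def[symmetric] B_def[symmetric] P_def[symmetric] Q ..
  ultimately show ?thesis
    unfolding c2 distrib_left by algebra
qed

lemma jacobi_coeff_eq_0: "\<bar>j\<bar> > int N \<Longrightarrow> jacobi_coeff q N j = 0"
  by (auto simp: jacobi_coeff_def qpoch_inv_def)

text \<open>The summation range is given by \<open>M\<close> and stays fixed in the induction on
  \<open>N\<close>. Shifting the index then loses only boundary terms, whose coefficients vanish
  because N < M in the induction step.\<close>

lemma finite_jacobi_product:
  assumes q: "0 < q" "q < 1" and "N \<le> M"
  shows "(\<Prod>k<N. 1 + 2 * q ^ (2 * k + 1) * cos u + (q ^ (2 * k + 1))\<^sup>2) =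
    (\<Sum>j = - int M..int M. jacobi_coeff q N j * cos (of_int j * u))"
  using \<open>N \<le> M\<close>
proof (induction N)
  case 0
  have "(\<Sum>j = - int M..int M. jacobi_coeff q 0 j * cos (of_int j * u)) =
      (\<Sum>j\<in>{0}. jacobi_coeff q 0 j * cos (of_int j * u))"
    by (rule sum.mono_neutral_right) (auto intro: jacobi_coeff_eq_0)
  then show ?case
    by (simp add: jacobi_coeff_def qpoch_inv_def qpoch_def)
next
  case (Suc N)
  define c where "c = q ^ (2 * N + 1)"
  let ?I = "{- int M..int M}" and ?a = "jacobi_coeff q N"
  have up: "(\<Sum>j\<in>?I. ?a j * cos ((of_int j + 1) * u)) = (\<Sum>j\<in>?I. ?a (j - 1) * cos (of_int j * u))"
    by (rule sum.reindex_bij_witness_not_neutral[of "{int M}" "{- int M}" _ "\<lambda>j. j - 1" "\<lambda>j. j + 1"])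
      (use Suc.prems in \<open>auto simp: jacobi_coeff_eq_0\<close>)
  have down: "(\<Sum>j\<in>?I. ?a j * cos ((of_int j - 1) * u)) = (\<Sum>j\<in>?I. ?a (j + 1) * cos (of_int j * u))"
    by (rule sum.reindex_bij_witness_not_neutral[of "{- int M}" "{int M}" _ "\<lambda>j. j + 1" "\<lambda>j. j - 1"])
      (use Suc.prems in \<open>auto simp: jacobi_coeff_eq_0\<close>)
  have cc: "2 * cos u * cos (of_int j * u) = cos ((of_int j + 1) * u) + cos ((of_int j - 1) * u)" for j :: int
    by (simp add: ring_distribs cos_add cos_diff)
  have "(\<Prod>k<Suc N. 1 + 2 * q ^ (2 * k + 1) * cos u + (q ^ (2 * k + 1))\<^sup>2) =
      (\<Sum>j\<in>?I. ?a j * cos (of_int j * u)) * (1 + 2 * c * cos u + c\<^sup>2)"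
    using Suc by (simp add: c_def)
  also have "\<dots> = (\<Sum>j\<in>?I. (1 + c\<^sup>2) * (?a j * cos (of_int j * u)) + c * (?a j * (2 * cos u * cos (of_int j * u))))"
    unfolding sum_distrib_right by (intro sum.cong refl) (simp add: algebra_simps)
  also have "\<dots> = (1 + c\<^sup>2) * (\<Sum>j\<in>?I. ?a j * cos (of_int j * u)) +
      c * ((\<Sum>j\<in>?I. ?a j * cos ((of_int j + 1) * u)) + (\<Sum>j\<in>?I. ?a j * cos ((of_int j - 1) * u)))"
    unfolding cc by (simp add: sum.distrib sum_distrib_left distrib_left)
  also have "\<dots> = (\<Sum>j\<in>?I. jacobi_coeff q (Suc N) j * cos (of_int j * u))"
    unfolding up down jacobi_coeff_Suc[OF q] c_def[symmetric]
    by (simp add: sum.distrib sum_distrib_left algebra_simps)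
  finally show ?case .
qed

section \<open>The limit of the finite triple product\<close>

lemma summable_on_int:
  fixes f :: "int \<Rightarrow> real"
  assumes "summable (\<lambda>n. f (int n))" "summable (\<lambda>n. f (- int n))" "\<And>j. f j \<ge> 0"
  shows "f summable_on UNIV"
proof -
  have "f summable_on range int"
    using assms by (subst summable_on_reindex) (auto simp: o_def intro!: norm_summable_imp_summable_on)
  moreover have "f summable_on range (\<lambda>n. - int n)"
    using assms by (subst summable_on_reindex) (auto simp: o_def inj_on_def intro!: norm_summable_imp_summable_on)
  ultimately have "f summable_on (range int \<union> range (\<lambda>n. - int n))"
    by (rule summable_on_union)
  moreover have "range int \<union> range (\<lambda>n. - int n) = UNIV"
    by (auto simp: image_iff) (metis int_cases2)
  ultimately show ?thesis by simp
qed

text \<open>Dominated convergence for the counting measure, reached through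
  \<open>infsetsum\<close>, which is an integral by definition.\<close>

lemma infsum_dominated_convergence:
  fixes f :: "nat \<Rightarrow> 'a :: countable \<Rightarrow> real"
  assumes b: "b summable_on UNIV" and f: "\<And>n j. \<bar>f n j\<bar> \<le> b j"
    and lim: "\<And>j. (\<lambda>n. f n j) \<longlonglongrightarrow> g j"
  shows "(\<lambda>n. infsum (f n) UNIV) \<longlonglongrightarrow> infsum g UNIV"
proof -
  have b0: "b j \<ge> 0" for j using f[of 0 j] by linarith
  have g: "\<bar>g j\<bar> \<le> b j" for j
    using lim[of j, THEN tendsto_rabs] by (rule LIMSEQ_le_const2) (use f in auto)
  have abs: "Infinite_Set_Sum.abs_summable_on h UNIV" if "\<And>j. \<bar>h j\<bar> \<le> b j" for h :: "'a \<Rightarrow> real"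
    unfolding abs_summable_equivalent[symmetric]
    using b by (rule summable_on_comparison_test) (use that in auto)
  have "(\<lambda>n. infsetsum (f n) UNIV) \<longlonglongrightarrow> infsetsum g UNIV"
    unfolding infsetsum_def
    by (rule integral_dominated_convergence[where w = b])
      (use abs[of b] b0 f lim in \<open>auto simp: abs_summable_on_def\<close>)
  then show ?thesis
    by (simp add: infsetsum_infsum[OF abs[OF f]] infsetsum_infsum[OF abs[OF g]])
qed

lemma summable_on_power_square:
  fixes q :: real
  assumes "0 < q" "q < 1"
  shows "(\<lambda>j::int. q powi (j * j)) summable_on UNIV"
proof (rule summable_on_int)
  have "q powi (int n * int n) \<le> q ^ n" for n
  proof -
    have "q powi (int n * int n) = q ^ (n * n)"
      by (metis of_nat_mult power_int_of_nat)
    also have "\<dots> \<le> q ^ n"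
      using assms by (intro power_decreasing) auto
    finally show ?thesis .
  qed
  then have "summable (\<lambda>n. q powi (int n * int n))"
    using assms by (intro summable_comparison_test'[OF summable_geometric[of q]]) auto
  then show "summable (\<lambda>n. q powi (int n * int n))" "summable (\<lambda>n. q powi (- int n * - int n))"
    by simp_all
qed (use assms in auto)

text \<open>The product converges absolutely and has no zero factor, so its limit is nonzero. It
  decreases, so the limit is also a lower bound, and 1/L bounds all reciprocals uniformly.\<close>

lemma qpoch_limit:
  assumes "0 < q" "q < 1"
  obtains L where "L > 0" "qpoch q \<longlonglongrightarrow> L" "\<And>m. qpoch q m \<ge> L"
proof -
  let ?f = "\<lambda>i. 1 - q ^ (2 * Suc i)"
  have q2: "q\<^sup>2 < 1" using assms by (simp add: power_less_one_iff)
  have p: "q ^ (2 * Suc i) = q\<^sup>2 * (q\<^sup>2) ^ i" for i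
    by (simp add: power_mult[symmetric] power_add[symmetric])
  have "summable (\<lambda>i. q\<^sup>2 * (q\<^sup>2) ^ i)"
    using q2 by (intro summable_mult summable_geometric) simp
  then have "summable (\<lambda>i. norm (?f i - 1))"
    unfolding p by (simp add: abs_mult)
  then have "convergent_prod ?f"
    by (intro abs_convergent_prod_imp_convergent_prod summable_imp_abs_convergent_prod)
  moreover have nz: "?f i \<noteq> 0" for i
    using qpoch_pos[OF assms, of "Suc i"] unfolding qpoch_Suc by (metis less_irrefl mult_zero_right)
  ultimately obtain L where L: "L \<noteq> 0" "(\<lambda>n. \<Prod>i\<le>n. ?f i) \<longlonglongrightarrow> L"
    using convergent_prod_iff_nz_lim[of ?f, OF nz] by metis
  have "(\<lambda>n. qpoch q (Suc n)) \<longlonglongrightarrow> L"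
    using L(2) unfolding qpoch_def lessThan_Suc_atMost .
  then have lim: "qpoch q \<longlonglongrightarrow> L"
    by (simp add: filterlim_sequentially_Suc)
  moreover have "decseq (qpoch q)"
  proof (rule decseq_SucI)
    fix m
    show "qpoch q (Suc m) \<le> qpoch q m"
      unfolding qpoch_Suc using qpoch_pos[OF assms, of m] assms by (simp add: mult_left_le)
  qed
  ultimately have ge: "L \<le> qpoch q m" for m
    by (simp add: decseq_ge)
  have "L \<ge> 0"
    using lim by (rule LIMSEQ_le_const) (use qpoch_pos[OF assms] less_imp_le in blast)
  then show ?thesis
    using that[OF _ lim ge] L(1) by (simp add: less_le)
qed

text \<open>The prefactor \<open>qpoch q N\<close> is the normalization under which the coefficient
  of cos(ju) tends to q^(j^2): four Pochhammer symbols contribute L * L / (L * L). The dominating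
  function is q^(j^2) / L^2.\<close>

lemma jacobi_product_limit:
  assumes q: "0 < q" "q < 1"
  shows "(\<lambda>N. qpoch q N * (\<Prod>k<N. 1 + 2 * q ^ (2 * k + 1) * cos u + (q ^ (2 * k + 1))\<^sup>2))
    \<longlonglongrightarrow> (\<Sum>\<^sub>\<infinity>j::int. q powi (j * j) * cos (of_int j * u))"
proof -
  obtain L where L: "L > 0" "qpoch q \<longlonglongrightarrow> L" "\<And>m. qpoch q m \<ge> L"
    using qpoch_limit[OF q] by metis
  have le1: "qpoch q m \<le> 1" for m
    unfolding qpoch_def
  proof (rule prod_le_1)
    fix i
    have "0 < q ^ (2 * Suc i)" "q ^ (2 * Suc i) \<le> 1"
      using q by (simp_all only: zero_less_power power_le_one less_imp_le)
    then show "0 \<le> 1 - q ^ (2 * Suc i) \<and> 1 - q ^ (2 * Suc i) \<le> 1" by linarith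
  qed
  have inv0: "qpoch_inv q m \<ge> 0" for m
    using qpoch_pos[OF q] by (simp add: qpoch_inv_def less_imp_le)
  have invL: "qpoch_inv q m \<le> inverse L" for m
    using L(1,3) by (auto simp: qpoch_inv_def intro: le_imp_inverse_le)
  have bound: "\<bar>qpoch q N * (jacobi_coeff q N j * cos (of_int j * u))\<bar> \<le> q powi (j * j) * (inverse L)\<^sup>2" for N j
  proof -
    have J: "jacobi_coeff q N j \<ge> 0"
      unfolding jacobi_coeff_def using q qpoch_pos[OF q] inv0
      by (intro mult_nonneg_nonneg) (auto simp: less_imp_le)
    have "\<bar>qpoch q N * (jacobi_coeff q N j * cos (of_int j * u))\<bar> =
        qpoch q N * (jacobi_coeff q N j * \<bar>cos (of_int j * u)\<bar>)"
      by (simp only: abs_mult abs_of_nonneg[OF J] abs_of_pos[OF qpoch_pos[OF q]])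
    also have "\<dots> =
        (qpoch q N * qpoch q (2 * N)) * (qpoch_inv q (int N + j) * qpoch_inv q (int N - j)) * (q powi (j * j) * \<bar>cos (of_int j * u)\<bar>)"
      by (simp only: jacobi_coeff_def mult_ac)
    also have "\<dots> \<le> (1 * 1) * (inverse L * inverse L) * (q powi (j * j) * 1)"
    proof -
      have 1: "qpoch q N * qpoch q (2 * N) \<le> 1 * 1"
        by (rule mult_mono[OF le1 le1]) (simp_all add: less_imp_le[OF qpoch_pos[OF q]])
      have 2: "qpoch_inv q (int N + j) * qpoch_inv q (int N - j) \<le> inverse L * inverse L"
        by (rule mult_mono[OF invL invL]) (use inv0 L(1) in simp_all)
      have 3: "q powi (j * j) * \<bar>cos (of_int j * u)\<bar> \<le> q powi (j * j) * 1"
        by (rule mult_left_mono) (use q in simp_all)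
      show ?thesis
        by (rule mult_mono[OF mult_mono[OF 1 2] 3]) (use inv0 L(1) q in simp_all)
    qed
    finally show ?thesis by (simp add: power2_eq_square mult_ac)
  qed
  have inv_lim: "(\<lambda>N. qpoch_inv q (int N + j)) \<longlonglongrightarrow> inverse L" for j
  proof -
    have "filterlim (\<lambda>N. nat (int N + j)) at_top sequentially"
      unfolding filterlim_at_top
    proof
      fix Z
      show "eventually (\<lambda>N. Z \<le> nat (int N + j)) sequentially"
        by (rule eventually_sequentiallyI[of "Z + nat \<bar>j\<bar>"]) linarith
    qed
    then have "(\<lambda>N. inverse (qpoch q (nat (int N + j)))) \<longlonglongrightarrow> inverse L"
      using L(1) by (intro tendsto_inverse filterlim_compose[OF L(2)]) auto
    then show ?thesis
    proof (rule Lim_transform_eventually)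
      show "\<forall>\<^sub>F N in sequentially. inverse (qpoch q (nat (int N + j))) = qpoch_inv q (int N + j)"
        by (rule eventually_sequentiallyI[of "nat \<bar>j\<bar>"]) (auto simp: qpoch_inv_def)
    qed
  qed
  have "filterlim (\<lambda>N::nat. 2 * N) at_top sequentially"
    by (rule filterlim_subseq) (simp add: strict_mono_def)
  then have L2: "(\<lambda>N. qpoch q (2 * N)) \<longlonglongrightarrow> L"
    by (rule filterlim_compose[OF L(2)])
  have lim: "(\<lambda>N. qpoch q N * (jacobi_coeff q N j * cos (of_int j * u))) \<longlonglongrightarrow> q powi (j * j) * cos (of_int j * u)" for j
  proof -
    have "(\<lambda>N. qpoch_inv q (int N - j)) \<longlonglongrightarrow> inverse L"
      using inv_lim[of "- j"] by simp
    then have "(\<lambda>N. qpoch q N * (q powi (j * j) * qpoch q (2 * N) * qpoch_inv q (int N + j) * qpoch_inv q (int N - j) * cos (of_int j * u)))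
      \<longlonglongrightarrow> L * (q powi (j * j) * L * inverse L * inverse L * cos (of_int j * u))"
      by (intro tendsto_mult L L2 inv_lim tendsto_const)
    moreover have "L * (q powi (j * j) * L * inverse L * inverse L * cos (of_int j * u)) = q powi (j * j) * cos (of_int j * u)"
      using L(1) by (simp add: field_simps)
    ultimately show ?thesis
      unfolding jacobi_coeff_def by simp
  qed
  have "(\<lambda>N. \<Sum>\<^sub>\<infinity>j. qpoch q N * (jacobi_coeff q N j * cos (of_int j * u))) \<longlonglongrightarrow>
      (\<Sum>\<^sub>\<infinity>j::int. q powi (j * j) * cos (of_int j * u))"
    using bound lim
    by (intro infsum_dominated_convergence[where b = "\<lambda>j. q powi (j * j) * (inverse L)\<^sup>2"]
        summable_on_cmult_left summable_on_power_square q)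
  moreover have "(\<Sum>\<^sub>\<infinity>j. qpoch q N * (jacobi_coeff q N j * cos (of_int j * u))) =
      qpoch q N * (\<Prod>k<N. 1 + 2 * q ^ (2 * k + 1) * cos u + (q ^ (2 * k + 1))\<^sup>2)" for N
  proof -
    have "(\<Sum>\<^sub>\<infinity>j. qpoch q N * (jacobi_coeff q N j * cos (of_int j * u))) =
        (\<Sum>\<^sub>\<infinity>j\<in>{- int N..int N}. qpoch q N * (jacobi_coeff q N j * cos (of_int j * u)))"
      by (rule infsum_cong_neutral) (auto intro: jacobi_coeff_eq_0)
    then show ?thesis
      unfolding finite_jacobi_product[OF q order_refl] sum_distrib_left
      by (simp only: infsum_finite finite_atLeastAtMost_int)
  qed
  ultimately show ?thesis by simp
qed

section \<open>The theta function as a power series in \<open>1 + cos 2\<pi>x\<close>\<close>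


text \<open>\<theta>_3 in terms of the nome q = e^(\<pi>i\<tau>) and the angle u = 2\<pi>x, with
  real parts taken term by term. For \<tau> = i/l the nome is e^(-\<pi>/l).\<close>

definition theta_series :: "real \<Rightarrow> real \<Rightarrow> real" where
  "theta_series q u = (\<Sum>\<^sub>\<infinity>j::int. q powi (j * j) * cos (of_int j * u))"

lemma summable_theta_series:
  fixes q :: real
  assumes "0 < q" "q < 1"
  shows "(\<lambda>j::int. q powi (j * j) * cos (of_int j * u)) summable_on UNIV"
proof (rule abs_summable_summable)
  show "(\<lambda>j::int. norm (q powi (j * j) * cos (of_int j * u))) summable_on UNIV"
    by (rule summable_on_comparison_test[OF summable_on_power_square[OF assms]])
      (use assms in \<open>auto simp: abs_mult intro!: mult_left_le\<close>)
qed

lemma Re_theta3: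
  assumes "l > 0"
  shows "Re (theta3 (of_real x) (\<i> * of_real (1 / l))) = theta_series (exp (- pi / l)) (2 * pi * x)"
proof -
  let ?q = "exp (- pi / l)"
  let ?t = "\<lambda>k::int. exp (of_real pi * \<i> * (\<i> * of_real (1 / l)) * of_int k ^ 2 + 2 * of_real pi * \<i> * of_int k * of_real x)"
  have q: "0 < ?q" "?q < 1" using assms by auto
  have t: "?t k = of_real (?q powi (k * k)) * cis (of_int k * (2 * pi * x))" for k
  proof -
    have "?q powi (k * k) = exp (- pi / l * of_int (k * k))"
      by (simp add: exp_power_int mult.commute)
    moreover have "of_real pi * \<i> * (\<i> * of_real (1 / l)) * of_int k ^ 2 + 2 * of_real pi * \<i> * of_int k * of_real x
        = of_real (- pi / l * of_int (k * k)) + \<i> * of_real (of_int k * (2 * pi * x))"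
      by (simp add: power2_eq_square field_simps)
    ultimately show ?thesis
      by (simp only: exp_add exp_of_real cis_conv_exp)
  qed
  have "(\<lambda>k. norm (?t k)) summable_on UNIV"
    unfolding t using summable_on_power_square[OF q] by (simp only: norm_mult norm_of_real norm_cis) simp
  then have "?t summable_on UNIV"
    by (rule abs_summable_summable)
  then have "Re (theta3 (of_real x) (\<i> * of_real (1 / l))) = (\<Sum>\<^sub>\<infinity>k. Re (?t k))"
    unfolding theta3_def by (rule infsum_Re[symmetric])
  then show ?thesis
    unfolding t theta_series_def by (simp only: Re_complex_of_real Im_complex_of_real times_complex.sel cis.sel) simp
qed

lemma theta_diff_eq:
  assumes "l > 0"
  shows "theta_diff l x = l powr (- 1 / 2) *
    (theta_series (exp (- pi / l)) (2 * pi * x) - theta_series (exp (- pi / l)) pi)"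
proof -
  have "1 / 2 = complex_of_real (1 / 2)" by simp
  then have "Re (theta3 (1 / 2) (\<i> * of_real (1 / l))) = theta_series (exp (- pi / l)) (2 * pi * (1 / 2))"
    using Re_theta3[OF assms, of "1 / 2"] by metis
  then show ?thesis
    by (simp only: theta_diff_def Re_theta3[OF assms] right_diff_distrib) simp
qed

lemma theta_series_limit:
  assumes "0 < q" "q < 1"
  shows "(\<lambda>N. qpoch q N * (\<Prod>k<N. 1 + 2 * q ^ (2 * k + 1) * cos u + (q ^ (2 * k + 1))\<^sup>2))
    \<longlonglongrightarrow> theta_series q u"
  unfolding theta_series_def by (rule jacobi_product_limit[OF assms])

section \<open>Bounds for the theta difference as a function of the Gaussian parameter\<close>

lemma jacobi_factor_nonneg: "0 \<le> 1 + 2 * a * cos u + a\<^sup>2" for a :: real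
proof -
  have "1 + 2 * a * cos u + a\<^sup>2 = (a + cos u)\<^sup>2 + (sin u)\<^sup>2"
    using sin_cos_squared_add[of u] by (simp add: power2_eq_square algebra_simps)
  then show ?thesis by simp
qed

lemma theta_series_nonneg:
  assumes q: "0 < q" "q < 1"
  shows "theta_series q u \<ge> 0"
  using theta_series_limit[OF q, of u]
proof (rule LIMSEQ_le_const)
  show "\<exists>N. \<forall>n\<ge>N. 0 \<le> qpoch q n * (\<Prod>k<n. 1 + 2 * q ^ (2 * k + 1) * cos u + (q ^ (2 * k + 1))\<^sup>2)"
    using qpoch_pos[OF q] by (intro exI allI impI mult_nonneg_nonneg prod_nonneg jacobi_factor_nonneg less_imp_le)
qed

text \<open>The order \<open>sqrt l\<close> matters, since it is exactly cancelled by the prefactor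
  \<open>l powr (- 1 / 2)\<close> of the theta difference. The constant \<open>exp pi\<close> pays
  for the term - 1 in the comparison of exponents.\<close>

lemma sum_gaussian_le:
  assumes l: "l > 0"
  shows "(\<Sum>i<M. exp (- pi / l) ^ (i * i)) \<le> exp pi * (1 + sqrt l)"
proof -
  define y where "y = 2 * pi / sqrt l"
  have y: "y > 0" using l by (simp add: y_def)
  have gauss_term: "exp (- pi / l) ^ (i * i) \<le> exp pi * exp (- y) ^ i" for i
  proof -
    \<comment> \<open>\<open>i\<^sup>2/l \<ge> 2i/\<surd>l - 1\<close> compares the Gaussian sum with a geometric series\<close>
    have "0 \<le> (real i / sqrt l - 1)\<^sup>2" by simp
    also have "\<dots> = real i * real i / l - 2 * real i / sqrt l + 1"
      using l by (simp add: power2_diff power_divide) (simp add: power2_eq_square)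
    finally have "pi * (2 * real i / sqrt l - 1) \<le> pi * (real i * real i / l)"
      by (intro mult_left_mono) auto
    then have "real (i * i) * (- pi / l) \<le> pi + real i * (- y)"
      by (simp add: y_def algebra_simps)
    then have "exp (real (i * i) * (- pi / l)) \<le> exp (pi + real i * (- y))"
      by simp
    then show ?thesis
      by (simp only: exp_of_nat_mult exp_add)
  qed
  have r: "exp (- y) < 1" using y by simp
  have "(\<Sum>i<M. exp (- pi / l) ^ (i * i)) \<le> (\<Sum>i<M. exp pi * exp (- y) ^ i)"
    by (intro sum_mono gauss_term)
  also have "\<dots> = exp pi * (\<Sum>i<M. exp (- y) ^ i)"
    by (simp add: sum_distrib_left)
  also have "(\<Sum>i<M. exp (- y) ^ i) \<le> 1 / (1 - exp (- y))"
    using r by (simp add: sum_gp_strict divide_right_mono)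
  also have "1 / (1 - exp (- y)) \<le> 1 + 1 / y"
  proof -
    have "1 + y \<le> exp y" by (rule exp_ge_add_one_self)
    then have "exp (- y) \<le> 1 / (1 + y)"
      using y by (simp add: exp_minus inverse_eq_divide frac_le)
    then have "y / (1 + y) \<le> 1 - exp (- y)"
      using y by (simp add: field_simps)
    then have "1 / (1 - exp (- y)) \<le> 1 / (y / (1 + y))"
      using y by (intro divide_left_mono mult_pos_pos) auto
    also have "\<dots> = 1 + 1 / y" using y by (simp add: field_simps)
    finally show ?thesis .
  qed
  also have "1 / y \<le> sqrt l"
  proof -
    have "1 / y = sqrt l / (2 * pi)" by (simp add: y_def)
    also have "\<dots> \<le> sqrt l / 1"
      using pi_ge_two l by (intro divide_left_mono) auto
    finally show ?thesis by simp
  qed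
  finally show ?thesis by (simp add: mult_left_mono)
qed

text \<open>At most two integers share an absolute value; counting 0 twice does no harm, because
  \<open>g\<close> is nonnegative.\<close>

lemma infsum_int_le:
  fixes f :: "int \<Rightarrow> real" and g :: "nat \<Rightarrow> real"
  assumes "f summable_on UNIV" "\<And>j. f j \<le> g (nat \<bar>j\<bar>)" "\<And>i. g i \<ge> 0" "\<And>M. (\<Sum>i<M. g i) \<le> S"
  shows "infsum f UNIV \<le> 2 * S"
proof (rule infsum_le_finite_sums[OF assms(1)])
  fix F :: "int set" assume F: "finite F"
  define h where "h j = g (nat \<bar>j\<bar>)" for j
  define M where "M = Suc (nat (Max (abs ` insert 0 F)))"
  have M: "nat \<bar>j\<bar> < M" if "j \<in> F" for j
  proof -
    have "\<bar>j\<bar> \<le> Max (abs ` insert 0 F)"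
      using F that by (intro Max_ge) auto
    then show ?thesis unfolding M_def by linarith
  qed
  let ?A = "int ` {..<M}" and ?B = "(\<lambda>i. - int i) ` {..<M}"
  have "F \<subseteq> ?A \<union> ?B"
  proof
    fix j assume "j \<in> F"
    then have "j = int (nat \<bar>j\<bar>) \<or> j = - int (nat \<bar>j\<bar>)" "nat \<bar>j\<bar> \<in> {..<M}"
      using M by auto
    then show "j \<in> ?A \<union> ?B" by blast
  qed
  have h0: "h j \<ge> 0" for j by (simp add: h_def assms(3))
  have "sum f F \<le> sum h F"
    unfolding h_def by (intro sum_mono assms(2))
  also have "\<dots> \<le> sum h (?A \<union> ?B)"
    using \<open>F \<subseteq> ?A \<union> ?B\<close> h0 by (intro sum_mono2) auto
  also have "\<dots> \<le> sum h ?A + sum h ?B"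
    using h0 sum.union_inter[of ?A ?B h] sum_nonneg[of "?A \<inter> ?B" h] by auto
  also have "sum h ?A = (\<Sum>i<M. g i)"
    by (subst sum.reindex) (auto simp: h_def)
  also have "sum h ?B = (\<Sum>i<M. g i)"
    by (subst sum.reindex) (auto simp: h_def inj_on_def)
  also have "(\<Sum>i<M. g i) + (\<Sum>i<M. g i) \<le> 2 * S"
    using assms(4)[of M] by simp
  finally show "sum f F \<le> 2 * S" .
qed

lemma powi_square_abs: "q powi (j * j) = q ^ (nat \<bar>j\<bar> * nat \<bar>j\<bar>)" for q :: real
proof -
  have "j * j = int (nat \<bar>j\<bar> * nat \<bar>j\<bar>)" by (simp add: abs_mult_self_eq)
  then show ?thesis by (metis power_int_of_nat)
qed

lemma theta_series_0_le:
  assumes l: "l > 0"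
  shows "theta_series (exp (- pi / l)) 0 \<le> 2 * (exp pi * (1 + sqrt l))"
  unfolding theta_series_def
proof (rule infsum_int_le)
  show "(\<lambda>j::int. exp (- pi / l) powi (j * j) * cos (of_int j * 0)) summable_on UNIV"
    using l by (intro summable_theta_series) auto
  show "(\<Sum>i<M. exp (- pi / l) ^ (i * i)) \<le> exp pi * (1 + sqrt l)" for M
    by (rule sum_gaussian_le[OF l])
qed (auto simp: powi_square_abs)

text \<open>The terms with j = 0 cancel, and (i + 1)^2 is at least i^2 + 1, so a factor q =
  e^(-\<pi>/l) can be taken out of the rest. It supplies the decay as \<open>l\<close> tends to
  0.\<close>

lemma theta_series_diff_le:
  assumes l: "l > 0"
  shows "theta_series (exp (- pi / l)) u - theta_series (exp (- pi / l)) v \<le>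
    4 * exp (- pi / l) * (exp pi * (1 + sqrt l))"
proof -
  let ?q = "exp (- pi / l)"
  define g where "g i = (if i = 0 then 0 else 2 * ?q ^ (i * i))" for i :: nat
  have q: "0 < ?q" "?q < 1" using l by auto
  let ?f = "\<lambda>j::int. ?q powi (j * j) * cos (of_int j * u) + - (?q powi (j * j) * cos (of_int j * v))"
  have sums: "(\<lambda>j::int. ?q powi (j * j) * cos (of_int j * u)) summable_on UNIV"
    "(\<lambda>j::int. - (?q powi (j * j) * cos (of_int j * v))) summable_on UNIV"
    using summable_theta_series[OF q] by (simp_all only: summable_on_uminus)
  have "theta_series ?q u - theta_series ?q v = infsum ?f UNIV"
    unfolding infsum_add[OF sums] infsum_uminus theta_series_def by simp
  also have "\<dots> \<le> 2 * (2 * ?q * (exp pi * (1 + sqrt l)))"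
  proof (rule infsum_int_le)
    show "?f summable_on UNIV"
      by (rule summable_on_add[OF sums])
    show "?f j \<le> g (nat \<bar>j\<bar>)" for j
    proof (cases "j = 0")
      case False
      have "cos (of_int j * u) - cos (of_int j * v) \<le> 2"
        using cos_le_one[of "of_int j * u"] cos_ge_minus_one[of "of_int j * v"] by linarith
      then have "?q powi (j * j) * (cos (of_int j * u) - cos (of_int j * v)) \<le> ?q powi (j * j) * 2"
        using q by (intro mult_left_mono) auto
      then show ?thesis
        using False by (simp add: g_def powi_square_abs algebra_simps)
    qed (simp add: g_def)
    show "g i \<ge> 0" for i by (simp add: g_def)
    show "(\<Sum>i<M. g i) \<le> 2 * ?q * (exp pi * (1 + sqrt l))" for M
    proof -
      have "(\<Sum>i<M. g i) \<le> (\<Sum>i<Suc M. g i)"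
        by (simp add: g_def)
      also have "\<dots> = (\<Sum>i<M. g (Suc i))"
        by (subst sum.lessThan_Suc_shift) (simp add: g_def)
      also have "\<dots> \<le> (\<Sum>i<M. 2 * ?q * ?q ^ (i * i))"
      proof (rule sum_mono)
        fix i
        have "?q ^ (Suc i * Suc i) \<le> ?q ^ Suc (i * i)"
          using q by (intro power_decreasing) auto
        then show "g (Suc i) \<le> 2 * ?q * ?q ^ (i * i)"
          unfolding g_def by simp
      qed
      also have "\<dots> = 2 * ?q * (\<Sum>i<M. ?q ^ (i * i))"
        by (simp only: sum_distrib_left)
      also have "\<dots> \<le> 2 * ?q * (exp pi * (1 + sqrt l))"
        by (intro mult_left_mono sum_gaussian_le l) simp
      finally show ?thesis .
    qed
  qed
  finally show ?thesis by simp
qed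

text \<open>The left side is (1 + a)^2 - 2a (1 - cos u). As (1 + a)^2 is at most 4, the subtracted
  term is at least (1 + a)^2 a (1 - cos u) / 2, and 1 - y is at most e^(-y).\<close>

lemma jacobi_factor_decay:
  fixes a :: real
  assumes "0 \<le> a" "a \<le> 1"
  shows "1 + 2 * a * cos u + a\<^sup>2 \<le> (1 + 2 * a * cos 0 + a\<^sup>2) * exp (- (1 - cos u) / 2 * a)"
proof -
  have "(1 + a)\<^sup>2 \<le> 2\<^sup>2"
    using assms by (intro power_mono) auto
  then have "a * (1 - cos u) * (1 + a)\<^sup>2 \<le> a * (1 - cos u) * 4"
    using assms by (intro mult_left_mono) auto
  then have "1 + 2 * a * cos u + a\<^sup>2 \<le> (1 + a)\<^sup>2 * (1 + (- (1 - cos u) / 2 * a))"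
    by (simp add: power2_eq_square field_simps)
  also have "\<dots> \<le> (1 + a)\<^sup>2 * exp (- (1 - cos u) / 2 * a)"
    by (intro mult_left_mono exp_ge_add_one_self) simp
  also have "(1 + a)\<^sup>2 = 1 + 2 * a * cos 0 + a\<^sup>2"
    by (simp add: power2_eq_square algebra_simps)
  finally show ?thesis .
qed

text \<open>
  With \<open>q = e\<^sup>-\<^sup>\<pi>\<^sup>/\<^sup>l\<close> the sum in the exponent is of order \<open>l\<close>, which takes the place of the
  modular transformation of \<open>\<theta>\<^sub>3\<close> as \<open>l \<rightarrow> \<infinity>\<close>.
\<close>

lemma theta_series_decay:
  assumes q: "0 < q" "q < 1"
  shows "theta_series q u \<le> theta_series q 0 * exp (- (1 - cos u) / 2 * (\<Sum>k<K. q ^ (2 * k + 1)))"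
proof (rule LIMSEQ_le)
  let ?P = "\<lambda>u N. qpoch q N * (\<Prod>k<N. 1 + 2 * q ^ (2 * k + 1) * cos u + (q ^ (2 * k + 1))\<^sup>2)"
  let ?E = "exp (- (1 - cos u) / 2 * (\<Sum>k<K. q ^ (2 * k + 1)))"
  show "?P u \<longlonglongrightarrow> theta_series q u" "(\<lambda>N. ?P 0 N * ?E) \<longlonglongrightarrow> theta_series q 0 * ?E"
    by (intro tendsto_mult_right theta_series_limit q)+
  have "?P u N \<le> ?P 0 N * ?E" if "N \<ge> K" for N
  proof -
    have a: "0 \<le> q ^ (2 * k + 1)" "q ^ (2 * k + 1) \<le> 1" for k
      using q by (simp_all only: zero_le_power power_le_one less_imp_le)
    have "(\<Prod>k<N. 1 + 2 * q ^ (2 * k + 1) * cos u + (q ^ (2 * k + 1))\<^sup>2) \<le>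
        (\<Prod>k<N. (1 + 2 * q ^ (2 * k + 1) * cos 0 + (q ^ (2 * k + 1))\<^sup>2) * exp (- (1 - cos u) / 2 * q ^ (2 * k + 1)))"
      by (intro prod_mono conjI jacobi_factor_nonneg jacobi_factor_decay a)
    also have "\<dots> = (\<Prod>k<N. 1 + 2 * q ^ (2 * k + 1) * cos 0 + (q ^ (2 * k + 1))\<^sup>2) *
        exp (- (1 - cos u) / 2 * (\<Sum>k<N. q ^ (2 * k + 1)))"
      by (simp only: prod.distrib sum_distrib_left exp_sum finite_lessThan)
    also have "\<dots> \<le> (\<Prod>k<N. 1 + 2 * q ^ (2 * k + 1) * cos 0 + (q ^ (2 * k + 1))\<^sup>2) * ?E"
    proof (intro mult_left_mono prod_nonneg jacobi_factor_nonneg)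
      have "(\<Sum>k<K. q ^ (2 * k + 1)) \<le> (\<Sum>k<N. q ^ (2 * k + 1))"
        using that a by (intro sum_mono2) auto
      then have "(1 - cos u) / 2 * (\<Sum>k<K. q ^ (2 * k + 1)) \<le> (1 - cos u) / 2 * (\<Sum>k<N. q ^ (2 * k + 1))"
        by (intro mult_left_mono) auto
      then show "exp (- (1 - cos u) / 2 * (\<Sum>k<N. q ^ (2 * k + 1))) \<le> ?E"
        by (simp only: exp_le_cancel_iff minus_divide_left[symmetric] mult_minus_left neg_le_iff_le)
    qed
    finally show ?thesis
      using qpoch_pos[OF q, of N] by (simp only: mult.assoc mult_le_cancel_left_pos)
  qed
  then show "\<exists>N. \<forall>n\<ge>N. ?P u n \<le> ?P 0 n * ?E" by blast
qed

text \<open>Up to a constant the bound is the integrand in the hypothesis of (ii).\<close>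

lemma theta_diff_le:
  assumes l: "l > 0"
  shows "theta_diff l x \<le> 4 * exp pi * ((1 + l powr (- 1 / 2)) * exp (- pi / l))"
proof -
  have s: "l powr (- 1 / 2) * sqrt l = 1"
    using l by (simp add: powr_half_sqrt[symmetric] powr_add[symmetric])
  have "theta_diff l x \<le> l powr (- 1 / 2) * (4 * exp (- pi / l) * (exp pi * (1 + sqrt l)))"
    unfolding theta_diff_eq[OF l] by (intro mult_left_mono theta_series_diff_le l) simp
  also have "\<dots> = 4 * exp pi * exp (- pi / l) * (l powr (- 1 / 2) + l powr (- 1 / 2) * sqrt l)"
    by (simp only: algebra_simps)
  finally show ?thesis
    unfolding s by (simp add: algebra_simps)
qed

text \<open>Up to a constant the bound is the integrand in the hypothesis of (i). For l at most 1 it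
  follows from \<open>theta_diff_le\<close>, as both 1 and e^(al) stay bounded by constant multiples
  of \<open>l powr (- 1 / 2)\<close> and 1; for l > 1 it comes from the product.\<close>

lemma theta_diff_decay:
  assumes "cos (2 * pi * x) < 1"
  obtains a C where "a > 0" "C > 0"
    "\<And>l. l > 0 \<Longrightarrow> theta_diff l x \<le> C * (l powr (- 1 / 2) * exp (- pi / l - a * l))"
proof
  define d where "d = (1 - cos (2 * pi * x)) / 2"
  \<comment> \<open>The first \<lfloor>l\<rfloor> \<ge> l/2 odd powers of q = e^(-\<pi>/l) are each
    at least e^(-2\<pi>), so the product yields decay e^(-2al). Half of this exponent is kept in
    reserve, hence the 4.\<close>
  define a where "a = d * exp (- 2 * pi) / 4"
  \<comment> \<open>One summand for each of the ranges l \<le> 1 and l > 1.\<close>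
  define C where "C = 8 * exp (pi + a) + 4 * exp (2 * pi) / a"
  have d: "d > 0" using assms by (simp add: d_def)
  then show a: "a > 0" by (simp add: a_def)
  then show "C > 0" by (simp add: C_def add_pos_pos)
  fix l :: real assume l: "l > 0"
  let ?B = "l powr (- 1 / 2) * exp (- pi / l - a * l)"
  have s: "l powr (- 1 / 2) * sqrt l = 1"
    using l by (simp add: powr_half_sqrt[symmetric] powr_add[symmetric])
  have B: "?B > 0" using l by simp
  show "theta_diff l x \<le> C * ?B"
  proof (cases "l \<le> 1")
    case True
    have "1 \<le> l powr (- 1 / 2)"
      using l True by (simp add: powr_minus powr_half_sqrt inverse_eq_divide)
    then have "theta_diff l x \<le> 4 * exp pi * ((l powr (- 1 / 2) + l powr (- 1 / 2)) * exp (- pi / l))"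
      by (intro order_trans[OF theta_diff_le[OF l]] mult_left_mono mult_right_mono add_mono) auto
    also have "\<dots> = 8 * exp pi * (l powr (- 1 / 2) * exp (- pi / l)) * 1"
      by (simp add: algebra_simps)
    also have "\<dots> \<le> 8 * exp pi * (l powr (- 1 / 2) * exp (- pi / l)) * (exp a * exp (- (a * l)))"
    proof (rule mult_left_mono)
      have "a * l \<le> a * 1" using a True by (intro mult_left_mono) auto
      then show "1 \<le> exp a * exp (- (a * l))"
        by (simp add: exp_add[symmetric])
    qed simp
    also have "\<dots> = 8 * exp (pi + a) * ?B"
      by (simp add: exp_add exp_diff exp_minus field_simps)
    also have "\<dots> \<le> C * ?B"
      using B a by (intro mult_right_mono) (auto simp: C_def)
    finally show ?thesis .
  next
    case False
    define q where "q = exp (- pi / l)"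
    have q: "0 < q" "q < 1" using l by (auto simp: q_def)
    define K where "K = nat \<lfloor>l\<rfloor>"
    have K: "real K \<le> l" "l / 2 \<le> real K"
    proof -
      have K': "real K = of_int \<lfloor>l\<rfloor>" "\<lfloor>l\<rfloor> \<ge> 1"
        using False by (simp_all add: K_def)
      then show "real K \<le> l" by simp
      have "real_of_int \<lfloor>l\<rfloor> \<ge> 1" using K'(2) by linarith
      then show "l / 2 \<le> real K"
        unfolding K'(1) using real_of_int_floor_add_one_gt[of l] by linarith
    qed
    have "q ^ (2 * k + 1) \<ge> exp (- 2 * pi)" if "k < K" for k
    proof -
      have "real (2 * k + 1) \<le> 2 * l" using that K(1) by linarith
      then have "pi / l * real (2 * k + 1) \<le> pi / l * (2 * l)"
        using l by (intro mult_left_mono) auto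
      then have "- 2 * pi \<le> real (2 * k + 1) * (- pi / l)"
        using l by (simp add: mult.commute)
      then have "exp (- 2 * pi) \<le> exp (real (2 * k + 1) * (- pi / l))"
        by simp
      then show ?thesis unfolding q_def by (simp only: exp_of_nat_mult)
    qed
    then have "(\<Sum>k<K. exp (- 2 * pi)) \<le> (\<Sum>k<K. q ^ (2 * k + 1))"
      by (intro sum_mono) auto
    then have "l / 2 * exp (- 2 * pi) \<le> (\<Sum>k<K. q ^ (2 * k + 1))"
      using K(2) by (intro order_trans[OF mult_right_mono[OF K(2)]]) auto
    then have "d * (l / 2 * exp (- 2 * pi)) \<le> d * (\<Sum>k<K. q ^ (2 * k + 1))"
      using d by (intro mult_left_mono) auto
    then have E: "exp (- (1 - cos (2 * pi * x)) / 2 * (\<Sum>k<K. q ^ (2 * k + 1))) \<le> exp (- (2 * a * l))"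
      by (simp only: exp_le_cancel_iff minus_divide_left[symmetric] mult_minus_left neg_le_iff_le d_def[symmetric])
        (simp add: a_def field_simps)
    have "theta_diff l x \<le> l powr (- 1 / 2) * theta_series q (2 * pi * x)"
      unfolding theta_diff_eq[OF l] q_def[symmetric]
      by (intro mult_left_mono) (use theta_series_nonneg[OF q] in auto)
    also have "\<dots> \<le> l powr (- 1 / 2) * (2 * (exp pi * (1 + sqrt l)) * exp (- (2 * a * l)))"
    proof (intro mult_left_mono)
      show "theta_series q (2 * pi * x) \<le> 2 * (exp pi * (1 + sqrt l)) * exp (- (2 * a * l))"
      proof (rule order_trans[OF theta_series_decay[OF q, of _ K] mult_mono[OF _ E]])
        show "theta_series q 0 \<le> 2 * (exp pi * (1 + sqrt l))"
          unfolding q_def by (rule theta_series_0_le[OF l])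
      qed (use l in auto)
    qed simp
    also have "\<dots> \<le> l powr (- 1 / 2) * (4 * exp (2 * pi) / a * (exp (- pi / l) * exp (- (a * l))))"
    proof (intro mult_left_mono)
      have sl: "1 \<le> sqrt l" "sqrt l \<le> l"
        using False l by (simp_all add: real_le_lsqrt self_le_power power2_eq_square)
      \<comment> \<open>The reserve e^(-al) is spent on the factor \<open>l\<close> that bounds
        \<open>sqrt l\<close>.\<close>
      have al: "a * l \<le> exp (a * l)"
        using exp_ge_add_one_self[of "a * l"] by linarith
      have "2 * (exp pi * (1 + sqrt l)) * exp (- (2 * a * l)) \<le> 4 * exp pi * l * exp (- (2 * a * l))"
        using sl by (intro mult_right_mono) auto
      also have "\<dots> = 4 * exp pi / a * (a * l) * (exp (- (a * l)) * exp (- (a * l)))"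
        using a by (simp add: exp_add[symmetric] field_simps)
      also have "\<dots> \<le> 4 * exp pi / a * exp (a * l) * (exp (- (a * l)) * exp (- (a * l)))"
        using a al by (intro mult_right_mono mult_left_mono) auto
      also have "\<dots> = 4 * exp pi / a * 1 * exp (- (a * l))"
      proof -
        have "exp (a * l) * exp (- (a * l)) = 1" by (simp add: exp_add[symmetric])
        then show ?thesis by (metis mult.assoc)
      qed
      also have "\<dots> \<le> 4 * exp pi / a * (exp pi * exp (- pi / l)) * exp (- (a * l))"
      proof (intro mult_right_mono mult_left_mono)
        have "pi / l \<le> pi / 1" using False by (intro divide_left_mono) auto
        then show "1 \<le> exp pi * exp (- pi / l)"
          by (simp add: exp_add[symmetric])
      qed (use a in auto)
      also have "\<dots> = 4 * exp (2 * pi) / a * (exp (- pi / l) * exp (- (a * l)))"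
      proof -
        have "exp (2 * pi) = exp pi * exp pi" using exp_add[of pi pi] by simp
        then show ?thesis by (simp only: mult_ac times_divide_eq_left times_divide_eq_right)
      qed
      finally show "2 * (exp pi * (1 + sqrt l)) * exp (- (2 * a * l)) \<le>
        4 * exp (2 * pi) / a * (exp (- pi / l) * exp (- (a * l)))" .
    qed simp
    also have "\<dots> = 4 * exp (2 * pi) / a * ?B"
      by (simp add: exp_diff exp_minus field_simps)
    also have "\<dots> \<le> C * ?B"
      using B a by (intro mult_right_mono) (auto simp: C_def)
    finally show ?thesis .
  qed
qed

text \<open>Monotone convergence, with the limit in \<open>N\<close> exchanged with the sum over
  \<open>m\<close>. The bound at 1 makes every coefficient sequence converge; the bound at
  \<open>s\<close> controls the partial sums.\<close>

lemma increasing_poly_limit: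
  fixes p :: "nat \<Rightarrow> real poly"
  assumes nonneg: "\<And>N m. 0 \<le> coeff (p N) m"
    and mono: "\<And>N m. coeff (p N) m \<le> coeff (p (Suc N)) m"
    and bdd: "\<And>N. poly (p N) s \<le> B" "\<And>N. poly (p N) 1 \<le> B'" and s: "s \<ge> 0"
  shows "summable (\<lambda>m. lim (\<lambda>N. coeff (p N) m) * s ^ m)"
    and "(\<lambda>N. poly (p N) s) \<longlonglongrightarrow> (\<Sum>m. lim (\<lambda>N. coeff (p N) m) * s ^ m)"
    and "0 \<le> lim (\<lambda>N. coeff (p N) m)"
proof -
  define e where "e m = lim (\<lambda>N. coeff (p N) m)" for m
  have inc: "incseq (\<lambda>N. coeff (p N) m)" for m
    by (rule incseq_SucI) (rule mono)
  have part: "(\<Sum>m<K. coeff (p N) m * t ^ m) \<le> poly (p N) t" if "t \<ge> 0" for K N t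
  proof -
    have "(\<Sum>m<K. coeff (p N) m * t ^ m) \<le> (\<Sum>m\<in>{..<K} \<union> {..degree (p N)}. coeff (p N) m * t ^ m)"
      using that nonneg by (intro sum_mono2) auto
    also have "\<dots> = (\<Sum>m\<le>degree (p N). coeff (p N) m * t ^ m)"
      by (rule sum.mono_neutral_right) (auto simp: coeff_eq_0)
    finally show ?thesis by (simp add: poly_altdef)
  qed
  have "coeff (p N) m \<le> B'" for N m
  proof -
    have "coeff (p N) m * 1 ^ m \<le> (\<Sum>i<Suc m. coeff (p N) i * 1 ^ i)"
      by (rule member_le_sum) (use nonneg in auto)
    then show ?thesis using part[where t = 1 and K = "Suc m" and N = N] bdd(2)[of N] by simp
  qed
  then have lim_e: "(\<lambda>N. coeff (p N) m) \<longlonglongrightarrow> e m" for m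
    unfolding e_def using incseq_convergent[OF inc, of m B'] by (metis limI)
  have le_e: "coeff (p N) m \<le> e m" for N m
    by (rule incseq_le[OF inc lim_e])
  have e0: "e m \<ge> 0" for m
    using nonneg[of 0 m] le_e[of 0 m] by linarith
  then show "0 \<le> lim (\<lambda>N. coeff (p N) m)" by (simp add: e_def)
  have incp: "incseq (\<lambda>N. poly (p N) s)"
  proof (rule incseq_SucI)
    fix N
    have "poly (p N) s = (\<Sum>m<Suc (degree (p N)). coeff (p N) m * s ^ m)"
      by (simp add: poly_altdef lessThan_Suc_atMost)
    also have "\<dots> \<le> (\<Sum>m<Suc (degree (p N)). coeff (p (Suc N)) m * s ^ m)"
      using s by (intro sum_mono mult_right_mono mono) auto
    also have "\<dots> \<le> poly (p (Suc N)) s" by (rule part[OF s])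
    finally show "poly (p N) s \<le> poly (p (Suc N)) s" .
  qed
  obtain E where E: "(\<lambda>N. poly (p N) s) \<longlonglongrightarrow> E" "\<And>N. poly (p N) s \<le> E"
    using incseq_convergent[OF incp, of B] bdd(1) by metis
  have le_E: "(\<Sum>m<K. e m * s ^ m) \<le> E" for K
  proof (rule LIMSEQ_le_const2)
    show "(\<lambda>N. \<Sum>m<K. coeff (p N) m * s ^ m) \<longlonglongrightarrow> (\<Sum>m<K. e m * s ^ m)"
      by (intro tendsto_intros lim_e)
    show "\<exists>N. \<forall>n\<ge>N. (\<Sum>m<K. coeff (p n) m * s ^ m) \<le> E"
      using part[OF s] E(2) order_trans by blast
  qed
  have sum_e: "summable (\<lambda>m. e m * s ^ m)"
    by (rule summableI_nonneg_bounded[of _ E]) (use e0 s le_E in auto)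
  then show "summable (\<lambda>m. lim (\<lambda>N. coeff (p N) m) * s ^ m)" by (simp add: e_def)
  have "(\<Sum>m. e m * s ^ m) \<le> E"
    by (rule suminf_le_const[OF sum_e le_E])
  moreover have "E \<le> (\<Sum>m. e m * s ^ m)"
  proof (rule LIMSEQ_le_const2[OF E(1)])
    have "poly (p N) s \<le> (\<Sum>m. e m * s ^ m)" for N
    proof -
      have "poly (p N) s = (\<Sum>m\<le>degree (p N). coeff (p N) m * s ^ m)"
        by (simp add: poly_altdef)
      also have "\<dots> \<le> (\<Sum>m\<le>degree (p N). e m * s ^ m)"
        using s by (intro sum_mono mult_right_mono le_e) auto
      also have "\<dots> \<le> (\<Sum>m. e m * s ^ m)"
        by (rule sum_le_suminf[OF sum_e]) (use e0 s in auto)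
      finally show ?thesis .
    qed
    then show "\<exists>N. \<forall>n\<ge>N. poly (p n) s \<le> (\<Sum>m. e m * s ^ m)" by blast
  qed
  ultimately show "(\<lambda>N. poly (p N) s) \<longlonglongrightarrow> (\<Sum>m. lim (\<lambda>N. coeff (p N) m) * s ^ m)"
    using E(1) by (simp add: e_def)
qed

text \<open>With a = q^(2k+1), the Jacobi factor is 1 + 2a cos u + a^2 = (1 - a)^2 + 2a (1 + cos u);
  this is the coefficient of 1 + cos u after division by (1 - a)^2.\<close>

definition jacobi_ratio :: "real \<Rightarrow> nat \<Rightarrow> real" where
  "jacobi_ratio q k = 2 * q ^ (2 * k + 1) / (1 - q ^ (2 * k + 1))\<^sup>2"

definition jacobi_poly :: "real \<Rightarrow> nat \<Rightarrow> real poly" where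
  "jacobi_poly q N = (\<Prod>k<N. [:1, jacobi_ratio q k:])"

text \<open>The part of the product free of \<open>u\<close>. It is the value of the product at u =
  \<pi>, where 1 + cos u = 0, so it tends to the theta series at \<pi>.\<close>

definition jacobi_base :: "real \<Rightarrow> nat \<Rightarrow> real" where
  "jacobi_base q N = qpoch q N * (\<Prod>k<N. (1 - q ^ (2 * k + 1))\<^sup>2)"

lemma jacobi_product_eq:
  assumes q: "0 < q" "q < 1"
  shows "qpoch q N * (\<Prod>k<N. 1 + 2 * q ^ (2 * k + 1) * cos u + (q ^ (2 * k + 1))\<^sup>2) =
    jacobi_base q N * poly (jacobi_poly q N) (1 + cos u)"
proof -
  have "1 + 2 * q ^ (2 * k + 1) * cos u + (q ^ (2 * k + 1))\<^sup>2 =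
      (1 - q ^ (2 * k + 1))\<^sup>2 * poly [:1, jacobi_ratio q k:] (1 + cos u)" for k
  proof -
    define a where "a = q ^ (2 * k + 1)"
    have "a < 1" using q unfolding a_def by (intro power_Suc_less_one[of q "2 * k", simplified] | simp)+
    then have "(1 - a)\<^sup>2 * poly [:1, 2 * a / (1 - a)\<^sup>2:] (1 + cos u) = (1 - a)\<^sup>2 + (1 + cos u) * (2 * a)"
      by (simp add: distrib_left)
    also have "\<dots> = 1 + 2 * a * cos u + a\<^sup>2"
      by (simp add: power2_eq_square algebra_simps)
    finally show ?thesis
      unfolding jacobi_ratio_def a_def[symmetric] by (rule sym)
  qed
  then show ?thesis
    by (simp only: jacobi_base_def jacobi_poly_def poly_prod prod.distrib mult.assoc)
qed

lemma jacobi_ratio_nonneg: "0 < q \<Longrightarrow> 0 \<le> jacobi_ratio q k"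
  by (simp add: jacobi_ratio_def)

lemma coeff_jacobi_poly_Suc:
  "coeff (jacobi_poly q (Suc N)) m =
    coeff (jacobi_poly q N) m + (case m of 0 \<Rightarrow> 0 | Suc i \<Rightarrow> jacobi_ratio q N * coeff (jacobi_poly q N) i)"
  by (simp add: jacobi_poly_def mult.commute[of _ "[:1, _:]"] coeff_pCons split: nat.split)

lemma coeff_jacobi_poly_nonneg: "0 < q \<Longrightarrow> 0 \<le> coeff (jacobi_poly q N) m"
proof (induction N arbitrary: m)
  case (Suc N)
  then show ?case
    by (auto simp: coeff_jacobi_poly_Suc jacobi_ratio_nonneg split: nat.split)
qed (simp add: jacobi_poly_def)

lemma coeff_jacobi_poly_mono: "0 < q \<Longrightarrow> coeff (jacobi_poly q N) m \<le> coeff (jacobi_poly q (Suc N)) m"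
  by (auto simp: coeff_jacobi_poly_Suc jacobi_ratio_nonneg coeff_jacobi_poly_nonneg split: nat.split)

lemma coeff_0_jacobi_poly: "coeff (jacobi_poly q N) 0 = 1"
  by (induction N) (simp_all add: coeff_jacobi_poly_Suc, simp add: jacobi_poly_def)

text \<open>What matters is that the bound is independent of \<open>N\<close>: 1 + y is at most e^y,
  and the ratios are dominated by a geometric sequence.\<close>

lemma poly_jacobi_poly_le:
  assumes q: "0 < q" "q < 1" and s: "s \<ge> 0"
  shows "poly (jacobi_poly q N) s \<le> exp (s * (2 / ((1 - q)\<^sup>2 * (1 - q))))"
proof -
  have r: "jacobi_ratio q k \<le> 2 / (1 - q)\<^sup>2 * q ^ k" for k
  proof -
    have "q ^ (2 * k + 1) \<le> q ^ 1" "q ^ (2 * k + 1) \<le> q ^ k"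
      using q by (intro power_decreasing; simp)+
    then have "2 * q ^ (2 * k + 1) / (1 - q ^ (2 * k + 1))\<^sup>2 \<le> 2 * q ^ k / (1 - q)\<^sup>2"
      using q by (intro frac_le power_mono mult_left_mono) auto
    then show ?thesis by (simp add: jacobi_ratio_def)
  qed
  have "poly (jacobi_poly q N) s = (\<Prod>k<N. 1 + s * jacobi_ratio q k)"
    by (simp add: jacobi_poly_def poly_prod)
  also have "\<dots> \<le> (\<Prod>k<N. exp (s * jacobi_ratio q k))"
    using s jacobi_ratio_nonneg[OF q(1)] by (intro prod_mono conjI exp_ge_add_one_self) simp
  also have "\<dots> = exp (s * (\<Sum>k<N. jacobi_ratio q k))"
    by (simp add: exp_sum sum_distrib_left)
  also have "\<dots> \<le> exp (s * (2 / ((1 - q)\<^sup>2 * (1 - q))))"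
  proof -
    have "(\<Sum>k<N. jacobi_ratio q k) \<le> (\<Sum>k<N. 2 / (1 - q)\<^sup>2 * q ^ k)"
      by (intro sum_mono r)
    also have "\<dots> = 2 / (1 - q)\<^sup>2 * (\<Sum>k<N. q ^ k)"
      by (simp only: sum_distrib_left)
    also have "\<dots> \<le> 2 / (1 - q)\<^sup>2 * (1 / (1 - q))"
      using q by (intro mult_left_mono) (auto simp: sum_gp_strict divide_right_mono)
    finally have "(\<Sum>k<N. jacobi_ratio q k) \<le> 2 / ((1 - q)\<^sup>2 * (1 - q))" by simp
    then show ?thesis
      unfolding exp_le_cancel_iff by (rule mult_left_mono[OF _ s])
  qed
  finally show ?thesis .
qed

text \<open>The theta difference subtracts the value at x = 1/2, that is at s = 0, which removes the
  constant term. Writing the coefficients as limits makes their measurability in \<open>l\<close>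
  accessible.\<close>

definition theta_diff_coeff :: "nat \<Rightarrow> real \<Rightarrow> real" where
  "theta_diff_coeff m l = (if m = 0 then 0 else l powr (- 1 / 2) *
     (lim (jacobi_base (exp (- pi / l))) * lim (\<lambda>N. coeff (jacobi_poly (exp (- pi / l)) N) m)))"

lemma theta_diff_power_series:
  assumes l: "l > 0"
  shows "(\<lambda>m. theta_diff_coeff m l * (1 + cos (2 * pi * x)) ^ m) sums theta_diff l x"
    and "theta_diff_coeff m l \<ge> 0"
proof -
  define q where "q = exp (- pi / l)"
  have q: "0 < q" "q < 1" using l by (auto simp: q_def)
  define T where "T = theta_series q pi"
  define e where "e m = lim (\<lambda>N. coeff (jacobi_poly q N) m)" for m
  have "poly (jacobi_poly q N) 0 = 1" for N
    using coeff_0_jacobi_poly[of q N] by (simp add: poly_0_coeff_0)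
  then have T: "jacobi_base q \<longlonglongrightarrow> T"
    using theta_series_limit[OF q, of pi] unfolding jacobi_product_eq[OF q] T_def by simp
  have T0: "T \<ge> 0" unfolding T_def by (rule theta_series_nonneg[OF q])
  have lb: "lim (jacobi_base q) = T" using T by (rule limI)
  note lims = increasing_poly_limit[of "jacobi_poly q", OF coeff_jacobi_poly_nonneg[OF q(1)]
      coeff_jacobi_poly_mono[OF q(1)] poly_jacobi_poly_le[OF q] poly_jacobi_poly_le[OF q zero_le_one]]
  have e0: "e m \<ge> 0" for m
    unfolding e_def by (rule lims(3)[of 0]) simp_all
  then show "theta_diff_coeff m l \<ge> 0"
    unfolding theta_diff_coeff_def q_def[symmetric] lb e_def[symmetric] using T0 by simp
  let ?s = "1 + cos (2 * pi * x)"
  have s: "?s \<ge> 0" using cos_ge_minus_one[of "2 * pi * x"] by linarith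
  have sm: "summable (\<lambda>m. e m * ?s ^ m)"
    unfolding e_def by (rule lims(1)[OF s s])
  have th1: "(\<lambda>N. jacobi_base q N * poly (jacobi_poly q N) ?s) \<longlonglongrightarrow> T * (\<Sum>m. e m * ?s ^ m)"
    unfolding e_def by (intro tendsto_mult T lims(2)[OF s s])
  have th2: "(\<lambda>N. jacobi_base q N * poly (jacobi_poly q N) ?s) \<longlonglongrightarrow> theta_series q (2 * pi * x)"
    using theta_series_limit[OF q, of "2 * pi * x"] unfolding jacobi_product_eq[OF q] .
  have th: "theta_series q (2 * pi * x) = T * (\<Sum>m. e m * ?s ^ m)"
    by (rule LIMSEQ_unique[OF th2 th1])
  have "e 0 = 1" by (simp add: e_def coeff_0_jacobi_poly)
  then have "(if m = 0 then 0 else e m) * ?s ^ m = e m * ?s ^ m - (if m = 0 then 1 else 0)" for m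
    by simp
  then have "(\<lambda>m. (if m = 0 then 0 else e m) * ?s ^ m) sums ((\<Sum>m. e m * ?s ^ m) - 1)"
    using sums_diff[OF summable_sums[OF sm] sums_single[of 0 "\<lambda>_. 1"]] by (simp only:)
  then have "(\<lambda>m. l powr (- 1 / 2) * T * ((if m = 0 then 0 else e m) * ?s ^ m)) sums
      (l powr (- 1 / 2) * T * ((\<Sum>m. e m * ?s ^ m) - 1))"
    by (rule sums_mult)
  moreover have "l powr (- 1 / 2) * T * ((\<Sum>m. e m * ?s ^ m) - 1) = theta_diff l x"
    unfolding theta_diff_eq[OF l] q_def[symmetric] th T_def[symmetric] by (simp add: algebra_simps)
  moreover have "l powr (- 1 / 2) * T * ((if m = 0 then 0 else e m) * ?s ^ m) = theta_diff_coeff m l * ?s ^ m" for m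
    unfolding theta_diff_coeff_def q_def[symmetric] lb e_def[symmetric] by simp
  ultimately show "(\<lambda>m. theta_diff_coeff m l * ?s ^ m) sums theta_diff l x" by (simp only:)
qed

lemma theta_diff_coeff_measurable [measurable]: "theta_diff_coeff m \<in> borel_measurable borel"
proof -
  have base: "(\<lambda>l. jacobi_base (exp (- pi / l)) N) \<in> borel_measurable borel" for N
    unfolding jacobi_base_def qpoch_def by measurable
  have ratio: "(\<lambda>l. jacobi_ratio (exp (- pi / l)) N) \<in> borel_measurable borel" for N
    unfolding jacobi_ratio_def by measurable
  have coef: "(\<lambda>l. coeff (jacobi_poly (exp (- pi / l)) N) m) \<in> borel_measurable borel" for N m
  proof (induction N arbitrary: m)
    case (Suc N)
    then show ?case
      using ratio[of N] by (cases m) (auto simp: coeff_jacobi_poly_Suc)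
  qed (simp add: jacobi_poly_def)
  have "(\<lambda>l. l powr (- 1 / 2) * (lim (\<lambda>N. jacobi_base (exp (- pi / l)) N) * lim (\<lambda>N. coeff (jacobi_poly (exp (- pi / l)) N) m)))
      \<in> borel_measurable borel"
    by (intro borel_measurable_times borel_measurable_lim_metric base coef) measurable
  then show ?thesis
    by (cases "m = 0") (simp_all add: theta_diff_coeff_def[abs_def])
qed

text \<open>Tonelli applied to the nonnegative power series of the integrand. The coefficients are
  kept in \<open>ennreal\<close>, because without an integrability condition on \<sigma> they may be
  infinite.\<close>

lemma gauss_h_power_series:
  assumes sets: "sets \<sigma> = sets (restrict_space borel {0<..})"
  obtains A :: "nat \<Rightarrow> ennreal" where
    "\<And>x. gauss_h \<sigma> x = enn2ereal (\<Sum>m. A m * ennreal ((1 + cos (2 * pi * x)) ^ m))"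
    "\<And>x. gauss_h \<sigma> x = enn2ereal (\<integral>\<^sup>+l. ennreal (theta_diff l x) \<partial>\<sigma>)"
proof -
  have space: "space \<sigma> = {0<..}"
    using sets_eq_imp_space_eq[OF sets] by (simp add: space_restrict_space)
  have meas: "theta_diff_coeff m \<in> borel_measurable \<sigma>" for m
  proof -
    have "theta_diff_coeff m \<in> borel_measurable (restrict_space borel {0<..})"
      by (rule measurable_restrict_space1) (rule theta_diff_coeff_measurable)
    then show ?thesis
      using measurable_cong_sets[OF sets refl] by blast
  qed
  have main: "gauss_h \<sigma> x = enn2ereal (\<integral>\<^sup>+l. ennreal (theta_diff l x) \<partial>\<sigma>) \<and>
      (\<integral>\<^sup>+l. ennreal (theta_diff l x) \<partial>\<sigma>) =
        (\<Sum>m. (\<integral>\<^sup>+l. ennreal (theta_diff_coeff m l) \<partial>\<sigma>) * ennreal ((1 + cos (2 * pi * x)) ^ m))" for x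
  proof
    let ?s = "1 + cos (2 * pi * x)"
    have s: "?s \<ge> 0" using cos_ge_minus_one[of "2 * pi * x"] by linarith
    have nonneg: "theta_diff l x \<ge> 0" if "l \<in> space \<sigma>" for l
    proof -
      have l: "l > 0" using that space by simp
      show ?thesis
        by (rule sums_le[OF _ sums_zero theta_diff_power_series(1)[OF l]])
          (simp add: theta_diff_power_series(2)[OF l] s)
    qed
    then have "(\<integral>\<^sup>+l. ennreal (- theta_diff l x) \<partial>\<sigma>) = (\<integral>\<^sup>+l. 0 \<partial>\<sigma>)"
      by (intro nn_integral_cong) (simp add: ennreal_neg)
    then show "gauss_h \<sigma> x = enn2ereal (\<integral>\<^sup>+l. ennreal (theta_diff l x) \<partial>\<sigma>)"
      by (simp add: gauss_h_def zero_ennreal.rep_eq)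
    have "(\<integral>\<^sup>+l. ennreal (theta_diff l x) \<partial>\<sigma>) =
        (\<integral>\<^sup>+l. (\<Sum>m. ennreal (theta_diff_coeff m l) * ennreal (?s ^ m)) \<partial>\<sigma>)"
    proof (rule nn_integral_cong)
      fix l assume "l \<in> space \<sigma>"
      then have l: "l > 0" using space by simp
      have "(\<Sum>m. ennreal (theta_diff_coeff m l * ?s ^ m)) = ennreal (theta_diff l x)"
        using theta_diff_power_series[OF l] s
        by (subst suminf_ennreal2) (auto simp: sums_iff)
      then show "ennreal (theta_diff l x) = (\<Sum>m. ennreal (theta_diff_coeff m l) * ennreal (?s ^ m))"
        using theta_diff_power_series(2)[OF l] s by (simp add: ennreal_mult)
    qed
    also have "\<dots> = (\<Sum>m. \<integral>\<^sup>+l. ennreal (theta_diff_coeff m l) * ennreal (?s ^ m) \<partial>\<sigma>)"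
      by (rule nn_integral_suminf) (use meas in measurable)
    also have "\<dots> = (\<Sum>m. (\<integral>\<^sup>+l. ennreal (theta_diff_coeff m l) \<partial>\<sigma>) * ennreal (?s ^ m))"
      by (intro arg_cong[where f = suminf] ext nn_integral_multc) (use meas in measurable)
    finally show "(\<integral>\<^sup>+l. ennreal (theta_diff l x) \<partial>\<sigma>) = \<dots>" .
  qed
  show ?thesis
    by (rule that[of "\<lambda>m. \<integral>\<^sup>+l. ennreal (theta_diff_coeff m l) \<partial>\<sigma>"]) (use main in auto)
qed

section \<open>Hermite interpolation of power series with nonnegative coefficients\<close>


definition power_sum :: "(nat \<Rightarrow> real) \<Rightarrow> real \<Rightarrow> real" where
  "power_sum a s = (\<Sum>m. a m * s ^ m)"

text \<open>The coefficients of \<open>(f(s) - f(r)) / (s - r)\<close> for \<open>f(s) = \<Sum>a\<^sub>m s\<^sup>m\<close>.\<close>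

definition divided_coeff :: "(nat \<Rightarrow> real) \<Rightarrow> real \<Rightarrow> nat \<Rightarrow> real" where
  "divided_coeff a r k = (\<Sum>j. a (Suc k + j) * r ^ j)"

text \<open>The quotient coefficients satisfy b_k = a_(k+1) + r b_(k+1), which is the identity after
  multiplication by s - r. They also satisfy b_k t^(k+1) \<le> f(t), which gives convergence
  strictly below \<open>t\<close> even when r = t.\<close>

lemma power_sum_divide:
  assumes a: "\<And>m. a m \<ge> 0" and r: "0 \<le> r" "r \<le> t" and t: "t > 0"
    and sm: "summable (\<lambda>m. a m * t ^ m)" and s: "0 \<le> s" "s < t"
  shows "divided_coeff a r k \<ge> 0"
    and "summable (\<lambda>m. divided_coeff a r m * s ^ m)"
    and "power_sum a s = power_sum a r + (s - r) * power_sum (divided_coeff a r) s"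
proof -
  have sm': "summable (\<lambda>m. a m * u ^ m)" if "0 \<le> u" "u \<le> t" for u
    by (rule summable_comparison_test'[OF sm]) (use that a in \<open>auto intro!: mult_left_mono power_mono\<close>)
  have smt: "summable (\<lambda>j. a (Suc k + j) * t ^ j)" for k
  proof -
    have "summable (\<lambda>j. a (j + Suc k) * t ^ (j + Suc k))"
      using sm by (rule summable_ignore_initial_segment)
    then have "summable (\<lambda>j. inverse (t ^ Suc k) * (a (j + Suc k) * t ^ (j + Suc k)))"
      by (rule summable_mult)
    then show ?thesis
      using t by (simp add: power_add field_simps add.commute)
  qed
  have smr: "summable (\<lambda>j. a (Suc k + j) * r ^ j)" for k
    by (rule summable_comparison_test'[OF smt[of k]])
      (use r a in \<open>auto intro!: mult_left_mono power_mono\<close>)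
  show nonneg: "divided_coeff a r k \<ge> 0" for k
    unfolding divided_coeff_def using a r by (intro suminf_nonneg smr) auto
  have bound: "divided_coeff a r k * t ^ Suc k \<le> power_sum a t" for k
  proof -
    have "divided_coeff a r k \<le> (\<Sum>j. a (Suc k + j) * t ^ j)"
      unfolding divided_coeff_def using a r by (intro suminf_le smr smt mult_left_mono power_mono) auto
    then have "divided_coeff a r k * t ^ Suc k \<le> (\<Sum>j. a (Suc k + j) * t ^ j) * t ^ Suc k"
      using t by (intro mult_right_mono) auto
    also have "\<dots> = (\<Sum>j. a (j + Suc k) * t ^ (j + Suc k))"
      by (subst suminf_mult2[OF smt]) (simp add: power_add mult_ac add.commute)
    also have "\<dots> \<le> power_sum a t"
      unfolding power_sum_def using suminf_split_initial_segment[OF sm, of "Suc k"] a t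
      by (simp add: sum_nonneg del: sum.lessThan_Suc)
    finally show ?thesis .
  qed
  show smb: "summable (\<lambda>m. divided_coeff a r m * s ^ m)"
  proof (rule summable_comparison_test')
    show "summable (\<lambda>m. power_sum a t / t * (s / t) ^ m)"
      using s t by (intro summable_mult summable_geometric) auto
    fix m
    have "divided_coeff a r m \<le> power_sum a t / t ^ Suc m"
      using bound[of m] t by (simp add: field_simps)
    then have "divided_coeff a r m * s ^ m \<le> power_sum a t / t ^ Suc m * s ^ m"
      using s by (intro mult_right_mono) auto
    then show "norm (divided_coeff a r m * s ^ m) \<le> power_sum a t / t * (s / t) ^ m"
      using nonneg[of m] s by (simp add: power_divide)
  qed
  let ?b = "divided_coeff a r"
  have rec: "a (Suc k) + r * ?b (Suc k) = ?b k" for k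
  proof -
    have "?b k = (\<Sum>j. a (Suc k + Suc j) * r ^ Suc j) + a (Suc k)"
      unfolding divided_coeff_def using suminf_split_head[OF smr[of k]] by simp
    also have "(\<Sum>j. a (Suc k + Suc j) * r ^ Suc j) = r * ?b (Suc k)"
      unfolding divided_coeff_def by (subst suminf_mult[OF smr, symmetric]) (simp add: mult_ac)
    finally show ?thesis by simp
  qed
  have fr: "power_sum a r = a 0 + r * ?b 0"
  proof -
    have "power_sum a r = (\<Sum>m. a (Suc m) * r ^ Suc m) + a 0"
      unfolding power_sum_def using suminf_split_head[OF sm'[OF r]] by simp
    also have "(\<Sum>m. a (Suc m) * r ^ Suc m) = r * ?b 0"
      unfolding divided_coeff_def using smr[of 0] by (subst suminf_mult[symmetric]) (simp_all add: mult_ac)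
    finally show ?thesis by simp
  qed
  have sms: "summable (\<lambda>m. a m * s ^ m)" using s by (intro sm') auto
  have "(\<lambda>m. ?b m * s ^ m) sums power_sum ?b s"
    unfolding power_sum_def using smb by (rule summable_sums)
  then have "(\<lambda>m. s * (?b m * s ^ m)) sums (s * power_sum ?b s)"
    by (rule sums_mult)
  moreover have "(\<lambda>m. r * (?b (Suc m) * s ^ Suc m)) sums (r * (power_sum ?b s - ?b 0))"
  proof (rule sums_mult)
    show "(\<lambda>m. ?b (Suc m) * s ^ Suc m) sums (power_sum ?b s - ?b 0)"
      using sums_split_initial_segment[OF \<open>(\<lambda>m. ?b m * s ^ m) sums power_sum ?b s\<close>, of 1] by simp
  qed
  ultimately have "(\<lambda>m. s * (?b m * s ^ m) - r * (?b (Suc m) * s ^ Suc m)) sums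
      (s * power_sum ?b s - r * (power_sum ?b s - ?b 0))"
    by (rule sums_diff)
  moreover have "s * (?b m * s ^ m) - r * (?b (Suc m) * s ^ Suc m) = a (Suc m) * s ^ Suc m" for m
    by (subst rec[symmetric]) (simp add: algebra_simps)
  ultimately have "(\<lambda>m. a (Suc m) * s ^ Suc m) sums (s * power_sum ?b s - r * (power_sum ?b s - ?b 0))"
    by (simp only:)
  moreover have "(\<lambda>m. a (Suc m) * s ^ Suc m) sums (power_sum a s - a 0)"
    unfolding power_sum_def using sums_split_initial_segment[OF summable_sums[OF sms], of 1] by simp
  ultimately have "power_sum a s - a 0 = s * power_sum ?b s - r * (power_sum ?b s - ?b 0)"
    by (rule sums_unique2[rotated])
  then show "power_sum a s = power_sum a r + (s - r) * power_sum ?b s"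
    unfolding fr by (simp add: algebra_simps)
qed

text \<open>Convergence is required on [0, 2) only, as this is what both the series of h in (i) and
  the quotient by s - 2 in (ii) provide.\<close>

definition absolutely_monotone_coeffs :: "(nat \<Rightarrow> real) \<Rightarrow> bool" where
  "absolutely_monotone_coeffs a \<longleftrightarrow>
     (\<forall>m. a m \<ge> 0) \<and> (\<forall>s. 0 \<le> s \<longrightarrow> s < 2 \<longrightarrow> summable (\<lambda>m. a m * s ^ m))"

lemma power_sum_mono:
  assumes "absolutely_monotone_coeffs a" "0 \<le> s" "s \<le> t" "t < 2"
  shows "power_sum a s \<le> power_sum a t"
  unfolding power_sum_def using assms
  by (intro suminf_le mult_left_mono power_mono) (auto simp: absolutely_monotone_coeffs_def)

lemma power_sum_nonneg:
  assumes "absolutely_monotone_coeffs a" "0 \<le> s" "s < 2"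
  shows "power_sum a s \<ge> 0"
  unfolding power_sum_def using assms
  by (intro suminf_nonneg) (auto simp: absolutely_monotone_coeffs_def)

lemma divided_coeff_interior:
  assumes a: "absolutely_monotone_coeffs a" and r: "0 \<le> r" "r < 2"
  shows "absolutely_monotone_coeffs (divided_coeff a r)"
    and "0 \<le> s \<Longrightarrow> s < 2 \<Longrightarrow> power_sum a s = power_sum a r + (s - r) * power_sum (divided_coeff a r) s"
proof -
  have step: "divided_coeff a r k \<ge> 0 \<and> summable (\<lambda>m. divided_coeff a r m * s ^ m) \<and>
      power_sum a s = power_sum a r + (s - r) * power_sum (divided_coeff a r) s"
    if s: "0 \<le> s" "s < 2" for s k
  proof -
    \<comment> \<open>A point at or above \<open>r\<close>, strictly above \<open>s\<close> and
      still below 2, so that the series of \<open>a\<close> converges there.\<close>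
    define t where "t = (max r s + 2) / 2"
    have "max r s < 2" using r s by simp
    then have t: "r \<le> t" "s < t" "t < 2" "0 < t"
      using r s unfolding t_def by (simp_all add: max_def split: if_splits)
    have "summable (\<lambda>m. a m * t ^ m)" "\<And>m. a m \<ge> 0"
      using a t by (auto simp: absolutely_monotone_coeffs_def)
    then show ?thesis
      using power_sum_divide[of a r t s] r s t by blast
  qed
  show "absolutely_monotone_coeffs (divided_coeff a r)"
    unfolding absolutely_monotone_coeffs_def using step step[of 0] by auto
  show "0 \<le> s \<Longrightarrow> s < 2 \<Longrightarrow> power_sum a s = power_sum a r + (s - r) * power_sum (divided_coeff a r) s"
    using step by blast
qed

text \<open>The case r = t = 2 of \<open>power_sum_divide\<close>: convergence at 2 is used up by
  the division, and the quotient is controlled only below 2.\<close>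

lemma divided_coeff_endpoint:
  assumes a: "\<And>m. a m \<ge> 0" and sm: "summable (\<lambda>m. a m * 2 ^ m)"
  shows "absolutely_monotone_coeffs (divided_coeff a 2)"
    and "0 \<le> s \<Longrightarrow> s < 2 \<Longrightarrow> power_sum a s = power_sum a 2 + (s - 2) * power_sum (divided_coeff a 2) s"
  using power_sum_divide(1)[of a 2 2 0, OF a] power_sum_divide[of a 2 2, OF a] sm by (auto simp: absolutely_monotone_coeffs_def)

text \<open>Newton interpolation with repeated nodes: each division leaves a remainder of the same
  class. The degree bound is stated through coefficients because the empty list requires P = 0,
  which a bound on \<open>degree\<close> cannot express.\<close>

lemma interpolation:
  assumes "absolutely_monotone_coeffs a" "\<forall>r\<in>set rs. 0 \<le> r \<and> r < 2"
  obtains P b where "\<And>i. length rs \<le> i \<Longrightarrow> coeff P i = 0" "absolutely_monotone_coeffs b"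
    "\<And>s. 0 \<le> s \<Longrightarrow> s < 2 \<Longrightarrow> power_sum a s = poly P s + (\<Prod>r\<leftarrow>rs. s - r) * power_sum b s"
proof -
  have "\<exists>P b. (\<forall>i\<ge>length rs. coeff P i = 0) \<and> absolutely_monotone_coeffs b \<and>
    (\<forall>s. 0 \<le> s \<longrightarrow> s < 2 \<longrightarrow> power_sum a s = poly P s + (\<Prod>r\<leftarrow>rs. s - r) * power_sum b s)"
    using assms
  proof (induction rs arbitrary: a)
    case Nil
    then show ?case by (intro exI[of _ 0] exI[of _ a]) simp
  next
    case (Cons r rs)
    then have r: "0 \<le> r" "r < 2" by auto
    note d = divided_coeff_interior[OF Cons.prems(1) r]
    obtain P b where P: "\<forall>i\<ge>length rs. coeff P i = 0" and b: "absolutely_monotone_coeffs b"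
      and eq: "\<And>s. 0 \<le> s \<Longrightarrow> s < 2 \<Longrightarrow>
        power_sum (divided_coeff a r) s = poly P s + (\<Prod>r\<leftarrow>rs. s - r) * power_sum b s"
      using Cons.IH[OF d(1)] Cons.prems(2) by auto
    define P' where "P' = [:power_sum a r:] + (pCons 0 P - smult r P)"
    have "coeff P' i = 0" if "length (r # rs) \<le> i" for i
      using that P by (cases i) (auto simp: P'_def coeff_pCons)
    moreover have "power_sum a s = poly P' s + (\<Prod>r\<leftarrow>r # rs. s - r) * power_sum b s"
      if s: "0 \<le> s" "s < 2" for s
      unfolding d(2)[OF s] eq[OF s] P'_def by (simp add: algebra_simps)
    ultimately show ?case using b by blast
  qed
  then show ?thesis using that by blast
qed

section \<open>The power series of h under the two integrability conditions\<close>

lemma ennreal_power_sum: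
  fixes A :: "nat \<Rightarrow> ennreal"
  assumes fin: "\<And>m. A m < top" and s: "s \<ge> 0" and lt: "(\<Sum>m. A m * ennreal (s ^ m)) < top"
  shows "summable (\<lambda>m. enn2real (A m) * s ^ m)"
    and "(\<Sum>m. A m * ennreal (s ^ m)) = ennreal (power_sum (\<lambda>m. enn2real (A m)) s)"
proof -
  have A: "A m * ennreal (s ^ m) = ennreal (enn2real (A m) * s ^ m)" for m
    using fin[of m] s by (simp add: ennreal_mult)
  have nonneg: "0 \<le> enn2real (A m) * s ^ m" for m using s by simp
  show sm: "summable (\<lambda>m. enn2real (A m) * s ^ m)"
    by (rule summable_suminf_not_top[OF nonneg]) (use lt in \<open>simp add: A less_top\<close>)
  show "(\<Sum>m. A m * ennreal (s ^ m)) = ennreal (power_sum (\<lambda>m. enn2real (A m)) s)"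
    unfolding A power_sum_def by (rule suminf_ennreal2[OF nonneg sm])
qed

lemma cos_2pi_value:
  assumes "0 \<le> s" "s \<le> 2"
  obtains x where "1 + cos (2 * pi * x) = s"
proof
  show "1 + cos (2 * pi * (arccos (s - 1) / (2 * pi))) = s"
    using assms by (simp add: cos_arccos)
qed

lemma finite_coeffs:
  fixes A :: "nat \<Rightarrow> ennreal"
  assumes "(\<Sum>m. A m * ennreal (1 ^ m)) < top"
  shows "A m < top"
proof -
  have "A m = (\<Sum>i\<in>{m}. A i * ennreal (1 ^ i))" by simp
  also have "\<dots> \<le> (\<Sum>i. A i * ennreal (1 ^ i))"
    by (rule sum_le_suminf) auto
  finally show ?thesis using assms by (rule le_less_trans)
qed

text \<open>The last conclusion is for integers \<open>x\<close>, where h may be infinite: by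
  monotonicity in s, the finite values for s < 2 are still lower bounds for it.\<close>

lemma gauss_h_interior:
  assumes sets: "sets \<sigma> = sets (restrict_space borel {0<..})"
    and fin: "\<And>a::real. a > 0 \<Longrightarrow> (\<integral>\<^sup>+l. ennreal (l powr (- 1 / 2) * exp (- pi / l - a * l)) \<partial>\<sigma>) < \<infinity>"
  obtains c where "absolutely_monotone_coeffs c"
    "\<And>x. cos (2 * pi * x) < 1 \<Longrightarrow> gauss_h \<sigma> x = ereal (power_sum c (1 + cos (2 * pi * x)))"
    "\<And>x s. 0 \<le> s \<Longrightarrow> s < 2 \<Longrightarrow> s \<le> 1 + cos (2 * pi * x) \<Longrightarrow> ereal (power_sum c s) \<le> gauss_h \<sigma> x"
proof -
  obtain A where A: "\<And>x. gauss_h \<sigma> x = enn2ereal (\<Sum>m. A m * ennreal ((1 + cos (2 * pi * x)) ^ m))"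
    "\<And>x. gauss_h \<sigma> x = enn2ereal (\<integral>\<^sup>+l. ennreal (theta_diff l x) \<partial>\<sigma>)"
    using gauss_h_power_series[OF sets] by metis
  have space: "space \<sigma> = {0<..}"
    using sets_eq_imp_space_eq[OF sets] by (simp add: space_restrict_space)
  have AI: "(\<Sum>m. A m * ennreal ((1 + cos (2 * pi * x)) ^ m)) = (\<integral>\<^sup>+l. ennreal (theta_diff l x) \<partial>\<sigma>)" for x
    using A(1)[of x] A(2)[of x] by (simp add: enn2ereal_inject)
  have lt: "(\<Sum>m. A m * ennreal (s ^ m)) < top" if s: "0 \<le> s" "s < 2" for s
  proof -
    \<comment> \<open>Every s in [0, 2) is the height of some real \<open>x\<close>, so the decay
      estimate for the integrand proves finiteness at s.\<close>
    obtain x where x: "1 + cos (2 * pi * x) = s"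
      using cos_2pi_value[of s] s by auto
    then have "cos (2 * pi * x) < 1" using s by linarith
    then obtain a C where a: "a > 0" "C > 0"
      and le: "\<And>l. l > 0 \<Longrightarrow> theta_diff l x \<le> C * (l powr (- 1 / 2) * exp (- pi / l - a * l))"
      using theta_diff_decay by metis
    have meas: "(\<lambda>l. ennreal (l powr (- 1 / 2) * exp (- pi / l - a * l))) \<in> borel_measurable \<sigma>"
    proof -
      have "(\<lambda>l. ennreal (l powr (- 1 / 2) * exp (- pi / l - a * l))) \<in> borel_measurable (restrict_space borel {0<..})"
        by (rule measurable_restrict_space1) measurable
      then show ?thesis using measurable_cong_sets[OF sets refl] by blast
    qed
    have "(\<integral>\<^sup>+l. ennreal (theta_diff l x) \<partial>\<sigma>) \<le>
        (\<integral>\<^sup>+l. ennreal C * ennreal (l powr (- 1 / 2) * exp (- pi / l - a * l)) \<partial>\<sigma>)"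
      using le a space by (intro nn_integral_mono) (simp add: ennreal_mult[symmetric] ennreal_leI)
    also have "\<dots> = ennreal C * (\<integral>\<^sup>+l. ennreal (l powr (- 1 / 2) * exp (- pi / l - a * l)) \<partial>\<sigma>)"
      using meas by (rule nn_integral_cmult)
    also have "\<dots> < top"
      using fin[OF a(1)] by (simp add: ennreal_mult_less_top)
    finally show ?thesis using AI[of x] x by simp
  qed
  have Afin: "A m < top" for m
    using finite_coeffs lt[of 1] by simp
  define c where "c m = enn2real (A m)" for m
  have c: "absolutely_monotone_coeffs c"
    unfolding absolutely_monotone_coeffs_def c_def using ennreal_power_sum(1)[OF Afin _ lt] by simp
  have val: "enn2ereal (\<Sum>m. A m * ennreal (s ^ m)) = ereal (power_sum c s)" if "0 \<le> s" "s < 2" for s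
    using ennreal_power_sum(2)[OF Afin that(1) lt[OF that]] power_sum_nonneg[OF c that]
    by (simp add: c_def[abs_def] enn2ereal_ennreal)
  have cg: "0 \<le> 1 + cos (2 * pi * x)" for x
    using cos_ge_minus_one[of "2 * pi * x"] by linarith
  show ?thesis
  proof (rule that[OF c])
    show "gauss_h \<sigma> x = ereal (power_sum c (1 + cos (2 * pi * x)))" if "cos (2 * pi * x) < 1" for x
      unfolding A(1) using that cg by (intro val) auto
    show "ereal (power_sum c s) \<le> gauss_h \<sigma> x" if s: "0 \<le> s" "s < 2" "s \<le> 1 + cos (2 * pi * x)" for x s
    proof -
      have "(\<Sum>m. A m * ennreal (s ^ m)) \<le> (\<Sum>m. A m * ennreal ((1 + cos (2 * pi * x)) ^ m))"
        using s by (intro suminf_le mult_left_mono ennreal_leI power_mono) auto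
      then show ?thesis
        unfolding val[OF s(1,2), symmetric] A(1) by (simp add: less_eq_ennreal.rep_eq)
    qed
  qed
qed

lemma gauss_h_everywhere:
  assumes sets: "sets \<sigma> = sets (restrict_space borel {0<..})"
    and fin: "(\<integral>\<^sup>+l. ennreal ((1 + l powr (- 1 / 2)) * exp (- pi / l)) \<partial>\<sigma>) < \<infinity>"
  obtains c where "\<And>m. c m \<ge> 0" "summable (\<lambda>m. c m * 2 ^ m)"
    "\<And>x. gauss_h \<sigma> x = ereal (power_sum c (1 + cos (2 * pi * x)))"
proof -
  obtain A where A: "\<And>x. gauss_h \<sigma> x = enn2ereal (\<Sum>m. A m * ennreal ((1 + cos (2 * pi * x)) ^ m))"
    "\<And>x. gauss_h \<sigma> x = enn2ereal (\<integral>\<^sup>+l. ennreal (theta_diff l x) \<partial>\<sigma>)"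
    using gauss_h_power_series[OF sets] by metis
  have space: "space \<sigma> = {0<..}"
    using sets_eq_imp_space_eq[OF sets] by (simp add: space_restrict_space)
  have AI: "(\<Sum>m. A m * ennreal ((1 + cos (2 * pi * x)) ^ m)) = (\<integral>\<^sup>+l. ennreal (theta_diff l x) \<partial>\<sigma>)" for x
    using A(1)[of x] A(2)[of x] by (simp add: enn2ereal_inject)
  have ltx: "(\<Sum>m. A m * ennreal ((1 + cos (2 * pi * x)) ^ m)) < top" for x
  proof -
    have meas: "(\<lambda>l. ennreal ((1 + l powr (- 1 / 2)) * exp (- pi / l))) \<in> borel_measurable \<sigma>"
    proof -
      have "(\<lambda>l. ennreal ((1 + l powr (- 1 / 2)) * exp (- pi / l))) \<in> borel_measurable (restrict_space borel {0<..})"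
        by (rule measurable_restrict_space1) measurable
      then show ?thesis using measurable_cong_sets[OF sets refl] by blast
    qed
    have "(\<integral>\<^sup>+l. ennreal (theta_diff l x) \<partial>\<sigma>) \<le>
        (\<integral>\<^sup>+l. ennreal (4 * exp pi) * ennreal ((1 + l powr (- 1 / 2)) * exp (- pi / l)) \<partial>\<sigma>)"
      using theta_diff_le space by (intro nn_integral_mono) (simp add: ennreal_mult[symmetric] ennreal_leI)
    also have "\<dots> = ennreal (4 * exp pi) * (\<integral>\<^sup>+l. ennreal ((1 + l powr (- 1 / 2)) * exp (- pi / l)) \<partial>\<sigma>)"
      using meas by (rule nn_integral_cmult)
    also have "\<dots> < top"
      using fin by (simp add: ennreal_mult_less_top)
    finally show ?thesis using AI[of x] by simp
  qed
  have lt: "(\<Sum>m. A m * ennreal (s ^ m)) < top" if "0 \<le> s" "s \<le> 2" for s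
    using cos_2pi_value[of s] ltx that by metis
  have Afin: "A m < top" for m
    using finite_coeffs lt[of 1] by simp
  define c where "c m = enn2real (A m)" for m
  have c0: "c m \<ge> 0" for m by (simp add: c_def)
  have sm: "summable (\<lambda>m. c m * s ^ m)" if "0 \<le> s" "s \<le> 2" for s
    unfolding c_def by (rule ennreal_power_sum(1)[OF Afin that(1) lt[OF that]])
  show ?thesis
  proof (rule that[OF c0])
    show "summable (\<lambda>m. c m * 2 ^ m)" by (rule sm) auto
    fix x
    let ?s = "1 + cos (2 * pi * x)"
    have s: "0 \<le> ?s" "?s \<le> 2"
      using cos_ge_minus_one[of "2 * pi * x"] cos_le_one[of "2 * pi * x"] by linarith+
    have "0 \<le> power_sum c ?s"
      unfolding power_sum_def using c0 s by (intro suminf_nonneg sm) auto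
    then show "gauss_h \<sigma> x = ereal (power_sum c ?s)"
      unfolding A(1) using ennreal_power_sum(2)[OF Afin s(1) lt[OF s]]
      by (simp add: c_def[abs_def] enn2ereal_ennreal)
  qed
qed

section \<open>Extremal trigonometric polynomials\<close>


text \<open>Multiplication by e^(2\<pi>inz) shifts the frequencies from [-n, n] to [0, 2n], so zeros
  can be counted for an ordinary polynomial.\<close>

lemma trig_polys_iff:
  "f \<in> trig_polys n \<longleftrightarrow>
    (\<exists>p. degree p \<le> 2 * n \<and> (\<forall>z. f z = exp (- (2 * of_real pi * \<i> * of_nat n * z)) * poly p (exp (2 * of_real pi * \<i> * z))))"
proof -
  have e: "exp (2 * of_real pi * \<i> * of_int (int j - int n) * z) =
      exp (- (2 * of_real pi * \<i> * of_nat n * z)) * exp (2 * of_real pi * \<i> * z) ^ j" for j and z :: complex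
  proof -
    have "exp (2 * of_real pi * \<i> * z) ^ j = exp (of_nat j * (2 * of_real pi * \<i> * z))"
      by (rule exp_of_nat_mult[symmetric])
    then show ?thesis
      by (simp add: exp_add[symmetric] algebra_simps)
  qed
  have shift: "(\<Sum>k = - int n..int n. a k * exp (2 * of_real pi * \<i> * of_int k * z)) =
      exp (- (2 * of_real pi * \<i> * of_nat n * z)) * (\<Sum>j\<le>2 * n. a (int j - int n) * exp (2 * of_real pi * \<i> * z) ^ j)"
    for a and z :: complex
  proof -
    have "(\<Sum>k = - int n..int n. a k * exp (2 * of_real pi * \<i> * of_int k * z)) =
        (\<Sum>j\<le>2 * n. a (int j - int n) * exp (2 * of_real pi * \<i> * of_int (int j - int n) * z))"
      by (rule sum.reindex_bij_witness[of _ "\<lambda>j. int j - int n" "\<lambda>k. nat (k + int n)"]) auto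
    then show ?thesis
      unfolding e sum_distrib_left by (simp only: mult_ac)
  qed
  show ?thesis
  proof
    assume "f \<in> trig_polys n"
    then obtain a :: "int \<Rightarrow> complex"
      where f: "f = (\<lambda>z. \<Sum>k = - int n..int n. a k * exp (2 * of_real pi * \<i> * of_int k * z))"
      by (auto simp: trig_polys_def)
    define p where "p = (\<Sum>j\<le>2 * n. monom (a (int j - int n)) j)"
    have "degree p \<le> 2 * n"
      unfolding p_def by (intro degree_sum_le) (auto intro: order_trans[OF degree_monom_le])
    moreover have "f z = exp (- (2 * of_real pi * \<i> * of_nat n * z)) * poly p (exp (2 * of_real pi * \<i> * z))" for z
      unfolding f shift p_def by (simp only: poly_sum poly_monom)
    ultimately show "\<exists>p. degree p \<le> 2 * n \<and> (\<forall>z. f z = exp (- (2 * of_real pi * \<i> * of_nat n * z)) * poly p (exp (2 * of_real pi * \<i> * z)))"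
      by blast
  next
    assume "\<exists>p. degree p \<le> 2 * n \<and> (\<forall>z. f z = exp (- (2 * of_real pi * \<i> * of_nat n * z)) * poly p (exp (2 * of_real pi * \<i> * z)))"
    then obtain p where p: "degree p \<le> 2 * n"
      and f: "\<And>z. f z = exp (- (2 * of_real pi * \<i> * of_nat n * z)) * poly p (exp (2 * of_real pi * \<i> * z))"
      by blast
    have "f = (\<lambda>z. \<Sum>k = - int n..int n. coeff p (nat (k + int n)) * exp (2 * of_real pi * \<i> * of_int k * z))"
    proof
      fix z
      have pw: "poly p w = (\<Sum>j\<le>2 * n. coeff p (nat (int j - int n + int n)) * w ^ j)" for w
      proof -
        have "(\<Sum>j\<le>degree p. coeff p j * w ^ j) = (\<Sum>j\<le>2 * n. coeff p j * w ^ j)"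
          by (rule sum.mono_neutral_left) (use p in \<open>auto simp: coeff_eq_0\<close>)
        moreover have "nat (int j - int n + int n) = j" for j by simp
        ultimately show ?thesis by (simp only: poly_altdef)
      qed
      show "f z = (\<Sum>k = - int n..int n. coeff p (nat (k + int n)) * exp (2 * of_real pi * \<i> * of_int k * z))"
        unfolding shift f pw ..
    qed
    then show "f \<in> trig_polys n"
      unfolding trig_polys_def mem_Collect_eq
      by (rule exI[where x = "\<lambda>k. coeff p (nat (k + int n))"])
  qed
qed

lemma trig_polys_cos_step:
  assumes "f \<in> trig_polys n"
  shows "(\<lambda>z. c + (1 + cos (2 * of_real pi * z)) * f z) \<in> trig_polys (Suc n)"
proof -
  obtain p where p: "degree p \<le> 2 * n"
    and f: "\<And>z. f z = exp (- (2 * of_real pi * \<i> * of_nat n * z)) * poly p (exp (2 * of_real pi * \<i> * z))"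
    using assms by (auto simp: trig_polys_iff)
  \<comment> \<open>With w = e^(2\<pi>iz), the polynomial 1/2 + w + w^2/2 is w (1 + cos 2\<pi>z);
    the extra \<open>w\<close> and the power in the monomial account for the normalization at n + 1
    instead of n.\<close>
  define q where "q = monom c (Suc n) + [:1 / 2, 1, 1 / 2:] * p"
  have "degree q \<le> 2 * Suc n"
  proof -
    have "degree ([:1 / 2, 1, 1 / 2:] * p) \<le> degree [:1 / 2, 1, 1 / 2 :: complex:] + degree p"
      by (rule degree_mult_le)
    also have "\<dots> \<le> 2 * Suc n" using p by simp
    finally have "degree ([:1 / 2, 1, 1 / 2:] * p) \<le> 2 * Suc n" .
    moreover have "degree (monom c (Suc n)) \<le> 2 * Suc n"
      using degree_monom_le[of c "Suc n"] by simp
    ultimately show ?thesis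
      unfolding q_def by (intro degree_add_le)
  qed
  moreover have "c + (1 + cos (2 * of_real pi * z)) * f z =
      exp (- (2 * of_real pi * \<i> * of_nat (Suc n) * z)) * poly q (exp (2 * of_real pi * \<i> * z))" for z
  proof -
    define w where "w = exp (2 * of_real pi * \<i> * z)"
    have w0: "w \<noteq> 0" by (simp add: w_def)
    have wn: "exp (- (2 * of_real pi * \<i> * of_nat m * z)) = inverse (w ^ m)" for m
      unfolding w_def exp_minus exp_of_nat_mult[symmetric] by (simp add: mult_ac)
    have C: "cos (2 * of_real pi * z) = (w + inverse w) / 2"
      unfolding w_def cos_exp_eq exp_minus[symmetric] by (simp add: mult_ac)
    show ?thesis
      unfolding f wn w_def[symmetric] q_def C using w0
      by (simp add: poly_monom field_simps)
  qed
  ultimately show ?thesis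
    by (auto simp: trig_polys_iff)
qed

lemma poly_cos_trig_polys:
  fixes P :: "real poly"
  assumes "\<And>i. n < i \<Longrightarrow> coeff P i = 0"
  shows "(\<lambda>z. poly (map_poly of_real P) (1 + cos (2 * of_real pi * z))) \<in> trig_polys n"
  using assms
proof (induction n arbitrary: P)
  case 0
  have "P = [:coeff P 0:]"
  proof (rule poly_eqI)
    fix i show "coeff P i = coeff [:coeff P 0:] i"
      using 0[of i] by (cases i) auto
  qed
  then obtain c where "P = [:c:]" by blast
  then show ?case
    by (auto simp: trig_polys_iff map_poly_pCons intro!: exI[of _ "[:of_real c:]"])
next
  case (Suc n)
  obtain c Q where P: "P = pCons c Q" by (cases P)
  have "coeff Q i = 0" if "n < i" for i
    using Suc.prems[of "Suc i"] that by (simp add: P)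
  from trig_polys_cos_step[OF Suc.IH[OF this], of "of_real c"]
  show ?case by (simp add: P map_poly_pCons)
qed

lemma poly_of_real_cos:
  "poly (map_poly of_real P) (1 + cos (2 * of_real pi * complex_of_real x)) =
    of_real (poly P (1 + cos (2 * pi * x)))"
proof -
  have "1 + cos (2 * of_real pi * complex_of_real x) = of_real (1 + cos (2 * pi * x))"
    by (simp add: cos_of_real[symmetric] del: cos_of_real)
  then show ?thesis
    by (simp only:) (induction P, simp_all add: map_poly_pCons)
qed

text \<open>On the real line a point of \<open>Z\<close> is a double zero of the polynomial of
  degree at most 2n behind \<open>f\<close>, since x \<mapsto> e^(2\<pi>ix) has nonvanishing
  derivative; a point of \<open>Z'\<close> counts once.\<close>

lemma trig_poly_zero:
  assumes f: "f \<in> trig_polys n" and Z: "finite Z" "Z \<subseteq> {0..<1}" "2 * n < 2 * card Z + card Z'"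
    and Z': "finite Z'" "Z' \<subseteq> {0..<1}" "Z \<inter> Z' = {}"
    and simple: "\<And>x. x \<in> Z \<union> Z' \<Longrightarrow> f (of_real x) = 0"
    and double: "\<And>x. x \<in> Z \<Longrightarrow> ((\<lambda>t. f (of_real t)) has_vector_derivative 0) (at x)"
  shows "f = (\<lambda>_. 0)"
proof -
  obtain p where p: "degree p \<le> 2 * n"
    and f: "\<And>z. f z = exp (- (2 * of_real pi * \<i> * of_nat n * z)) * poly p (exp (2 * of_real pi * \<i> * z))"
    using f by (auto simp: trig_polys_iff)
  let ?c = "\<lambda>x. cis (2 * pi * x)"
  have ec: "exp (2 * of_real pi * \<i> * of_real x) = ?c x" for x
    by (simp add: cis_conv_exp mult_ac)
  have en: "exp (2 * of_real pi * \<i> * of_nat n * of_real x) = ?c x ^ n" for x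
    unfolding ec[symmetric] by (simp add: exp_of_nat_mult[symmetric] mult_ac)
  have pf: "poly p (?c x) = ?c x ^ n * f (of_real x)" for x
    unfolding f ec by (simp add: exp_minus en)
  have root: "poly p (?c x) = 0" if "x \<in> Z \<union> Z'" for x
    using simple[OF that] by (simp add: pf)
  have dc: "(?c has_vector_derivative (2 * pi * \<i> * ?c x)) (at x)" for x
    unfolding has_vector_derivative_complex_iff
    by (auto intro!: derivative_eq_intros simp: has_real_derivative_iff_has_vector_derivative[symmetric])
  have droot: "poly (pderiv p) (?c x) = 0" if x: "x \<in> Z" for x
  proof -
    have "((\<lambda>t. poly p (?c t)) has_vector_derivative (2 * pi * \<i> * ?c x) * poly (pderiv p) (?c x)) (at x)"
      using field_vector_diff_chain_at[OF dc[of x] poly_DERIV[of p "?c x"]] by (simp add: o_def)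
    moreover have "((\<lambda>t. ?c t ^ n) has_vector_derivative (2 * pi * \<i> * ?c x) * (of_nat n * ?c x ^ (n - 1))) (at x)"
    proof -
      have "((\<lambda>w. w ^ n) has_field_derivative (of_nat n * ?c x ^ (n - 1))) (at (?c x))"
        by (auto intro!: derivative_eq_intros)
      from field_vector_diff_chain_at[OF dc[of x] this] show ?thesis by (simp add: o_def)
    qed
    from has_vector_derivative_mult[OF this double[OF x]]
    have "((\<lambda>t. poly p (?c t)) has_vector_derivative 0) (at x)"
      unfolding pf using simple[of x] x by simp
    ultimately have "(2 * pi * \<i> * ?c x) * poly (pderiv p) (?c x) = 0"
      by (rule vector_derivative_unique_at)
    then show ?thesis by simp
  qed
  have "p = 0"
  proof (rule ccontr)
    assume p0: "p \<noteq> 0"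
    have inj: "inj_on ?c (Z \<union> Z')"
      using Z(2) Z'(2) by (intro inj_onI cis_2pi_inj) auto
    have o2: "order (?c x) p \<ge> 2" if "x \<in> Z" for x
    proof -
      have "order (?c x) p \<noteq> 0"
        using root[of x] that p0 by (simp add: order_root)
      moreover have "pderiv p \<noteq> 0"
      proof
        assume "pderiv p = 0"
        then have "degree p = 0" by (simp add: pderiv_eq_0_iff)
        then obtain a where "p = [:a:]" by (rule degree_eq_zeroE)
        then show False using root[of x] that p0 by simp
      qed
      moreover have "order (?c x) (pderiv p) \<noteq> 0"
        using droot[OF that] \<open>pderiv p \<noteq> 0\<close> by (simp add: order_root)
      ultimately show ?thesis
        using order_pderiv[OF p0 root[of x]] that by simp
    qed
    have o1: "order (?c x) p \<ge> 1" if "x \<in> Z'" for x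
      using root[of x] that p0 by (simp add: order_root Suc_leI)
    have "2 * card Z + card Z' = (\<Sum>x\<in>Z. 2) + (\<Sum>x\<in>Z'. 1)" by simp
    also have "\<dots> \<le> (\<Sum>x\<in>Z. order (?c x) p) + (\<Sum>x\<in>Z'. order (?c x) p)"
      using o1 o2 by (intro add_mono sum_mono) auto
    also have "\<dots> = (\<Sum>x\<in>Z \<union> Z'. order (?c x) p)"
      using Z(1) Z' by (simp add: sum.union_disjoint)
    also have "\<dots> = (\<Sum>w\<in>?c ` (Z \<union> Z'). order w p)"
      by (simp add: sum.reindex[OF inj])
    also have "\<dots> \<le> (\<Sum>w | poly p w = 0. order w p)"
      using root by (intro sum_mono2 poly_roots_finite p0) auto
    also have "\<dots> \<le> degree p" by (rule sum_order_le_degree[OF p0])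
    finally show False using p Z(3) by linarith
  qed
  then show ?thesis
    using f by auto
qed

lemma trig_polys_diff:
  assumes "f \<in> trig_polys n" "g \<in> trig_polys n"
  shows "(\<lambda>z. f z - g z) \<in> trig_polys n"
proof -
  obtain a b :: "int \<Rightarrow> complex" where
    "f = (\<lambda>z. \<Sum>k = - int n..int n. a k * exp (2 * of_real pi * \<i> * of_int k * z))"
    "g = (\<lambda>z. \<Sum>k = - int n..int n. b k * exp (2 * of_real pi * \<i> * of_int k * z))"
    using assms by (auto simp: trig_polys_def)
  then have "(\<lambda>z. f z - g z) = (\<lambda>z. \<Sum>k = - int n..int n. (a k - b k) * exp (2 * of_real pi * \<i> * of_int k * z))"
    by (simp add: fun_eq_iff sum_subtractf left_diff_distrib)
  then show ?thesis
    unfolding trig_polys_def mem_Collect_eq by (rule exI[where x = "\<lambda>k. a k - b k"])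
qed

lemma trig_polys_differentiable:
  assumes "f \<in> trig_polys n"
  obtains v where "((\<lambda>t. f (of_real t)) has_vector_derivative v) (at x)"
proof -
  obtain a :: "int \<Rightarrow> complex" where
    f: "f = (\<lambda>z. \<Sum>k = - int n..int n. a k * exp (2 * of_real pi * \<i> * of_int k * z))"
    using assms by (auto simp: trig_polys_def)
  have "(f has_field_derivative
      (\<Sum>k = - int n..int n. a k * (exp (2 * of_real pi * \<i> * of_int k * of_real x) * (2 * of_real pi * \<i> * of_int k)))) (at (of_real x))"
    unfolding f by (auto intro!: derivative_eq_intros sum.cong)
  then have "((\<lambda>t. f (of_real t)) has_vector_derivative
      (\<Sum>k = - int n..int n. a k * (exp (2 * of_real pi * \<i> * of_int k * of_real x) * (2 * of_real pi * \<i> * of_int k)))) (at x)"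
    by (rule has_vector_derivative_real_field)
  then show ?thesis by (rule that)
qed

text \<open>Subtracting M w makes \<open>x\<close> a local minimum without changing the derivative
  there. Only a lower bound for \<open>d\<close> is needed, so nothing has to be known about
  derivatives of h.\<close>

lemma derivative_zero_of_touching:
  fixes d w :: "real \<Rightarrow> real"
  assumes d: "(d has_real_derivative d') (at x)" "d x = 0"
    and w: "(w has_real_derivative 0) (at x)" "w x = 0"
    and "\<delta> > 0" and le: "\<And>y. \<bar>x - y\<bar> < \<delta> \<Longrightarrow> M * w y \<le> d y"
  shows "d' = 0"
proof (rule DERIV_local_min)
  show "((\<lambda>y. d y - M * w y) has_real_derivative d') (at x)"
    using d(1) w(1) by (auto intro!: derivative_eq_intros)
  show "\<forall>y. \<bar>x - y\<bar> < \<delta> \<longrightarrow> d x - M * w x \<le> d y - M * w y"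
    using le d(2) w(2) by auto
qed fact

section \<open>The variable s along the real line and contact at the nodes\<close>

definition height :: "real \<Rightarrow> real" where
  "height x = 1 + cos (2 * pi * x)"

lemma height_bounds: "0 \<le> height x" "height x \<le> 2"
  using cos_ge_minus_one[of "2 * pi * x"] cos_le_one[of "2 * pi * x"]
  unfolding height_def by linarith+

lemma height_half: "height (1 / 2) = 0"
  by (simp add: height_def)

lemma height_0: "height 0 = 2"
  by (simp add: height_def)

lemma height_less_2:
  assumes "0 < x" "x < 1"
  shows "height x < 2"
proof -
  have "cos (2 * pi * x) \<noteq> 1"
  proof
    assume *: "cos (2 * pi * x) = 1"
    then have "sin (2 * pi * x) = 0"
      using sin_cos_squared_add[of "2 * pi * x"] by simp
    then have "cis (2 * pi * x) = cis (2 * pi * 0)"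
      using * by (simp add: complex_eq_iff)
    then show False
      using cis_2pi_inj[of x 0] assms by simp
  qed
  then show ?thesis
    using cos_le_one[of "2 * pi * x"] by (simp add: height_def less_le)
qed

lemma height_reflect: "height (1 - x) = height x"
proof -
  have "2 * pi * (1 - x) = 2 * pi - 2 * pi * x" by (simp add: algebra_simps)
  then show ?thesis by (simp add: height_def cos_diff)
qed

lemma height_derivative: "(height has_real_derivative (- 2 * pi * sin (2 * pi * x))) (at x)"
  unfolding height_def by (auto intro!: derivative_eq_intros)

text \<open>Staying below some t < 2 keeps the quotient series, which may blow up at 2, bounded in a
  neighbourhood of the node.\<close>

lemma height_near:
  assumes "height x < 2"
  obtains t \<delta> where "t < 2" "\<delta> > 0" "\<And>y. \<bar>x - y\<bar> < \<delta> \<Longrightarrow> height y \<le> t"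
proof -
  define t where "t = (height x + 2) / 2"
  have t: "height x < t" "t < 2" using assms by (auto simp: t_def)
  have "isCont height x"
    using height_derivative by (rule DERIV_isCont)
  then have "(height \<longlongrightarrow> height x) (at x)" by (simp add: isCont_def)
  then have "eventually (\<lambda>y. height y < t) (at x)"
    using t(1) by (rule order_tendstoD)
  then obtain \<delta> where "\<delta> > 0" "\<And>y. y \<noteq> x \<Longrightarrow> dist y x < \<delta> \<Longrightarrow> height y < t"
    by (auto simp: eventually_at)
  then have "height y \<le> t" if "\<bar>x - y\<bar> < \<delta>" for y
    using that t(1) by (cases "y = x") (auto simp: dist_real_def abs_minus_commute less_imp_le)
  then show ?thesis using that t(2) \<open>\<delta> > 0\<close> by blast
qed

context even_para
begin

definition interior_nodes :: "real set" where
  "interior_nodes = {\<xi> \<in> nodes. 0 < \<xi> \<and> \<xi> < 1 / 2}"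

text \<open>A height in the interior is listed twice and serves both \<xi> and 1 - \<xi>. The height
  0 of the node 1/2 is listed once, since \<open>height\<close> itself vanishes there to second
  order. The node 0 is left to a separate factor s - 2.\<close>

definition contact_heights :: "real list" where
  "contact_heights = concat (map (\<lambda>\<xi>. [height \<xi>, height \<xi>]) (sorted_list_of_set interior_nodes)) @
     (if 1 / 2 \<in> nodes then [0] else [])"

definition contact :: "real \<Rightarrow> real" where
  "contact u = (\<Prod>r\<leftarrow>contact_heights. u - r)"

lemma finite_interior: "finite interior_nodes"
  unfolding interior_nodes_def using finite_nodes by simp

lemma nodes_bounds: "\<xi> \<in> nodes \<Longrightarrow> 0 \<le> \<xi> \<and> \<xi> < 1"
  by (simp add: torus_zeros_def)

lemma node_cases:
  assumes "\<xi> \<in> nodes" "\<xi> \<noteq> 0"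
  shows "\<xi> \<in> interior_nodes \<or> 1 - \<xi> \<in> interior_nodes \<or> \<xi> = 1 / 2"
  using nodes_reflect[OF assms] nodes_bounds[OF assms(1)] assms
  by (auto simp: interior_nodes_def)

text \<open>Each repeated height stands for a pair of reflected nodes, so the list has as many
  entries as there are nodes other than 0.\<close>

lemma length_contact_heights: "Suc n = length contact_heights + (if 0 \<in> nodes then 1 else 0)"
proof -
  let ?R = "(\<lambda>\<xi>. 1 - \<xi>) ` interior_nodes"
  let ?h = "nodes \<inter> {1 / 2}" and ?z = "nodes \<inter> {0}"
  have eq: "nodes = (interior_nodes \<union> ?R) \<union> (?h \<union> ?z)"
  proof (intro equalityI subsetI)
    fix \<xi> assume "\<xi> \<in> nodes"
    then show "\<xi> \<in> (interior_nodes \<union> ?R) \<union> (?h \<union> ?z)"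
      using node_cases[of \<xi>] by (auto simp: image_iff intro: bexI[of _ "1 - \<xi>"])
  next
    fix \<xi> assume "\<xi> \<in> (interior_nodes \<union> ?R) \<union> (?h \<union> ?z)"
    then show "\<xi> \<in> nodes"
      using nodes_reflect by (auto simp: interior_nodes_def)
  qed
  have "card nodes = card ((interior_nodes \<union> ?R) \<union> (?h \<union> ?z))"
    using eq by simp
  also have "\<dots> = (card interior_nodes + card ?R) + (card ?h + card ?z)"
    using finite_interior
    by (subst card_Un_disjoint, simp, simp, force simp: interior_nodes_def)
      (intro arg_cong2[where f = "(+)"] card_Un_disjoint, auto simp: interior_nodes_def)
  also have "card ?R = card interior_nodes"
    by (rule card_image) (simp add: inj_on_def)
  finally have "Suc n = 2 * card interior_nodes + (card ?h + card ?z)"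
    using card_nodes by simp
  moreover have "length contact_heights = 2 * card interior_nodes + card ?h"
  proof -
    have "length (concat (map (\<lambda>\<xi>. [height \<xi>, height \<xi>]) xs)) = 2 * length xs" for xs
      by (induction xs) auto
    then show ?thesis by (simp add: contact_heights_def)
  qed
  moreover have "card ?z = (if 0 \<in> nodes then 1 else 0)" by simp
  ultimately show ?thesis by simp
qed

lemma contact_heights_range: "\<forall>r\<in>set contact_heights. 0 \<le> r \<and> r < 2"
  using finite_interior height_bounds(1) height_less_2
  by (auto simp: contact_heights_def interior_nodes_def split: if_splits)

lemma contact_eq:
  "contact u = (\<Prod>\<xi>\<in>interior_nodes. u - height \<xi>)\<^sup>2 * (if 1 / 2 \<in> nodes then u else 1)"
proof -
  have "(\<Prod>r\<leftarrow>concat (map (\<lambda>\<xi>. [height \<xi>, height \<xi>]) xs). u - r) = (\<Prod>\<xi>\<leftarrow>xs. u - height \<xi>)\<^sup>2" for xs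
    by (induction xs) (simp_all add: power2_eq_square mult_ac)
  moreover have "(\<Prod>\<xi>\<leftarrow>sorted_list_of_set interior_nodes. u - height \<xi>) = (\<Prod>\<xi>\<in>interior_nodes. u - height \<xi>)"
    using prod.distinct_set_conv_list[of "sorted_list_of_set interior_nodes" "\<lambda>\<xi>. u - height \<xi>"] finite_interior
    by simp
  ultimately show ?thesis
    by (simp add: contact_def contact_heights_def)
qed

lemma contact_nonneg: "0 \<le> u \<Longrightarrow> 0 \<le> contact u"
  by (simp add: contact_eq)

text \<open>The function is B^2 E with B the product over the interior heights. At an interior node
  or its reflection B = 0; at 1/2 both E and its derivative vanish. Either way 2 B B' E + B^2 E' =
  0.\<close>

lemma contact_node:
  assumes "\<xi> \<in> nodes" "\<xi> \<noteq> 0"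
  shows "contact (height \<xi>) = 0" "((\<lambda>x. contact (height x)) has_real_derivative 0) (at \<xi>)"
proof -
  define B where "B x = (\<Prod>\<eta>\<in>interior_nodes. height x - height \<eta>)" for x
  define E where "E x = (if 1 / 2 \<in> nodes then height x else 1)" for x
  have c: "contact (height x) = (B x)\<^sup>2 * E x" for x
    by (simp add: contact_eq B_def E_def)
  obtain B' where B': "(B has_real_derivative B') (at \<xi>)"
  proof -
    have "\<exists>D. ((\<lambda>x. \<Prod>\<eta>\<in>S. height x - height \<eta>) has_real_derivative D) (at \<xi>)" if "finite S" for S
      using that
    proof induction
      case empty
      show ?case by (auto intro!: exI[of _ 0])
    next
      case (insert \<eta> S)
      then obtain D where D: "((\<lambda>x. \<Prod>\<eta>\<in>S. height x - height \<eta>) has_real_derivative D) (at \<xi>)"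
        by blast
      show ?case
        using DERIV_mult[OF DERIV_diff[OF height_derivative[of \<xi>] DERIV_const[of "height \<eta>" "at \<xi>"]] D] insert.hyps
        by auto
    qed
    from this[OF finite_interior] show ?thesis
      using that unfolding B_def[abs_def] by blast
  qed
  obtain E' where E': "(E has_real_derivative E') (at \<xi>)" "\<xi> = 1 / 2 \<Longrightarrow> E' = 0"
  proof (cases "1 / 2 \<in> nodes")
    case True
    then have "E = height" by (simp add: E_def fun_eq_iff)
    moreover have "- 2 * pi * sin (2 * pi * \<xi>) = 0" if "\<xi> = 1 / 2" unfolding that by simp
    ultimately show ?thesis using that height_derivative[of \<xi>] by blast
  next
    case False
    then have "E = (\<lambda>_. 1)" by (simp add: E_def fun_eq_iff)
    then show ?thesis using that[of 0] by simp
  qed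
  have D: "((\<lambda>x. contact (height x)) has_real_derivative (2 * B \<xi> * B' * E \<xi> + (B \<xi>)\<^sup>2 * E')) (at \<xi>)"
    unfolding c using B' E'(1) by (auto intro!: derivative_eq_intros)
  have BE: "B \<xi> = 0 \<or> (\<xi> = 1 / 2 \<and> E \<xi> = 0)"
  proof (cases "\<xi> = 1 / 2")
    case True
    then show ?thesis using assms(1) height_half unfolding True E_def by simp
  next
    case False
    then obtain \<eta> where "\<eta> \<in> interior_nodes" "height \<xi> = height \<eta>"
      using node_cases[OF assms] height_reflect by metis
    then show ?thesis
      using finite_interior by (auto simp: B_def)
  qed
  then show "contact (height \<xi>) = 0" by (auto simp: c)
  show "((\<lambda>x. contact (height x)) has_real_derivative 0) (at \<xi>)"
    using D BE E'(2) by auto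
qed

text \<open>Of the n + 1 nodes all but possibly 0 are double zeros of the difference, which makes at
  least 2n + 1 zeros in a period against a maximum of 2n. The assumption \<open>le\<close> excludes
  0 because no such bound is available where s = 2.\<close>

lemma trig_poly_unique:
  assumes f: "f \<in> trig_polys n" "real_on_line f" and g: "g \<in> trig_polys n" "real_on_line g"
    and eq: "\<And>\<xi>. \<xi> \<in> nodes \<Longrightarrow> Re (f (of_real \<xi>)) = Re (g (of_real \<xi>))"
    and le: "\<And>\<xi>. \<xi> \<in> nodes \<Longrightarrow> \<xi> \<noteq> 0 \<Longrightarrow>
      \<exists>M \<delta>. \<delta> > 0 \<and> (\<forall>y. \<bar>\<xi> - y\<bar> < \<delta> \<longrightarrow> M * contact (height y) \<le> Re (f (of_real y)) - Re (g (of_real y)))"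
  shows "f = g"
proof -
  define D where "D z = f z - g z" for z
  have D: "D \<in> trig_polys n"
    unfolding D_def[abs_def] by (rule trig_polys_diff[OF f(1) g(1)])
  have Dreal: "D (of_real x) = of_real (Re (D (of_real x)))" for x
    using f(2) g(2) by (simp add: real_on_line_def D_def)
  have "D = (\<lambda>_. 0)"
  proof (rule trig_poly_zero[OF D])
    show "finite (nodes - {0})" "finite (nodes \<inter> {0})" using finite_nodes by auto
    show "nodes - {0} \<subseteq> {0..<1}" "nodes \<inter> {0} \<subseteq> {0..<1}" "(nodes - {0}) \<inter> (nodes \<inter> {0}) = {}"
      using nodes_bounds by auto
    have "card (nodes - {0}) + card (nodes \<inter> {0}) = Suc n"
    proof (cases "0 \<in> nodes")
      case True
      then have "nodes \<inter> {0} = {0}" by auto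
      then show ?thesis using True card_nodes by (simp add: card_Diff_singleton)
    next
      case False
      then have "nodes \<inter> {0} = {}" "nodes - {0} = nodes" by auto
      then show ?thesis using card_nodes by simp
    qed
    moreover have "card (nodes \<inter> {0}) \<le> 1"
      by (metis Int_lower2 card.empty card_insert_disjoint card_mono empty_iff finite.emptyI finite_insert One_nat_def)
    ultimately show "2 * n < 2 * card (nodes - {0}) + card (nodes \<inter> {0})" by linarith
    show "D (of_real x) = 0" if "x \<in> (nodes - {0}) \<union> (nodes \<inter> {0})" for x
    proof -
      have "Re (D (of_real x)) = 0" using eq[of x] that by (auto simp: D_def)
      then show ?thesis using Dreal[of x] by simp
    qed
    show "((\<lambda>t. D (of_real t)) has_vector_derivative 0) (at x)" if x: "x \<in> nodes - {0}" for x
    proof -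
      obtain v where v: "((\<lambda>t. D (of_real t)) has_vector_derivative v) (at x)"
        using trig_polys_differentiable[OF D] .
      have dRe: "((\<lambda>t. Re (D (of_real t))) has_real_derivative Re v) (at x)"
        and dIm: "((\<lambda>t. Im (D (of_real t))) has_real_derivative Im v) (at x)"
        using v by (simp_all add: has_vector_derivative_complex_iff)
      obtain M \<delta> where "\<delta> > 0" and M: "\<And>y. \<bar>x - y\<bar> < \<delta> \<Longrightarrow> M * contact (height y) \<le> Re (D (of_real y))"
        using le[of x] x by (auto simp: D_def)
      have "Re v = 0"
        by (rule derivative_zero_of_touching[OF dRe _ contact_node(2) contact_node(1) \<open>\<delta> > 0\<close> M])
          (use x eq in \<open>auto simp: D_def\<close>)
      moreover have "Im v = 0"
      proof -
        have "(\<lambda>t. Im (D (of_real t))) = (\<lambda>_. 0)"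
          using Dreal by (metis Im_complex_of_real)
        then show ?thesis using dIm by (metis DERIV_const DERIV_unique)
      qed
      ultimately have "v = 0" by (simp add: complex_eq_iff)
      then show ?thesis using v by simp
    qed
  qed
  then show ?thesis by (auto simp: D_def fun_eq_iff)
qed

section \<open>Equality in the quadrature and the two extremal problems\<close>

lemma quadrature_sum_real:
  assumes "\<And>\<xi>. \<xi> \<in> nodes \<Longrightarrow> h \<xi> = ereal (H \<xi>)"
  shows "quadrature_sum \<phi> n nodes h = ereal (\<Sum>\<xi>\<in>nodes. H \<xi> / kernel_value \<xi>)"
proof -
  have "quadrature_sum \<phi> n nodes h = (\<Sum>\<xi>\<in>nodes. ereal (H \<xi> / kernel_value \<xi>))"
    unfolding quadrature_sum_def
  proof (intro sum.cong refl)
    fix \<xi> assume "\<xi> \<in> nodes"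
    then show "h \<xi> / ereal (kernel_value \<xi>) = ereal (H \<xi> / kernel_value \<xi>)"
      using kernel_value_pos[of \<xi>] assms[of \<xi>] by simp
  qed
  then show ?thesis by simp
qed

lemma cos_poly_on_line:
  "Re (poly (map_poly of_real P) (1 + cos (2 * of_real pi * complex_of_real x))) = poly P (height x)"
  by (simp add: poly_of_real_cos height_def)

lemma equal_at_nodes:
  assumes "\<And>\<xi>. \<xi> \<in> nodes \<Longrightarrow> F \<xi> \<le> G \<xi>"
    and "(\<Sum>\<xi>\<in>nodes. F \<xi> / kernel_value \<xi>) = (\<Sum>\<xi>\<in>nodes. G \<xi> / kernel_value \<xi>)" "\<xi> \<in> nodes"
  shows "F \<xi> = G \<xi>"
proof -
  have "(\<Sum>\<xi>\<in>nodes. (G \<xi> - F \<xi>) / kernel_value \<xi>) = 0"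
    using assms(2) by (simp add: diff_divide_distrib sum_subtractf)
  moreover have "0 \<le> (G \<xi> - F \<xi>) / kernel_value \<xi>" if "\<xi> \<in> nodes" for \<xi>
    using assms(1)[OF that] kernel_value_pos[OF that] by simp
  ultimately have "(G \<xi> - F \<xi>) / kernel_value \<xi> = 0"
    using assms(3) finite_nodes by (simp add: sum_nonneg_eq_0_iff)
  then show ?thesis
    using kernel_value_pos[OF assms(3)] by simp
qed

lemma torus_integral_cos_poly:
  assumes "\<And>i. n < i \<Longrightarrow> coeff P i = 0"
  shows "torus_integral \<theta> (\<lambda>z. poly (map_poly of_real P) (1 + cos (2 * of_real pi * z))) =
    (\<Sum>\<xi>\<in>nodes. poly P (height \<xi>) / kernel_value \<xi>)"
  by (subst torus_quadrature[OF poly_cos_trig_polys[OF assms]]) (simp_all only: cos_poly_on_line)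

lemma minorant_theorem:
  assumes eps: "\<epsilon> = 1" and sets: "sets \<sigma> = sets (restrict_space borel {0<..})"
    and fin: "\<And>a::real. a > 0 \<Longrightarrow> (\<integral>\<^sup>+l. ennreal (l powr (- 1 / 2) * exp (- pi / l - a * l)) \<partial>\<sigma>) < \<infinity>"
  shows "\<forall>f \<in> trig_polys n. minorant f (gauss_h \<sigma>) \<longrightarrow>
      ereal (torus_integral \<theta> f) \<le> quadrature_sum \<phi> n nodes (gauss_h \<sigma>)"
    and "\<exists>!f. f \<in> trig_polys n \<and> minorant f (gauss_h \<sigma>) \<and>
      ereal (torus_integral \<theta> f) = quadrature_sum \<phi> n nodes (gauss_h \<sigma>)"
proof -
  obtain c where c: "absolutely_monotone_coeffs c"
    and c1: "\<And>x. cos (2 * pi * x) < 1 \<Longrightarrow> gauss_h \<sigma> x = ereal (power_sum c (1 + cos (2 * pi * x)))"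
    and c2: "\<And>x s. 0 \<le> s \<Longrightarrow> s < 2 \<Longrightarrow> s \<le> 1 + cos (2 * pi * x) \<Longrightarrow> ereal (power_sum c s) \<le> gauss_h \<sigma> x"
    using gauss_h_interior[OF sets fin] by metis
  have h: "gauss_h \<sigma> x = ereal (power_sum c (height x))" if "height x < 2" for x
    using c1[of x] that by (simp add: height_def)
  have zero: "0 \<notin> nodes" using zero_in_nodes eps by auto
  have node2: "height \<xi> < 2" if "\<xi> \<in> nodes" for \<xi>
    using nodes_bounds[OF that] zero that by (intro height_less_2) (auto simp: less_le)
  obtain P b where P0: "\<And>i. length contact_heights \<le> i \<Longrightarrow> coeff P i = 0" and b: "absolutely_monotone_coeffs b"
    and P: "\<And>s. 0 \<le> s \<Longrightarrow> s < 2 \<Longrightarrow> power_sum c s = poly P s + contact s * power_sum b s"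
    using interpolation[OF c contact_heights_range] unfolding contact_def by metis
  \<comment> \<open>Here 0 is not a node, so the list of contact heights has length n + 1.\<close>
  have Pn: "coeff P i = 0" if "n < i" for i
    using P0[of i] length_contact_heights zero that by simp
  define L where "L z = poly (map_poly of_real P) (1 + cos (2 * of_real pi * z))" for z :: complex
  have Ltrig: "L \<in> trig_polys n"
    unfolding L_def[abs_def] by (rule poly_cos_trig_polys[OF Pn])
  have Lre: "Re (L (of_real x)) = poly P (height x)" for x
    unfolding L_def by (rule cos_poly_on_line)
  have Lreal: "real_on_line L"
    by (simp add: real_on_line_def L_def poly_of_real_cos)
  have Ple: "poly P s \<le> power_sum c s" if "0 \<le> s" "s < 2" for s
    using P[OF that] contact_nonneg[OF that(1)] power_sum_nonneg[OF b that] by simp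
  have "ereal (poly P (height x)) \<le> gauss_h \<sigma> x" for x
  proof (cases "height x < 2")
    case True
    then show ?thesis using h[OF True] Ple[OF height_bounds(1)] by simp
  next
    case False
    then have x2: "height x = 2" using height_bounds(2)[of x] by simp
    \<comment> \<open>At an integer h may be infinite; each value below s = 2 bounds it from below,
      and continuity of \<open>P\<close> carries the inequality to s = 2.\<close>
    have "ereal (poly P s) \<le> gauss_h \<sigma> x" if "0 \<le> s" "s < 2" for s
      using order_trans[OF _ c2[OF that, of x], of "ereal (poly P s)"] Ple[OF that] x2 that by (simp add: height_def)
    then have ev: "eventually (\<lambda>s. ereal (poly P s) \<le> gauss_h \<sigma> x) (at_left 2)"
      unfolding eventually_at_left[of 0 "2::real", simplified] by (intro exI[of _ 0]) auto
    have "(poly P \<longlongrightarrow> poly P 2) (at_left 2)"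
      by (intro tendsto_intros)
    then have "((\<lambda>s. ereal (poly P s)) \<longlongrightarrow> ereal (poly P 2)) (at_left 2)"
      by (rule tendsto_ereal)
    then show ?thesis
      unfolding x2 by (rule tendsto_upperbound[OF _ ev]) simp
  qed
  then have Lmin: "minorant L (gauss_h \<sigma>)"
    using Lreal by (simp add: minorant_def Lre)
  have quad: "quadrature_sum \<phi> n nodes (gauss_h \<sigma>) = ereal (\<Sum>\<xi>\<in>nodes. power_sum c (height \<xi>) / kernel_value \<xi>)"
    by (rule quadrature_sum_real) (simp add: h node2)
  have fle: "Re (f (of_real \<xi>)) \<le> power_sum c (height \<xi>)" if "minorant f (gauss_h \<sigma>)" "height \<xi> < 2" for f \<xi>
    using that h[of \<xi>] by (simp add: minorant_def) (metis ereal_less_eq(3))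
  show "\<forall>f \<in> trig_polys n. minorant f (gauss_h \<sigma>) \<longrightarrow>
      ereal (torus_integral \<theta> f) \<le> quadrature_sum \<phi> n nodes (gauss_h \<sigma>)"
  proof (intro ballI impI)
    fix f assume "f \<in> trig_polys n" and fm: "minorant f (gauss_h \<sigma>)"
    then show "ereal (torus_integral \<theta> f) \<le> quadrature_sum \<phi> n nodes (gauss_h \<sigma>)"
      unfolding quad ereal_less_eq
      by (simp only: torus_quadrature)
        (intro sum_mono divide_right_mono fle[OF fm] node2 less_imp_le[OF kernel_value_pos])
  qed
  have PH: "poly P (height \<xi>) = power_sum c (height \<xi>)" if "\<xi> \<in> nodes" for \<xi>
    using P[OF height_bounds(1) node2[OF that]] contact_node(1)[OF that] zero that by auto
  show "\<exists>!f. f \<in> trig_polys n \<and> minorant f (gauss_h \<sigma>) \<and>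
      ereal (torus_integral \<theta> f) = quadrature_sum \<phi> n nodes (gauss_h \<sigma>)"
  proof (rule ex1I[of _ L])
    have "torus_integral \<theta> L = (\<Sum>\<xi>\<in>nodes. power_sum c (height \<xi>) / kernel_value \<xi>)"
      unfolding L_def[abs_def] by (subst torus_integral_cos_poly[OF Pn]) (simp_all add: PH)
    then show "L \<in> trig_polys n \<and> minorant L (gauss_h \<sigma>) \<and>
        ereal (torus_integral \<theta> L) = quadrature_sum \<phi> n nodes (gauss_h \<sigma>)"
      using Ltrig Lmin quad by simp
  next
    fix f assume f: "f \<in> trig_polys n \<and> minorant f (gauss_h \<sigma>) \<and>
        ereal (torus_integral \<theta> f) = quadrature_sum \<phi> n nodes (gauss_h \<sigma>)"
    then have fm: "minorant f (gauss_h \<sigma>)" and ft: "f \<in> trig_polys n" by auto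
    have "(\<Sum>\<xi>\<in>nodes. Re (f (of_real \<xi>)) / kernel_value \<xi>) = (\<Sum>\<xi>\<in>nodes. power_sum c (height \<xi>) / kernel_value \<xi>)"
      using f torus_quadrature[OF ft] by (simp add: quad)
    then have fH: "Re (f (of_real \<xi>)) = power_sum c (height \<xi>)" if "\<xi> \<in> nodes" for \<xi>
      using equal_at_nodes[of "\<lambda>\<xi>. Re (f (of_real \<xi>))" "\<lambda>\<xi>. power_sum c (height \<xi>)"] fle[OF fm node2] that by blast
    have "L = f"
    proof (rule trig_poly_unique[OF Ltrig Lreal ft])
      show "real_on_line f" using fm by (simp add: minorant_def)
      show "Re (L (of_real \<xi>)) = Re (f (of_real \<xi>))" if "\<xi> \<in> nodes" for \<xi>
        using that by (simp add: Lre PH fH)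
      fix \<xi> assume "\<xi> \<in> nodes"
      then obtain t \<delta> where t: "t < 2" "\<delta> > 0" "\<And>y. \<bar>\<xi> - y\<bar> < \<delta> \<Longrightarrow> height y \<le> t"
        using height_near[OF node2] by metis
      \<comment> \<open>As f \<le> h, the right side is at least L - h, which is minus the
        remainder; the remainder series is increasing, so its value at \<open>t\<close> serves as a
        constant near the node.\<close>
      have "- power_sum b t * contact (height y) \<le> Re (L (of_real y)) - Re (f (of_real y))"
        if y: "\<bar>\<xi> - y\<bar> < \<delta>" for y
      proof -
        have hy: "height y \<le> t" "height y < 2" using t(1) t(3)[OF y] by auto
        have "contact (height y) * power_sum b (height y) \<le> contact (height y) * power_sum b t"
          by (intro mult_left_mono power_sum_mono[OF b] contact_nonneg height_bounds hy t)
        then show ?thesis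
          using fle[OF fm hy(2)] P[OF height_bounds(1) hy(2)] by (simp add: Lre mult.commute)
      qed
      then show "\<exists>M \<delta>. \<delta> > 0 \<and> (\<forall>y. \<bar>\<xi> - y\<bar> < \<delta> \<longrightarrow> M * contact (height y) \<le> Re (L (of_real y)) - Re (f (of_real y)))"
        using t(2) by blast
    qed
    then show "f = L" by simp
  qed
qed

lemma majorant_theorem:
  assumes eps: "\<epsilon> = - 1" and sets: "sets \<sigma> = sets (restrict_space borel {0<..})"
    and fin: "(\<integral>\<^sup>+l. ennreal ((1 + l powr (- 1 / 2)) * exp (- pi / l)) \<partial>\<sigma>) < \<infinity>"
  shows "\<forall>f \<in> trig_polys n. majorant f (gauss_h \<sigma>) \<longrightarrow>
      ereal (torus_integral \<theta> f) \<ge> quadrature_sum \<phi> n nodes (gauss_h \<sigma>)"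
    and "\<exists>!f. f \<in> trig_polys n \<and> majorant f (gauss_h \<sigma>) \<and>
      ereal (torus_integral \<theta> f) = quadrature_sum \<phi> n nodes (gauss_h \<sigma>)"
proof -
  obtain c where c: "\<And>m. c m \<ge> 0" "summable (\<lambda>m. c m * 2 ^ m)"
    and c1: "\<And>x. gauss_h \<sigma> x = ereal (power_sum c (1 + cos (2 * pi * x)))"
    using gauss_h_everywhere[OF sets fin] by metis
  have h: "gauss_h \<sigma> x = ereal (power_sum c (height x))" for x
    using c1[of x] by (simp add: height_def)
  have zero: "0 \<in> nodes" using zero_in_nodes eps by auto
  note d = divided_coeff_endpoint[OF c]
  obtain P1 b where P0: "\<And>i. length contact_heights \<le> i \<Longrightarrow> coeff P1 i = 0" and b: "absolutely_monotone_coeffs b"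
    and P1: "\<And>s. 0 \<le> s \<Longrightarrow> s < 2 \<Longrightarrow> power_sum (divided_coeff c 2) s = poly P1 s + contact s * power_sum b s"
    using interpolation[OF d(1) contact_heights_range] unfolding contact_def by metis
  \<comment> \<open>One more Newton step with node 2: power_sum c 2 + (s - 2) P1(s).\<close>
  define P where "P = [:power_sum c 2:] + (pCons 0 P1 - smult 2 P1)"
  have P2: "poly P 2 = power_sum c 2" by (simp add: P_def)
  have P: "power_sum c s = poly P s + (s - 2) * (contact s * power_sum b s)" if "0 \<le> s" "s < 2" for s
    unfolding d(2)[OF that] P1[OF that] P_def by (simp add: algebra_simps)
  \<comment> \<open>Here 0 is a node, so the list has length n only and \<open>P1\<close> has no
    coefficient from index n on; the factor s - 2 raises the bound by one. For n = 0 this means P1 =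
    0.\<close>
  have Pn: "coeff P i = 0" if "n < i" for i
    using P0[of i] P0[of "i - 1"] length_contact_heights zero that
    by (cases i) (auto simp: P_def coeff_pCons)
  define L where "L z = poly (map_poly of_real P) (1 + cos (2 * of_real pi * z))" for z :: complex
  have Ltrig: "L \<in> trig_polys n"
    unfolding L_def[abs_def] by (rule poly_cos_trig_polys[OF Pn])
  have Lre: "Re (L (of_real x)) = poly P (height x)" for x
    unfolding L_def by (rule cos_poly_on_line)
  have Lreal: "real_on_line L"
    by (simp add: real_on_line_def L_def poly_of_real_cos)
  \<comment> \<open>The remainder formula is confined to s < 2, where s - 2 makes the remainder
    nonpositive; at s = 2 the polynomial agrees with the series by construction.\<close>
  have Ple: "power_sum c s \<le> poly P s" if "0 \<le> s" "s \<le> 2" for s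
  proof (cases "s = 2")
    case False
    then have s: "0 \<le> s" "s < 2" using that by auto
    have "(s - 2) * (contact s * power_sum b s) \<le> 0"
      using s contact_nonneg[OF s(1)] power_sum_nonneg[OF b s] by (intro mult_nonpos_nonneg mult_nonneg_nonneg) auto
    then show ?thesis using P[OF s] by simp
  qed (simp add: P2)
  then have Lmaj: "majorant L (gauss_h \<sigma>)"
    using Lreal height_bounds by (simp add: majorant_def Lre h)
  have quad: "quadrature_sum \<phi> n nodes (gauss_h \<sigma>) = ereal (\<Sum>\<xi>\<in>nodes. power_sum c (height \<xi>) / kernel_value \<xi>)"
    by (rule quadrature_sum_real) (simp add: h)
  have fge: "power_sum c (height \<xi>) \<le> Re (f (of_real \<xi>))" if "majorant f (gauss_h \<sigma>)" for f \<xi>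
    using that by (simp add: majorant_def h)
  show "\<forall>f \<in> trig_polys n. majorant f (gauss_h \<sigma>) \<longrightarrow>
      ereal (torus_integral \<theta> f) \<ge> quadrature_sum \<phi> n nodes (gauss_h \<sigma>)"
  proof (intro ballI impI)
    fix f assume "f \<in> trig_polys n" and fm: "majorant f (gauss_h \<sigma>)"
    then show "quadrature_sum \<phi> n nodes (gauss_h \<sigma>) \<le> ereal (torus_integral \<theta> f)"
      unfolding quad ereal_less_eq
      by (simp only: torus_quadrature)
        (intro sum_mono divide_right_mono fge[OF fm] less_imp_le[OF kernel_value_pos])
  qed
  have node2: "height \<xi> < 2" if "\<xi> \<in> nodes" "\<xi> \<noteq> 0" for \<xi>
    using nodes_bounds[OF that(1)] that(2) by (intro height_less_2) (auto simp: less_le)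
  have PH: "poly P (height \<xi>) = power_sum c (height \<xi>)" if "\<xi> \<in> nodes" for \<xi>
  proof (cases "\<xi> = 0")
    case True
    then show ?thesis by (simp add: height_0 P2)
  next
    case False
    then show ?thesis
      using P[OF height_bounds(1) node2[OF that False]] contact_node(1)[OF that False] by simp
  qed
  show "\<exists>!f. f \<in> trig_polys n \<and> majorant f (gauss_h \<sigma>) \<and>
      ereal (torus_integral \<theta> f) = quadrature_sum \<phi> n nodes (gauss_h \<sigma>)"
  proof (rule ex1I[of _ L])
    have "torus_integral \<theta> L = (\<Sum>\<xi>\<in>nodes. power_sum c (height \<xi>) / kernel_value \<xi>)"
      unfolding L_def[abs_def] by (subst torus_integral_cos_poly[OF Pn]) (simp_all add: PH)
    then show "L \<in> trig_polys n \<and> majorant L (gauss_h \<sigma>) \<and>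
        ereal (torus_integral \<theta> L) = quadrature_sum \<phi> n nodes (gauss_h \<sigma>)"
      using Ltrig Lmaj quad by simp
  next
    fix f assume f: "f \<in> trig_polys n \<and> majorant f (gauss_h \<sigma>) \<and>
        ereal (torus_integral \<theta> f) = quadrature_sum \<phi> n nodes (gauss_h \<sigma>)"
    then have fm: "majorant f (gauss_h \<sigma>)" and ft: "f \<in> trig_polys n" by auto
    have "(\<Sum>\<xi>\<in>nodes. power_sum c (height \<xi>) / kernel_value \<xi>) = (\<Sum>\<xi>\<in>nodes. Re (f (of_real \<xi>)) / kernel_value \<xi>)"
      using f torus_quadrature[OF ft] by (simp add: quad)
    then have fH: "power_sum c (height \<xi>) = Re (f (of_real \<xi>))" if "\<xi> \<in> nodes" for \<xi>
      using equal_at_nodes[of "\<lambda>\<xi>. power_sum c (height \<xi>)" "\<lambda>\<xi>. Re (f (of_real \<xi>))"] fge[OF fm] that by blast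
    show "f = L"
    proof (rule trig_poly_unique[OF ft _ Ltrig Lreal])
      show "real_on_line f" using fm by (simp add: majorant_def)
      show "Re (f (of_real \<xi>)) = Re (L (of_real \<xi>))" if "\<xi> \<in> nodes" for \<xi>
        using that by (simp add: Lre PH fH)
      fix \<xi> assume "\<xi> \<in> nodes" "\<xi> \<noteq> 0"
      then obtain t \<delta> where t: "t < 2" "\<delta> > 0" "\<And>y. \<bar>\<xi> - y\<bar> < \<delta> \<Longrightarrow> height y \<le> t"
        using height_near[OF node2] by metis
      \<comment> \<open>As f \<ge> h, the right side is at least h - L, which is the remainder with
        its factor s - 2; the 2 bounds 2 - s.\<close>
      have "- 2 * power_sum b t * contact (height y) \<le> Re (f (of_real y)) - Re (L (of_real y))"
        if y: "\<bar>\<xi> - y\<bar> < \<delta>" for y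
      proof -
        have hy: "height y \<le> t" "height y < 2" using t(1) t(3)[OF y] by auto
        have t0: "0 \<le> t" using hy(1) height_bounds(1)[of y] by linarith
        have "(2 - height y) * (contact (height y) * power_sum b (height y)) \<le> 2 * (contact (height y) * power_sum b t)"
          using hy(2) power_sum_nonneg[OF b height_bounds(1) hy(2)]
          by (intro mult_mono mult_left_mono power_sum_mono[OF b] contact_nonneg height_bounds hy t mult_nonneg_nonneg)
            (use height_bounds(1)[of y] in auto)
        then show ?thesis
          using fge[OF fm, of y] P[OF height_bounds(1) hy(2)] by (simp add: Lre algebra_simps)
      qed
      then show "\<exists>M \<delta>. \<delta> > 0 \<and> (\<forall>y. \<bar>\<xi> - y\<bar> < \<delta> \<longrightarrow> M * contact (height y) \<le> Re (f (of_real y)) - Re (L (of_real y)))"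
        using t(2) by blast
    qed
  qed
qed

end

theorem theorem19:
  fixes n :: nat
    and \<theta> \<sigma> :: "real measure"
    and \<phi> :: "nat \<Rightarrow> complex poly"
  assumes theta_prob: "prob_space \<theta>"
    and theta_sets: "sets \<theta> = sets torus_borel"
    and theta_nontrivial: "nontrivial_measure \<theta>"
    and theta_even: "even_measure \<theta>"
    and phi: "orthonormal_polys \<theta> \<phi>"
    and sigma_sets: "sets \<sigma> = sets (restrict_space borel {0<..})"
  shows
    "((\<forall>a::real. a > 0 \<longrightarrow>
          (\<integral>\<^sup>+l. ennreal (l powr (- 1 / 2) * exp (- pi / l - a * l)) \<partial>\<sigma>) < \<infinity>) \<longrightarrow>
        (\<forall>f \<in> trig_polys n. minorant f (gauss_h \<sigma>) \<longrightarrow>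
           ereal (torus_integral \<theta> f)
             \<le> quadrature_sum \<phi> n (torus_zeros (companion_A \<phi> (n + 1))) (gauss_h \<sigma>)) \<and>
        (\<exists>!f. f \<in> trig_polys n \<and> minorant f (gauss_h \<sigma>) \<and>
           ereal (torus_integral \<theta> f)
             = quadrature_sum \<phi> n (torus_zeros (companion_A \<phi> (n + 1))) (gauss_h \<sigma>))) \<and>
     ((\<integral>\<^sup>+l. ennreal ((1 + l powr (- 1 / 2)) * exp (- pi / l)) \<partial>\<sigma>) < \<infinity> \<longrightarrow>
        (\<forall>f \<in> trig_polys n. majorant f (gauss_h \<sigma>) \<longrightarrow>
           ereal (torus_integral \<theta> f)
             \<ge> quadrature_sum \<phi> n (torus_zeros (companion_B \<phi> (n + 1))) (gauss_h \<sigma>)) \<and>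
        (\<exists>!f. f \<in> trig_polys n \<and> majorant f (gauss_h \<sigma>) \<and>
           ereal (torus_integral \<theta> f)
             = quadrature_sum \<phi> n (torus_zeros (companion_B \<phi> (n + 1))) (gauss_h \<sigma>)))"
proof -
  have base: "even_para \<theta> \<phi> \<epsilon>" if "\<epsilon> = 1 \<or> \<epsilon> = - 1" for \<epsilon>
    using assms that
    by (simp add: even_para_def even_opuc_def even_opuc_axioms_def para_orthogonal_def para_orthogonal_axioms_def
        opuc_def opuc_axioms_def circle_prob_def circle_prob_axioms_def)
  interpret A: even_para \<theta> \<phi> n 1 by (rule base) simp
  interpret B: even_para \<theta> \<phi> n "- 1" by (rule base) simp
  have "torus_zeros (companion_A \<phi> (n + 1)) = torus_zeros A.para"
    by (simp add: torus_zeros_def companion_A_def A.para_def)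
  moreover have "torus_zeros (companion_B \<phi> (n + 1)) = torus_zeros B.para"
    by (simp add: torus_zeros_def companion_B_def B.para_def)
  ultimately show ?thesis
    using A.minorant_theorem[OF refl sigma_sets] B.majorant_theorem[OF refl sigma_sets] by auto
qed

end
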